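(* Let $B$ be the topological space, $\tilde\phi:B\to B$ the piecewise defined map, $\gamma_1,\gamma_2$ the loops and $p^1,p^2$ the paths defined in the context. Then: (1) $\pi_1(B,(1,\tfrac12))$ (base point in $A_0$) is generated by $[\gamma_1],[\gamma_2]$, and $a\mapsto[\gamma_1]$, $b\mapsto[\gamma_2]$ defines an isomorphism $BS(2,3)=\langle a,b\mid ba^2=a^3b\rangle\cong\pi_1(B,(1,\tfrac12))$. (2) $\tilde\phi$ is well defined and continuous on $B$, hence induces a homomorphism $\tilde\phi_*:\pi_1(B,(1,\tfrac12))\to\pi_1(B,(1,\tfrac32))$ (the second base point lying in $A_1$). (3) Under the identification in (1), $\operatorname{Ker}(\tilde\phi_* )=\operatorname{Ker}(\phi)=\operatorname{Ker}(\phi')$, where $\phi,\phi':BS(2,3)\to BS(2,3)$ are the homomorphisms with $\phi(a)=a^2$, $\phi(b)=b$ and $\phi'(a)=a^3$, $\phi'(b)=b$. (4) Under the identification in (1), $p^1_*\circ\tilde\phi_*=\phi$ and $p^2_*\circ\tilde\phi_*=\phi'$.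
   Context: The space $B$ is built from two circles $S_0,S_1$ and two annuli $A_0=S_a^0\times[0,1]$, $A_1=S_a^1\times[1,2]$ (all circles being the unit circle in $\mathbb{C}$) by the following gluings: $S_a^0\times\{0\}$ is attached to $S_0$ and $S_a^0\times\{1\}$ is attached to $S_1$, both along $e^{i\theta}\mapsto e^{i\theta}$; $S_a^1\times\{1\}$ is attached to $S_0$ along $e^{i\theta}\mapsto e^{3i\theta}$ and $S_a^1\times\{2\}$ is attached to $S_1$ along $e^{i\theta}\mapsto e^{2i\theta}$. Loops at $(1,\tfrac12)\in A_0$: $\gamma_1(\theta)=(e^{2\pi i\theta},\tfrac12)$ in $A_0$ for $\theta\in[0,1]$; and $\gamma_2:[0,1]\to B$ is given by $\gamma_2(x)=(1,\tfrac12-2x)\in A_0$ for $x\in[0,\tfrac14]$, $\gamma_2(x)=(1,1+2x-\tfrac12)\in A_1$ for $x\in[\tfrac14,\tfrac34]$, and $\gamma_2(x)=(1,\tfrac52-2x)\in A_0$ for $x\in[\tfrac34,1]$. The map $\tilde\phi:B\to B$ is defined piecewise by $A_0\to A_1:(e^{i\theta},x)\mapsto(e^{i\theta},2-x)$; $A_1\to A_0:(e^{i\theta},x)\mapsto(e^{6i\theta},2-x)$; $S_0\to S_1:e^{i\theta}\mapsto e^{2i\theta}$; $S_1\to S_0:e^{i\theta}\mapsto e^{3i\theta}$. Paths from $(1,\tfrac12)\in A_0$ to $(1,\tfrac32)\in A_1$: $p^1(x)=(1,\tfrac12+x)\in A_0$ for $x\in[0,\tfrac12]$ and $p^1(x)=(1,\tfrac52-x)\in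 A_1$ for $x\in[\tfrac12,1]$; $p^2(x)=(1,\tfrac12-x)\in A_0$ for $x\in[0,\tfrac12]$ and $p^2(x)=(1,\tfrac12+x)\in A_1$ for $x\in[\tfrac12,1]$. Products of paths are concatenations read from left to right. For $k=1,2$, $p^k_*:\pi_1(B,(1,\tfrac32))\to\pi_1(B,(1,\tfrac12))$ is the change-of-base-point isomorphism $[\delta]\mapsto[p^k\cdot\delta\cdot\overline{p^k}]$, where $\overline{p^k}$ is the reversed path. *)

theory Defs
  imports "HOL-Analysis.Analysis" "HOL-Algebra.Generated_Groups"
begin

section \<open>The fundamental group\<close>

definition homotopy_class :: "'a::topological_space set \<Rightarrow> (real \<Rightarrow> 'a) \<Rightarrow> (real \<Rightarrow> 'a) set" where
  "homotopy_class S p = {q. homotopic_paths S p q}"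

definition loops_at :: "'a::topological_space set \<Rightarrow> 'a \<Rightarrow> (real \<Rightarrow> 'a) set" where
  "loops_at S x = {p. path p \<and> path_image p \<subseteq> S \<and> pathstart p = x \<and> pathfinish p = x}"

text \<open>
  The operations on homotopy classes below are written without choosing representatives; the
  lemmas that follow each of them give the value on \<open>homotopy_class S p\<close>.
\<close>

definition fundamental_group :: "'a::topological_space set \<Rightarrow> 'a \<Rightarrow> (real \<Rightarrow> 'a) set monoid" where
  "fundamental_group S x =
    \<lparr>carrier = homotopy_class S ` loops_at S x,
     mult = (\<lambda>c d. {r. \<exists>p\<in>c. \<exists>q\<in>d. homotopic_paths S (p +++ q) r}),
     one = homotopy_class S (\<lambda>_. x)\<rparr>"

definition induced_map :: "'b::topological_space set \<Rightarrow> ('a \<Rightarrow> 'b) \<Rightarrow> (real \<Rightarrow> 'a) set \<Rightarrow> (real \<Rightarrow> 'b) set" where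
  "induced_map T f c = {r. \<exists>p\<in>c. homotopic_paths T (f \<circ> p) r}"

definition change_base :: "'a::topological_space set \<Rightarrow> (real \<Rightarrow> 'a) \<Rightarrow> (real \<Rightarrow> 'a) set \<Rightarrow> (real \<Rightarrow> 'a) set" where
  "change_base S p c = {r. \<exists>d\<in>c. homotopic_paths S (p +++ d +++ reversepath p) r}"

lemma homotopy_class_eq_iff:
  assumes "path p" "path_image p \<subseteq> S"
  shows "homotopy_class S p = homotopy_class S q \<longleftrightarrow> homotopic_paths S p q"
proof
  assume "homotopy_class S p = homotopy_class S q"
  moreover have "p \<in> homotopy_class S p"
    using assms by (simp add: homotopy_class_def)
  ultimately show "homotopic_paths S p q"
    by (simp add: homotopy_class_def homotopic_paths_sym)
next
  assume *: "homotopic_paths S p q"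
  have "homotopic_paths S p r \<longleftrightarrow> homotopic_paths S q r" for r
    using homotopic_paths_trans[OF *] homotopic_paths_trans[OF homotopic_paths_sym[OF *]] by fast
  then show "homotopy_class S p = homotopy_class S q"
    by (simp add: homotopy_class_def)
qed

lemma homotopy_class_absorb:
  assumes "P u" "\<And>v. P v \<Longrightarrow> homotopic_paths T (F u) (F v)"
  shows "{r. \<exists>v\<in>{v. P v}. homotopic_paths T (F v) r} = {r. homotopic_paths T (F u) r}"
  using assms(1) homotopic_paths_trans[OF assms(2)] by blast

lemma mult_homotopy_class:
  assumes "p \<in> loops_at S x" "q \<in> loops_at S x"
  shows "homotopy_class S p \<otimes>\<^bsub>fundamental_group S x\<^esub> homotopy_class S q = homotopy_class S (p +++ q)"
proof -
  have fin: "pathfinish p = pathstart q"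
    using assms by (simp add: loops_at_def)
  have *: "homotopic_paths S (p +++ q) (p' +++ q')"
    if "homotopic_paths S p p'" "homotopic_paths S q q'" for p' q'
    using that fin by (rule homotopic_paths_join)
  have "homotopic_paths S p p" "homotopic_paths S q q"
    using assms by (auto simp: loops_at_def)
  then have "{r. \<exists>v\<in>{v. homotopic_paths S p (fst v) \<and> homotopic_paths S q (snd v)}.
      homotopic_paths S (fst v +++ snd v) r} = {r. homotopic_paths S (fst (p, q) +++ snd (p, q)) r}"
    by (intro homotopy_class_absorb) (auto intro: *)
  then show ?thesis
    by (simp add: fundamental_group_def homotopy_class_def)
qed

lemma induced_map_homotopy_class:
  assumes "p \<in> loops_at S x" "continuous_on S f" "f \<in> S \<rightarrow> T"
  shows "induced_map T f (homotopy_class S p) = homotopy_class T (f \<circ> p)"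
proof -
  have "homotopic_paths T (f \<circ> p) (f \<circ> p')" if "homotopic_paths S p p'" for p'
    using that assms(2,3) by (rule homotopic_paths_continuous_image)
  moreover have "homotopic_paths S p p"
    using assms by (auto simp: loops_at_def)
  ultimately show ?thesis
    unfolding induced_map_def homotopy_class_def
    by (intro homotopy_class_absorb)
qed

lemma change_base_homotopy_class:
  assumes "path p" "path_image p \<subseteq> S" "d \<in> loops_at S (pathfinish p)"
  shows "change_base S p (homotopy_class S d) = homotopy_class S (p +++ d +++ reversepath p)"
proof -
  have "homotopic_paths S (p +++ d +++ reversepath p) (p +++ d' +++ reversepath p)"
    if "homotopic_paths S d d'" for d'
    using that assms by (intro homotopic_paths_join) (auto simp: loops_at_def)
  moreover have "homotopic_paths S d d"
    using assms by (auto simp: loops_at_def)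
  ultimately show ?thesis
    unfolding change_base_def homotopy_class_def
    by (intro homotopy_class_absorb)
qed

lemma const_loop: "x \<in> S \<Longrightarrow> (\<lambda>_. x) \<in> loops_at S x"
  by (auto simp: loops_at_def path_def path_image_def pathstart_def pathfinish_def)

lemma join_loop: "p \<in> loops_at S x \<Longrightarrow> q \<in> loops_at S x \<Longrightarrow> p +++ q \<in> loops_at S x"
  by (auto simp: loops_at_def path_image_join)

lemma reverse_loop: "p \<in> loops_at S x \<Longrightarrow> reversepath p \<in> loops_at S x"
  by (auto simp: loops_at_def)

lemma homotopic_const_join:
  assumes "p \<in> loops_at S x"
  shows "homotopic_paths S p ((\<lambda>_. x) +++ p)"
proof (rule homotopic_paths_reparametrize)
  show "continuous_on {0..1::real} (\<lambda>t. max 0 (2 * t - 1))"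
    by (intro continuous_intros)
  show "((\<lambda>_. x) +++ p) t = p (max 0 (2 * t - 1))" for t
    using assms by (cases t "1/2 :: real" rule: linorder_cases)
      (auto simp: loops_at_def joinpaths_def max_def pathstart_def mult.commute)
qed (use assms in \<open>auto simp: loops_at_def\<close>)

lemma homotopic_join_reverse:
  assumes "p \<in> loops_at S x"
  shows "homotopic_paths S (p +++ reversepath p) (\<lambda>_. x)"
proof -
  define k where "k = (\<lambda>y::real\<times>real. (1 - fst y) * min (2 * snd y) (2 - 2 * snd y))"
  have k: "k \<in> {0..1} \<times> {0..1} \<rightarrow> {0..1}"
  proof
    fix y :: "real \<times> real" assume y: "y \<in> {0..1} \<times> {0..1}"
    then have "min (2 * snd y) (2 - 2 * snd y) \<in> {0..1}"
      by (auto simp: min_def)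
    then show "k y \<in> {0..1}"
      using y by (auto simp: k_def intro!: mult_nonneg_nonneg mult_le_one)
  qed
  have ck: "continuous_on ({0..1} \<times> {0..1}) k"
    unfolding k_def by (intro continuous_intros)
  have p: "continuous_on {0..1} p" "p ` {0..1} \<subseteq> S" "p 0 = x" "p 1 = x"
    using assms by (auto simp: loops_at_def path_def path_image_def pathstart_def pathfinish_def)
  show ?thesis
    unfolding homotopic_paths
  proof (intro exI[of _ "p \<circ> k"] conjI)
    show "continuous_on ({0..1} \<times> {0..1}) (p \<circ> k)"
      using ck p(1) k by (intro continuous_on_compose continuous_on_subset[OF p(1)]) auto
    show "p \<circ> k \<in> {0..1} \<times> {0..1} \<rightarrow> S"
      using k p(2) by fastforce
  qed (use p in \<open>auto simp: k_def joinpaths_def reversepath_def min_def pathstart_def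
      pathfinish_def algebra_simps\<close>)
qed

lemma group_fundamental_group:
  assumes "x \<in> S"
  shows "group (fundamental_group S x)"
proof -
  let ?G = "fundamental_group S x"
  have car: "carrier ?G = homotopy_class S ` loops_at S x"
    and one: "\<one>\<^bsub>?G\<^esub> = homotopy_class S (\<lambda>_. x)"
    by (simp_all add: fundamental_group_def)
  have eq: "homotopy_class S p = homotopy_class S q"
    if "p \<in> loops_at S x" "homotopic_paths S p q" for p q
    using that by (simp add: homotopy_class_eq_iff loops_at_def)
  show ?thesis
  proof (rule groupI)
    fix a b assume "a \<in> carrier ?G" "b \<in> carrier ?G"
    then show "a \<otimes>\<^bsub>?G\<^esub> b \<in> carrier ?G"
      by (auto simp: car mult_homotopy_class join_loop)
  next
    show "\<one>\<^bsub>?G\<^esub> \<in> carrier ?G"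
      using assms by (simp add: one car const_loop)
  next
    fix a b c assume "a \<in> carrier ?G" "b \<in> carrier ?G" "c \<in> carrier ?G"
    then obtain p q r where "a = homotopy_class S p" "b = homotopy_class S q"
        "c = homotopy_class S r"
      and l: "p \<in> loops_at S x" "q \<in> loops_at S x" "r \<in> loops_at S x"
      by (auto simp: car)
    moreover have "homotopic_paths S (p +++ (q +++ r)) ((p +++ q) +++ r)"
      using l by (intro homotopic_paths_assoc) (auto simp: loops_at_def)
    ultimately show "(a \<otimes>\<^bsub>?G\<^esub> b) \<otimes>\<^bsub>?G\<^esub> c = a \<otimes>\<^bsub>?G\<^esub> (b \<otimes>\<^bsub>?G\<^esub> c)"
      using eq[of "p +++ (q +++ r)" "(p +++ q) +++ r"]
      by (simp add: mult_homotopy_class join_loop)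
  next
    fix a assume "a \<in> carrier ?G"
    then obtain p where a: "a = homotopy_class S p" and l: "p \<in> loops_at S x"
      by (auto simp: car)
    show "\<one>\<^bsub>?G\<^esub> \<otimes>\<^bsub>?G\<^esub> a = a"
      unfolding a one
      using mult_homotopy_class[OF const_loop[OF assms] l] eq[OF l homotopic_const_join[OF l]]
      by (rule trans[OF _ HOL.sym])
    have "homotopic_paths S (reversepath p +++ p) (\<lambda>_. x)"
      using homotopic_join_reverse[OF reverse_loop[OF l]] by simp
    then have "homotopy_class S (reversepath p) \<otimes>\<^bsub>?G\<^esub> a = \<one>\<^bsub>?G\<^esub>"
      using eq l by (simp add: a one mult_homotopy_class reverse_loop join_loop)
    then show "\<exists>y\<in>carrier ?G. y \<otimes>\<^bsub>?G\<^esub> a = \<one>\<^bsub>?G\<^esub>"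
      using reverse_loop[OF l] car by blast
  qed
qed


section \<open>Groups given by a presentation\<close>

text \<open>The letter \<open>(g, True)\<close> stands for the generator \<open>g\<close>, and \<open>(g, False)\<close> for its inverse.\<close>

type_synonym 'g word = "('g \<times> bool) list"

text \<open>Equality in \<open>\<langle>UNIV | u = v for (u, v) \<in> R\<rangle>\<close>.\<close>

inductive pres_eq :: "('g word \<times> 'g word) set \<Rightarrow> 'g word \<Rightarrow> 'g word \<Rightarrow> bool" for R where
  relator: "(u, v) \<in> R \<Longrightarrow> pres_eq R u v"
| cancel: "pres_eq R [(g, e), (g, \<not> e)] []"
| cong: "pres_eq R u u' \<Longrightarrow> pres_eq R v v' \<Longrightarrow> pres_eq R (u @ v) (u' @ v')"
| refl: "pres_eq R u u"
| sym: "pres_eq R u v \<Longrightarrow> pres_eq R v u"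
| trans: "pres_eq R u v \<Longrightarrow> pres_eq R v w \<Longrightarrow> pres_eq R u w"

definition pres_class :: "('g word \<times> 'g word) set \<Rightarrow> 'g word \<Rightarrow> 'g word set" where
  "pres_class R u = {v. pres_eq R u v}"

definition presented_group :: "('g word \<times> 'g word) set \<Rightarrow> 'g word set monoid" where
  "presented_group R =
    \<lparr>carrier = range (pres_class R),
     mult = (\<lambda>c d. {w. \<exists>u\<in>c. \<exists>v\<in>d. pres_eq R (u @ v) w}),
     one = pres_class R []\<rparr>"

lemma pres_class_eq_iff: "pres_class R u = pres_class R v \<longleftrightarrow> pres_eq R u v"
proof
  assume "pres_class R u = pres_class R v"
  moreover have "v \<in> pres_class R v"
    by (simp add: pres_class_def pres_eq.refl)
  ultimately have "v \<in> pres_class R u" by simp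
  then show "pres_eq R u v" by (simp add: pres_class_def)
next
  assume *: "pres_eq R u v"
  have "pres_eq R u w \<longleftrightarrow> pres_eq R v w" for w
    using pres_eq.trans[OF *] pres_eq.trans[OF pres_eq.sym[OF *]] by fast
  then show "pres_class R u = pres_class R v"
    by (simp add: pres_class_def)
qed

lemma mult_pres_class:
  "pres_class R u \<otimes>\<^bsub>presented_group R\<^esub> pres_class R v = pres_class R (u @ v)"
proof -
  have "pres_eq R (u @ v) w" if "pres_eq R u u'" "pres_eq R v v'" "pres_eq R (u' @ v') w" for u' v' w
    using pres_eq.cong[OF that(1,2)] that(3) by (rule pres_eq.trans)
  then have "(\<exists>u'. pres_eq R u u' \<and> (\<exists>v'. pres_eq R v v' \<and> pres_eq R (u' @ v') w)) \<longleftrightarrow> pres_eq R (u @ v) w"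
    for w
    using pres_eq.refl[of R u] pres_eq.refl[of R v] by fast
  then show ?thesis
    by (simp add: presented_group_def pres_class_def)
qed

lemma one_presented_group: "\<one>\<^bsub>presented_group R\<^esub> = pres_class R []"
  by (simp add: presented_group_def)

lemma carrier_presented_group: "carrier (presented_group R) = range (pres_class R)"
  by (simp add: presented_group_def)

lemma pres_eq_inverse: "\<exists>v. pres_eq R (v @ u) []"
proof (induction u)
  case Nil
  show ?case by (metis append_Nil pres_eq.refl)
next
  case (Cons l u)
  obtain g e where l: "l = (g, e)" by (cases l)
  obtain v where v: "pres_eq R (v @ u) []" using Cons by blast
  have "pres_eq R [(g, \<not> e), (g, e)] []" using pres_eq.cancel[of R g "\<not> e"] by simp
  then have "pres_eq R (v @ ([(g, \<not> e), (g, e)] @ u)) (v @ ([] @ u))"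
    by (intro pres_eq.cong pres_eq.refl)
  then have "pres_eq R ((v @ [(g, \<not> e)]) @ l # u) []"
    using v by (auto simp: l intro: pres_eq.trans)
  then show ?case by blast
qed

lemma group_presented_group: "group (presented_group R)"
proof (rule groupI)
  fix x assume "x \<in> carrier (presented_group R)"
  then obtain u where x: "x = pres_class R u" by (auto simp: carrier_presented_group)
  show "\<one>\<^bsub>presented_group R\<^esub> \<otimes>\<^bsub>presented_group R\<^esub> x = x"
    by (simp add: x one_presented_group mult_pres_class)
  show "\<exists>y\<in>carrier (presented_group R). y \<otimes>\<^bsub>presented_group R\<^esub> x = \<one>\<^bsub>presented_group R\<^esub>"
    using pres_eq_inverse[of R u]
    by (auto simp: x one_presented_group mult_pres_class carrier_presented_group pres_class_eq_iff)
qed (auto simp: carrier_presented_group one_presented_group mult_pres_class)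

datatype bs_gen = Gen_a | Gen_b

text \<open>\<open>BS(2,3) = \<langle>a, b | b a\<^sup>2 = a\<^sup>3 b\<rangle>\<close>\<close>

definition BS23_rel :: "(bs_gen word \<times> bs_gen word) set" where
  "BS23_rel =
    {([(Gen_b, True), (Gen_a, True), (Gen_a, True)],
      [(Gen_a, True), (Gen_a, True), (Gen_a, True), (Gen_b, True)])}"

definition BS23 :: "bs_gen word set monoid" where
  "BS23 = presented_group BS23_rel"

definition bs_a :: "bs_gen word set" where
  "bs_a = pres_class BS23_rel [(Gen_a, True)]"

definition bs_b :: "bs_gen word set" where
  "bs_b = pres_class BS23_rel [(Gen_b, True)]"

lemma group_BS23: "group BS23"
  by (simp add: BS23_def group_presented_group)

lemma BS23_relation:
  "bs_b \<otimes>\<^bsub>BS23\<^esub> bs_a [^]\<^bsub>BS23\<^esub> (2::nat) = bs_a [^]\<^bsub>BS23\<^esub> (3::nat) \<otimes>\<^bsub>BS23\<^esub> bs_b"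
proof -
  interpret group BS23 by (rule group_BS23)
  show ?thesis
    by (simp add: numeral_2_eq_2 numeral_3_eq_3 bs_a_def bs_b_def BS23_def one_presented_group
        mult_pres_class pres_class_eq_iff BS23_rel_def pres_eq.relator)
qed

text \<open>
  By the next lemma, prescribing a homomorphism on \<open>bs_a\<close> and \<open>bs_b\<close> leaves no freedom on
  \<open>carrier BS23\<close>.
\<close>

lemma hom_BS23_unique:
  assumes "group G" "f \<in> hom BS23 G" "g \<in> hom BS23 G" "f bs_a = g bs_a" "f bs_b = g bs_b"
    and "x \<in> carrier BS23"
  shows "f x = g x"
proof -
  interpret f: group_hom BS23 G f
    using assms group_BS23 by (simp add: group_hom_def group_hom_axioms_def)
  interpret g: group_hom BS23 G g
    using assms group_BS23 by (simp add: group_hom_def group_hom_axioms_def)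
  let ?c = "pres_class BS23_rel"
  have car: "?c u \<in> carrier BS23" for u
    by (simp add: BS23_def carrier_presented_group)
  have mult: "?c (u @ v) = ?c u \<otimes>\<^bsub>BS23\<^esub> ?c v" for u v
    by (simp add: BS23_def mult_pres_class)
  have pos: "f (?c [(h, True)]) = g (?c [(h, True)])" for h
    using assms(4,5) by (cases h) (simp_all add: bs_a_def bs_b_def)
  have neg: "?c [(h, False)] = inv\<^bsub>BS23\<^esub> ?c [(h, True)]" for h
  proof -
    have "?c [(h, False)] \<otimes>\<^bsub>BS23\<^esub> ?c [(h, True)] = \<one>\<^bsub>BS23\<^esub>"
      using pres_eq.cancel[of BS23_rel h False]
      by (simp add: BS23_def mult_pres_class one_presented_group pres_class_eq_iff)
    then show ?thesis
      using car f.G.inv_equality by metis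
  qed
  have letter: "f (?c [l]) = g (?c [l])" for l
  proof (cases l)
    case (Pair h e)
    show ?thesis
      by (cases e) (simp_all add: Pair pos neg car)
  qed
  obtain u where "x = ?c u"
    using assms(6) by (auto simp: BS23_def carrier_presented_group)
  moreover have "f (?c u) = g (?c u)"
  proof (induction u)
    case Nil
    show ?case
      using f.hom_one g.hom_one by (simp add: BS23_def one_presented_group)
  next
    case (Cons l u)
    have "?c (l # u) = ?c [l] \<otimes>\<^bsub>BS23\<^esub> ?c u"
      using mult[of "[l]" u] by simp
    then show ?case
      by (simp add: car letter Cons)
  qed
  ultimately show ?thesis by simp
qed


section \<open>The space \<open>B\<close>\<close>

abbreviation circle :: "complex set" where
  "circle \<equiv> sphere 0 1"

datatype pre_B = S0 complex | S1 complex | A0 "complex \<times> real" | A1 "complex \<times> real"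

definition pieces :: "pre_B set" where
  "pieces = S0 ` circle \<union> S1 ` circle \<union> A0 ` (circle \<times> {0..1}) \<union> A1 ` (circle \<times> {1..2})"

definition pieces_space :: "pre_B topology" where
  "pieces_space = topology (\<lambda>U. U \<subseteq> pieces
     \<and> openin (top_of_set circle) (S0 -` U)
     \<and> openin (top_of_set circle) (S1 -` U)
     \<and> openin (top_of_set (circle \<times> {0..1})) (A0 -` U)
     \<and> openin (top_of_set (circle \<times> {1..2})) (A1 -` U))"

inductive attach :: "pre_B \<Rightarrow> pre_B \<Rightarrow> bool" where
  "z \<in> circle \<Longrightarrow> attach (A0 (z, 0)) (S0 z)"
| "z \<in> circle \<Longrightarrow> attach (A0 (z, 1)) (S1 z)"
| "z \<in> circle \<Longrightarrow> attach (A1 (z, 1)) (S0 (z ^ 3))"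
| "z \<in> circle \<Longrightarrow> attach (A1 (z, 2)) (S1 (z ^ 2))"

definition glued :: "pre_B \<Rightarrow> pre_B \<Rightarrow> bool" where
  "glued x y \<longleftrightarrow> x \<in> pieces \<and> y \<in> pieces \<and> equivclp attach x y"

lemma part_equivp_glued: "part_equivp glued"
proof (rule part_equivpI)
  show "\<exists>x. glued x x"
    by (rule exI[of _ "S0 1"]) (auto simp: glued_def pieces_def)
  show "symp glued"
    by (auto simp: symp_def glued_def intro: equivclp_sym)
  show "transp glued"
    by (auto simp: transp_def glued_def intro: equivclp_trans)
qed

quotient_type B = pre_B / partial: glued
  by (rule part_equivp_glued)

lemma istopology_pieces: "istopology (\<lambda>U. U \<subseteq> pieces
     \<and> openin (top_of_set circle) (S0 -` U)
     \<and> openin (top_of_set circle) (S1 -` U)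
     \<and> openin (top_of_set (circle \<times> {0..1})) (A0 -` U)
     \<and> openin (top_of_set (circle \<times> {1..2})) (A1 -` U))"
  unfolding istopology_def vimage_Int vimage_Union
proof (intro conjI allI impI)
  fix U V
  assume "U \<subseteq> pieces
     \<and> openin (top_of_set circle) (S0 -` U)
     \<and> openin (top_of_set circle) (S1 -` U)
     \<and> openin (top_of_set (circle \<times> {0..1})) (A0 -` U)
     \<and> openin (top_of_set (circle \<times> {1..2})) (A1 -` U)"
  then show "U \<inter> V \<subseteq> pieces" by auto
qed (auto intro: openin_Int openin_Union)

lemma openin_pieces_space:
  "openin pieces_space U \<longleftrightarrow> U \<subseteq> pieces
     \<and> openin (top_of_set circle) (S0 -` U)
     \<and> openin (top_of_set circle) (S1 -` U)
     \<and> openin (top_of_set (circle \<times> {0..1})) (A0 -` U)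
     \<and> openin (top_of_set (circle \<times> {1..2})) (A1 -` U)"
  by (simp add: pieces_space_def istopology_pieces)

lemma topspace_pieces_space: "topspace pieces_space = pieces"
proof -
  have v: "S0 -` pieces = circle" "S1 -` pieces = circle"
    "A0 -` pieces = circle \<times> {0..1}" "A1 -` pieces = circle \<times> {1..2}"
    by (auto simp: pieces_def)
  have "openin pieces_space pieces"
    unfolding openin_pieces_space v by (simp add: openin_subtopology_self)
  then show ?thesis
    using openin_subset[of pieces_space pieces] openin_topspace[of pieces_space]
    unfolding openin_pieces_space[of "topspace _"] by blast
qed

text \<open>The quotient topology; see \<open>quotient_map_abs_B\<close> below.\<close>

instantiation B :: topological_space
begin

definition open_B :: "B set \<Rightarrow> bool" where
  "open_B U \<longleftrightarrow> openin pieces_space {x \<in> pieces. abs_B x \<in> U}"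

instance
proof
  show "open (UNIV :: B set)"
    using openin_topspace[of pieces_space] by (simp add: open_B_def topspace_pieces_space)
next
  fix U V :: "B set" assume "open U" "open V"
  then have "openin pieces_space ({x \<in> pieces. abs_B x \<in> U} \<inter> {x \<in> pieces. abs_B x \<in> V})"
    unfolding open_B_def by (rule openin_Int)
  moreover have "{x \<in> pieces. abs_B x \<in> U} \<inter> {x \<in> pieces. abs_B x \<in> V}
      = {x \<in> pieces. abs_B x \<in> U \<inter> V}" by auto
  ultimately show "open (U \<inter> V)"
    unfolding open_B_def by simp
next
  fix K :: "B set set" assume "\<forall>U\<in>K. open U"
  then have "openin pieces_space (\<Union>U\<in>K. {x \<in> pieces. abs_B x \<in> U})"
    unfolding open_B_def by (intro openin_Union) auto
  moreover have "(\<Union>U\<in>K. {x \<in> pieces. abs_B x \<in> U}) = {x \<in> pieces. abs_B x \<in> \<Union>K}" by auto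
  ultimately show "open (\<Union>K)"
    unfolding open_B_def by simp
qed

end

lemma abs_B_eq_iff:
  assumes "x \<in> pieces" "y \<in> pieces"
  shows "abs_B x = abs_B y \<longleftrightarrow> equivclp attach x y"
  using Quotient3_rel[OF Quotient3_B, of x y] assms
  by (auto simp: glued_def)

lemma rep_B_in_pieces: "rep_B b \<in> pieces"
  using Quotient3_rep_reflp[OF Quotient3_B, of b] by (simp add: glued_def)

lemma abs_B_rep_B: "abs_B (rep_B b) = b"
  by (rule Quotient3_abs_rep[OF Quotient3_B])

lemma quotient_map_abs_B: "quotient_map pieces_space euclidean abs_B"
  unfolding quotient_map_def
proof (intro conjI allI impI)
  show "abs_B ` topspace pieces_space = topspace euclidean"
  proof -
    have "b \<in> abs_B ` pieces" for b
      using imageI[OF rep_B_in_pieces, of abs_B b] by (simp add: abs_B_rep_B)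
    then show ?thesis
      by (auto simp: topspace_pieces_space)
  qed
qed (simp add: open_B_def topspace_pieces_space)

definition base0 :: B where
  "base0 = abs_B (A0 (1, 1/2))"

definition base1 :: B where
  "base1 = abs_B (A1 (1, 3/2))"

abbreviation pi1_B :: "B \<Rightarrow> (real \<Rightarrow> B) set monoid" where
  "pi1_B x \<equiv> fundamental_group UNIV x"

definition gamma1 :: "real \<Rightarrow> B" where
  "gamma1 \<theta> = abs_B (A0 (cis (2 * pi * \<theta>), 1/2))"

definition gamma2 :: "real \<Rightarrow> B" where
  "gamma2 x =
    (if x \<le> 1/4 then abs_B (A0 (1, 1/2 - 2 * x))
     else if x \<le> 3/4 then abs_B (A1 (1, 1 + 2 * x - 1/2))
     else abs_B (A0 (1, 5/2 - 2 * x)))"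

definition path1 :: "real \<Rightarrow> B" where
  "path1 x = (if x \<le> 1/2 then abs_B (A0 (1, 1/2 + x)) else abs_B (A1 (1, 5/2 - x)))"

definition path2 :: "real \<Rightarrow> B" where
  "path2 x = (if x \<le> 1/2 then abs_B (A0 (1, 1/2 - x)) else abs_B (A1 (1, 1/2 + x)))"

fun pre_phi :: "pre_B \<Rightarrow> pre_B" where
  "pre_phi (A0 (z, x)) = A1 (z, 2 - x)"
| "pre_phi (A1 (z, x)) = A0 (z ^ 6, 2 - x)"
| "pre_phi (S0 z) = S1 (z ^ 2)"
| "pre_phi (S1 z) = S0 (z ^ 3)"

text \<open>
  \<open>phi_tilde\<close> evaluates \<open>pre_phi\<close> at a chosen representative. That the choice does not matter,
  i.e. \<open>phi_tilde (abs_B x) = abs_B (pre_phi x)\<close> for every \<open>x \<in> pieces\<close>, is not proved here: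
  it is the well-definedness claim for the piecewise formula.
\<close>

definition phi_tilde :: "B \<Rightarrow> B" where
  "phi_tilde b = abs_B (pre_phi (rep_B b))"

end

theory Submission
  imports Defs
begin

text \<open>
  The annulus \<open>A\<^sub>0\<close> is a thickened circle whose core \<open>\<gamma>\<^sub>1\<close> is the generator \<open>a\<close>, and the annulus
  \<open>A\<^sub>1\<close> is attached to its two boundary circles with degrees \<open>3\<close> and \<open>2\<close>. So \<open>B\<close> is the graph of
  spaces of the HNN extension \<open>BS(2,3)\<close>: sliding a loop along \<open>A\<^sub>1\<close> turns \<open>a\<^sup>3\<close> into \<open>a\<^sup>2\<close>, and
  \<open>\<gamma>\<^sub>2\<close>, which crosses \<open>A\<^sub>1\<close> once, is the stable letter \<open>b\<close>. Surjectivity and injectivity of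
  \<open>BS(2,3) \<rightarrow> \<pi>\<^sub>1(B)\<close> are two separate arguments.

  \<^bold>\<open>Generation.\<close> A homotopy \<open>push\<close> fixes \<open>A\<^sub>0\<close> and collapses two collars of \<open>A\<^sub>1\<close> onto the boundary
  circles. A loop pushed this way stays, near every time, inside one of the two annuli and lifts
  there to a strip in the plane, where the ends of a path determine its homotopy class
  (\<open>pcl_convex\<close>). Comparing initial pieces of the loop with straight standard paths, modulo left
  multiplication by the subgroup generated by \<open>[\<gamma>\<^sub>1]\<close> and \<open>[\<gamma>\<^sub>2]\<close>, the property of agreeing with a
  standard path propagates along the loop (\<open>loop_in_gens\<close>).

  \<^bold>\<open>Injectivity.\<close> Let \<open>\<alpha>\<close>, \<open>\<beta>\<close> in a group \<open>G\<close> satisfy \<open>\<beta>\<alpha>\<^sup>2 = \<alpha>\<^sup>3\<beta>\<close>. There is then a covering of \<open>B\<close>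
  with fibre \<open>G\<close> and monodromy \<open>\<alpha>\<close>, \<open>\<beta>\<close>. Its total space is never built: a lift of a map
  \<open>h : D \<rightarrow> B\<close> is recorded as a \<open>G\<close>-valued function on \<open>D\<close>, a flat section: locally, and up to a
  left factor, a power of \<open>\<alpha>\<close> read off from a lifted angle, with a jump by \<open>\<beta>\<close> at the middle circle
  of \<open>A\<^sub>1\<close>. Flat sections are unique up to a left factor on
  convex sets (\<open>flat_ratio\<close>) and exist on the unit square (\<open>flat_exists_square\<close>), so the change of
  a flat section along a loop depends on the homotopy class only. This gives a homomorphism
  \<open>\<pi>\<^sub>1(B) \<rightarrow> G\<close> with \<open>[\<gamma>\<^sub>1] \<mapsto> \<alpha>\<close> and \<open>[\<gamma>\<^sub>2] \<mapsto> \<beta>\<close>. For \<open>G = BS(2,3)\<close> it is a left inverse of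
  \<open>BS(2,3) \<rightarrow> \<pi>\<^sub>1(B)\<close>.

  \<^bold>\<open>The map.\<close> Let \<open>F\<close> be \<open>phi_tilde\<close>. The equations \<open>p\<^sup>1\<^sub>* \<circ> F\<^sub>* = \<phi>\<close> and \<open>p\<^sup>2\<^sub>* \<circ> F\<^sub>* = \<phi>'\<close> only have
  to be compared on \<open>a\<close> and \<open>b\<close>, where they are computations with segments. Since
  \<open>p\<^sup>1\<^sub>*\<close> and \<open>p\<^sup>2\<^sub>*\<close> are injective, both \<open>\<phi>\<close> and \<open>\<phi>'\<close> have the kernel of \<open>F\<^sub>*\<close>.
\<close>

section \<open>Maps into and out of the glued space\<close>

abbreviation cyl0 :: "(complex \<times> real) set" where "cyl0 \<equiv> circle \<times> {0..1}"
abbreviation cyl1 :: "(complex \<times> real) set" where "cyl1 \<equiv> circle \<times> {1..2}"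

definition ann0 :: "complex \<times> real \<Rightarrow> B" where "ann0 y = abs_B (A0 y)"
definition ann1 :: "complex \<times> real \<Rightarrow> B" where "ann1 y = abs_B (A1 y)"

lemma abs_B_attach:
  assumes "attach x y" "x \<in> pieces" "y \<in> pieces"
  shows "abs_B x = abs_B y"
  using assms by (simp add: abs_B_eq_iff r_into_equivclp)

lemma abs_S0: "z \<in> circle \<Longrightarrow> abs_B (S0 z) = ann0 (z, 0)"
  unfolding ann0_def
  by (rule abs_B_attach[symmetric]) (auto intro: attach.intros simp: pieces_def)

lemma abs_S1: "z \<in> circle \<Longrightarrow> abs_B (S1 z) = ann0 (z, 1)"
  unfolding ann0_def
  by (rule abs_B_attach[symmetric]) (auto intro: attach.intros simp: pieces_def)

lemma ann1_bottom: "z \<in> circle \<Longrightarrow> ann1 (z, 1) = ann0 (z ^ 3, 0)"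
  using abs_S0[of "z ^ 3"] abs_B_attach[OF attach.intros(3)[of z]]
  by (auto simp: ann1_def pieces_def norm_power)

lemma ann1_top: "z \<in> circle \<Longrightarrow> ann1 (z, 2) = ann0 (z ^ 2, 1)"
  using abs_S1[of "z ^ 2"] abs_B_attach[OF attach.intros(4)[of z]]
  by (auto simp: ann1_def pieces_def norm_power)

lemma B_cases:
  obtains y where "y \<in> cyl0" "b = ann0 y" | y where "y \<in> cyl1" "b = ann1 y"
proof -
  consider z where "rep_B b = S0 z" "z \<in> circle" | z where "rep_B b = S1 z" "z \<in> circle"
    | y where "rep_B b = A0 y" "y \<in> cyl0" | y where "rep_B b = A1 y" "y \<in> cyl1"
    using rep_B_in_pieces[of b] unfolding pieces_def by blast
  then show thesis
  proof cases
    case (1 z)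
    then show thesis
      using that(1)[of "(z, 0)"] abs_B_rep_B[of b] by (simp add: abs_S0)
  next
    case (2 z)
    then show thesis
      using that(1)[of "(z, 1)"] abs_B_rep_B[of b] by (simp add: abs_S1)
  next
    case (3 y)
    then show thesis
      using that(1)[of y] abs_B_rep_B[of b] by (simp add: ann0_def)
  next
    case (4 y)
    then show thesis
      using that(2)[of y] abs_B_rep_B[of b] by (simp add: ann1_def)
  qed
qed

text \<open>
  A pair of functions on the two annuli descends to \<open>B\<close> as soon as it respects the two gluings
  of \<open>A\<^sub>1\<close> (\<open>glue_ann\<close>). The circles take their values from the boundary of \<open>A\<^sub>0\<close>, to which they
  are glued with degree one.
\<close>

definition glue :: "(complex \<times> real \<Rightarrow> 'c) \<Rightarrow> (complex \<times> real \<Rightarrow> 'c) \<Rightarrow> B \<Rightarrow> 'c" where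
  "glue f g b = (case rep_B b of S0 z \<Rightarrow> f (z, 0) | S1 z \<Rightarrow> f (z, 1) | A0 y \<Rightarrow> f y | A1 y \<Rightarrow> g y)"

lemma glue_ann:
  assumes "\<And>z. z \<in> circle \<Longrightarrow> f (z ^ 3, 0) = g (z, 1)" "\<And>z. z \<in> circle \<Longrightarrow> f (z ^ 2, 1) = g (z, 2)"
  shows "y \<in> cyl0 \<Longrightarrow> glue f g (ann0 y) = f y" "y \<in> cyl1 \<Longrightarrow> glue f g (ann1 y) = g y"
proof -
  define E where "E x = (case x of S0 z \<Rightarrow> f (z, 0) | S1 z \<Rightarrow> f (z, 1) | A0 y \<Rightarrow> f y | A1 y \<Rightarrow> g y)" for x
  have step: "E x = E y" if "attach x y" for x y
    using that assms by cases (auto simp: E_def)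
  have "E x = E y" if "equivclp attach x y" for x y
    using that by (induction rule: equivclp_induct) (auto dest: step)
  then have "glue f g (abs_B x) = E x" if "x \<in> pieces" for x
    using that abs_B_eq_iff[OF rep_B_in_pieces that, of "abs_B x"]
    by (simp add: abs_B_rep_B glue_def E_def)
  from this[of "A0 y"] this[of "A1 y"]
  show "y \<in> cyl0 \<Longrightarrow> glue f g (ann0 y) = f y" "y \<in> cyl1 \<Longrightarrow> glue f g (ann1 y) = g y"
    by (auto simp: pieces_def E_def ann0_def ann1_def)
qed

text \<open>
  The preimage of \<open>U\<close> in either circle is a slice of its preimage in \<open>A\<^sub>0\<close>, so openness on the
  annuli carries over to the circles.
\<close>

lemma open_B_iff:
  "open U \<longleftrightarrow> openin (top_of_set cyl0) {y \<in> cyl0. ann0 y \<in> U} \<and> openin (top_of_set cyl1) {y \<in> cyl1. ann1 y \<in> U}"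
  (is "_ \<longleftrightarrow> ?o0 \<and> ?o1")
proof -
  have v: "S0 -` {x \<in> pieces. abs_B x \<in> U} = circle \<inter> (\<lambda>z. (z, 0)) -` {y \<in> cyl0. ann0 y \<in> U}"
    "S1 -` {x \<in> pieces. abs_B x \<in> U} = circle \<inter> (\<lambda>z. (z, 1)) -` {y \<in> cyl0. ann0 y \<in> U}"
    "A0 -` {x \<in> pieces. abs_B x \<in> U} = {y \<in> cyl0. ann0 y \<in> U}"
    "A1 -` {x \<in> pieces. abs_B x \<in> U} = {y \<in> cyl1. ann1 y \<in> U}"
    by (auto simp: pieces_def ann0_def ann1_def abs_S0[unfolded ann0_def] abs_S1[unfolded ann0_def])
  have "openin (top_of_set circle) (circle \<inter> (\<lambda>z. (z, c)) -` {y \<in> cyl0. ann0 y \<in> U})"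
    if ?o0 "c \<in> {0..1}" for c
    by (rule continuous_openin_preimage[OF _ _ that(1)]) (use that(2) in \<open>auto intro!: continuous_intros\<close>)
  then show ?thesis
    unfolding open_B_def openin_pieces_space v by auto
qed

lemma continuous_on_ann: "continuous_on cyl0 ann0" "continuous_on cyl1 ann1"
proof -
  have eq: "{y \<in> cyl0. ann0 y \<in> U} = cyl0 \<inter> ann0 -` U" "{y \<in> cyl1. ann1 y \<in> U} = cyl1 \<inter> ann1 -` U" for U
    by auto
  show "continuous_on cyl0 ann0" "continuous_on cyl1 ann1"
    unfolding continuous_openin_preimage_eq by (simp_all add: open_B_iff eq)
qed

lemma continuous_on_B:
  fixes f :: "B \<Rightarrow> 'c::topological_space"
  assumes U: "open U"
    and "continuous_on {y \<in> cyl0. ann0 y \<in> U} (\<lambda>y. f (ann0 y))"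
    and "continuous_on {y \<in> cyl1. ann1 y \<in> U} (\<lambda>y. f (ann1 y))"
  shows "continuous_on U f"
  unfolding continuous_on_open_vimage[OF U]
proof (intro allI impI)
  fix V :: "'c set" assume V: "open V"
  have "openin (top_of_set {y \<in> cyl0. ann0 y \<in> U}) ({y \<in> cyl0. ann0 y \<in> U} \<inter> (\<lambda>y. f (ann0 y)) -` V)"
    "openin (top_of_set {y \<in> cyl1. ann1 y \<in> U}) ({y \<in> cyl1. ann1 y \<in> U} \<inter> (\<lambda>y. f (ann1 y)) -` V)"
    using assms V by (simp_all add: continuous_openin_preimage_gen)
  moreover have "openin (top_of_set cyl0) {y \<in> cyl0. ann0 y \<in> U}" "openin (top_of_set cyl1) {y \<in> cyl1. ann1 y \<in> U}"
    using U by (simp_all add: open_B_iff)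
  ultimately have "openin (top_of_set cyl0) ({y \<in> cyl0. ann0 y \<in> U} \<inter> (\<lambda>y. f (ann0 y)) -` V)"
    "openin (top_of_set cyl1) ({y \<in> cyl1. ann1 y \<in> U} \<inter> (\<lambda>y. f (ann1 y)) -` V)"
    by (meson openin_trans)+
  moreover have "{y \<in> cyl0. ann0 y \<in> f -` V \<inter> U} = {y \<in> cyl0. ann0 y \<in> U} \<inter> (\<lambda>y. f (ann0 y)) -` V"
    "{y \<in> cyl1. ann1 y \<in> f -` V \<inter> U} = {y \<in> cyl1. ann1 y \<in> U} \<inter> (\<lambda>y. f (ann1 y)) -` V"
    by auto
  ultimately show "open (f -` V \<inter> U)"
    unfolding open_B_iff by simp
qed

lemma continuous_on_B_UNIV:
  assumes "continuous_on cyl0 (\<lambda>y. f (ann0 y))" "continuous_on cyl1 (\<lambda>y. f (ann1 y))"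
  shows "continuous_on UNIV f"
  using assms by (intro continuous_on_B) simp_all

lemma openin_tube:
  fixes F :: "'a::euclidean_space \<times> 'b::euclidean_space \<Rightarrow> 'c::topological_space"
  assumes "continuous_on (S \<times> K) F" "compact K" "K \<noteq> {}" "open V"
  shows "openin (top_of_set S) {x \<in> S. \<forall>k\<in>K. F (x, k) \<in> V}"
proof (subst openin_subopen, intro ballI)
  fix x assume x: "x \<in> {x \<in> S. \<forall>k\<in>K. F (x, k) \<in> V}"
  have c: "continuous_on (K \<times> S) (F \<circ> prod.swap)"
    by (intro continuous_on_compose continuous_on_swap)
      (use assms(1) in \<open>auto simp: product_swap\<close>)
  then have o: "openin (top_of_set (K \<times> S)) (K \<times> S \<inter> (F \<circ> prod.swap) -` V)"
    using assms(4) by (rule continuous_openin_preimage_gen)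
  have "(\<lambda>k. (k, x)) ` K \<subseteq> K \<times> S \<inter> (F \<circ> prod.swap) -` V"
    using x by auto
  from Retracts.tube_lemma[OF assms(2,3) this o]
  obtain T where "openin (top_of_set S) T" "x \<in> T" "K \<times> T \<subseteq> K \<times> S \<inter> (F \<circ> prod.swap) -` V"
    by blast
  moreover from this have "T \<subseteq> {x \<in> S. \<forall>k\<in>K. F (x, k) \<in> V}"
    using openin_subset by fastforce
  ultimately show "\<exists>T. openin (top_of_set S) T \<and> x \<in> T \<and> T \<subseteq> {x \<in> S. \<forall>k\<in>K. F (x, k) \<in> V}"
    by blast
qed

text \<open>
  The product of a quotient map with a locally compact space is a quotient map; here in the
  form needed for homotopies of \<open>B\<close>. Around a point \<open>(b, s)\<close>, a compact neighbourhood \<open>L\<close> of \<open>s\<close>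
  is fixed first. The points \<open>b'\<close> for which all of \<open>{b'} \<times> L\<close> is mapped into the target form an
  open set, since the tube lemma shows this on each annulus.
\<close>

lemma continuous_on_B_Times:
  fixes F :: "B \<times> 'b::euclidean_space \<Rightarrow> 'c::topological_space"
  assumes K: "compact K"
    and c0: "continuous_on (cyl0 \<times> K) (\<lambda>(y, s). F (ann0 y, s))"
    and c1: "continuous_on (cyl1 \<times> K) (\<lambda>(y, s). F (ann1 y, s))"
  shows "continuous_on (UNIV \<times> K) F"
  unfolding continuous_on_topological
proof (intro ballI allI impI)
  fix x V assume x: "x \<in> UNIV \<times> K" and V: "open V" "F x \<in> V"
  obtain b s where bs: "x = (b, s)" by (cases x)
  then have s: "s \<in> K" using x by simp
  have "continuous_on K (\<lambda>s. F (b, s))"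
  proof (cases b rule: B_cases)
    case (1 y)
    have "continuous_on K (\<lambda>s. case (y, s) of (y, s) \<Rightarrow> F (ann0 y, s))"
      by (rule continuous_on_compose2[OF c0]) (use 1 in \<open>auto intro!: continuous_intros\<close>)
    then show ?thesis by (simp add: 1)
  next
    case (2 y)
    have "continuous_on K (\<lambda>s. case (y, s) of (y, s) \<Rightarrow> F (ann1 y, s))"
      by (rule continuous_on_compose2[OF c1]) (use 2 in \<open>auto intro!: continuous_intros\<close>)
    then show ?thesis by (simp add: 2)
  qed
  then have "openin (top_of_set K) (K \<inter> (\<lambda>s. F (b, s)) -` V)"
    using V by (simp add: continuous_openin_preimage_gen)
  then obtain r where r: "r > 0" "cball s r \<inter> K \<subseteq> K \<inter> (\<lambda>s. F (b, s)) -` V"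
    using V s bs unfolding openin_contains_cball by (metis IntI vimageI2 snd_conv fst_conv)
  define L where "L = cball s r \<inter> K"
  have "s \<in> L" using s r(1) by (simp add: L_def)
  then have L: "L \<noteq> {}" by blast
  have L': "compact L" "L \<subseteq> K"
    using K by (simp_all add: L_def compact_Int)
  define N where "N = {b'. \<forall>t\<in>L. F (b', t) \<in> V}"
  have "openin (top_of_set cyl0) {y \<in> cyl0. \<forall>t\<in>L. (case (y, t) of (y, s) \<Rightarrow> F (ann0 y, s)) \<in> V}"
    by (rule openin_tube[OF continuous_on_subset[OF c0] L'(1) L V(1)]) (use L'(2) in auto)
  moreover have "openin (top_of_set cyl1) {y \<in> cyl1. \<forall>t\<in>L. (case (y, t) of (y, s) \<Rightarrow> F (ann1 y, s)) \<in> V}"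
    by (rule openin_tube[OF continuous_on_subset[OF c1] L'(1) L V(1)]) (use L'(2) in auto)
  ultimately have "open N"
    by (simp add: open_B_iff N_def)
  moreover have "b \<in> N"
    using r by (auto simp: N_def L_def)
  ultimately show "\<exists>A. open A \<and> x \<in> A \<and> (\<forall>y\<in>UNIV \<times> K. y \<in> A \<longrightarrow> F y \<in> V)"
    using r(1) by (intro exI[of _ "N \<times> ball s r"]) (auto simp: bs open_Times N_def L_def)
qed

section \<open>Coordinates on the glued space\<close>

text \<open>
  Coordinates on two overlapping open sets. Where \<open>depth < 1/2\<close>, i.e. off the middle circle of
  \<open>A\<^sub>1\<close>, there is a retraction onto \<open>A\<^sub>0\<close> with components \<open>dir0\<close> and \<open>level\<close>. Where \<open>depth > 0\<close>,
  i.e. in the open annulus \<open>A\<^sub>1\<close>, the coordinates are \<open>sgn \<circ> scaled_dir1\<close> and \<open>height\<close>; the factor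
  \<open>depth\<close> in \<open>scaled_dir1\<close> makes it vanish on \<open>A\<^sub>0\<close>, hence well defined and continuous on
  all of \<open>B\<close>. On \<open>A\<^sub>0\<close> the function \<open>height\<close> interpolates between its values \<open>1\<close> and \<open>2\<close> on the
  boundary circles of \<open>A\<^sub>1\<close>.
\<close>

definition depth :: "B \<Rightarrow> real" where
  "depth = glue (\<lambda>_. 0) (\<lambda>(z, x). min (x - 1) (2 - x))"

definition height :: "B \<Rightarrow> real" where
  "height = glue (\<lambda>(z, x). 1 + x) (\<lambda>(z, x). x)"

definition dir0 :: "B \<Rightarrow> complex" where
  "dir0 = glue (\<lambda>(z, x). z) (\<lambda>(z, x). if x \<le> 3/2 then z ^ 3 else z ^ 2)"

definition level :: "B \<Rightarrow> real" where
  "level = glue (\<lambda>(z, x). x) (\<lambda>(z, x). if x \<le> 3/2 then 0 else 1)"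

definition scaled_dir1 :: "B \<Rightarrow> complex" where
  "scaled_dir1 = glue (\<lambda>_. 0) (\<lambda>(z, x). min (x - 1) (2 - x) *\<^sub>R z)"

lemma coord_ann0:
  assumes "y \<in> cyl0"
  shows "depth (ann0 y) = 0" "height (ann0 y) = 1 + snd y" "dir0 (ann0 y) = fst y"
    "level (ann0 y) = snd y" "scaled_dir1 (ann0 y) = 0"
  using assms by (auto simp: depth_def height_def dir0_def level_def scaled_dir1_def glue_ann)

lemma coord_ann1:
  assumes "y \<in> cyl1"
  shows "depth (ann1 y) = min (snd y - 1) (2 - snd y)" "height (ann1 y) = snd y"
    "dir0 (ann1 y) = (if snd y \<le> 3/2 then fst y ^ 3 else fst y ^ 2)"
    "level (ann1 y) = (if snd y \<le> 3/2 then 0 else 1)"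
    "scaled_dir1 (ann1 y) = min (snd y - 1) (2 - snd y) *\<^sub>R fst y"
  using assms by (auto simp: depth_def height_def dir0_def level_def scaled_dir1_def glue_ann)

lemma continuous_depth: "continuous_on UNIV depth"
  by (rule continuous_on_B_UNIV) (auto simp: coord_ann0 coord_ann1 intro!: continuous_intros cong: continuous_on_cong)

lemma continuous_height: "continuous_on UNIV height"
  by (rule continuous_on_B_UNIV) (auto simp: coord_ann0 coord_ann1 intro!: continuous_intros cong: continuous_on_cong)

lemma continuous_scaled_dir1: "continuous_on UNIV scaled_dir1"
  by (rule continuous_on_B_UNIV) (auto simp: coord_ann0 coord_ann1 intro!: continuous_intros cong: continuous_on_cong)

lemma open_depth: "open {b. depth b < c}" "open {b. c < depth b}"
  by (intro open_Collect_less continuous_depth continuous_on_const)+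

lemma continuous_dir0: "continuous_on {b. depth b < 1/2} dir0"
proof (rule continuous_on_B[OF open_depth(1)])
  have "continuous_on {y \<in> cyl1. ann1 y \<in> {b. depth b < 1/2}}
    (\<lambda>y. if snd y \<le> 3/2 then fst y ^ 3 else fst y ^ 2)"
    by (intro continuous_on_cases_le continuous_intros) (auto simp: coord_ann1)
  then show "continuous_on {y \<in> cyl1. ann1 y \<in> {b. depth b < 1/2}} (\<lambda>y. dir0 (ann1 y))"
    by (rule continuous_on_eq) (auto simp: coord_ann1)
  show "continuous_on {y \<in> cyl0. ann0 y \<in> {b. depth b < 1/2}} (\<lambda>y. dir0 (ann0 y))"
    by (rule continuous_on_eq[OF continuous_on_fst[OF continuous_on_id]]) (simp add: coord_ann0)
qed

lemma continuous_level: "continuous_on {b. depth b < 1/2} level"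
proof (rule continuous_on_B[OF open_depth(1)])
  have "continuous_on {y \<in> cyl1. ann1 y \<in> {b. depth b < 1/2}}
    (\<lambda>y. if snd y \<le> 3/2 then 0 else 1 :: real)"
    by (intro continuous_on_cases_le continuous_intros) (auto simp: coord_ann1)
  then show "continuous_on {y \<in> cyl1. ann1 y \<in> {b. depth b < 1/2}} (\<lambda>y. level (ann1 y))"
    by (rule continuous_on_eq) (auto simp: coord_ann1)
  show "continuous_on {y \<in> cyl0. ann0 y \<in> {b. depth b < 1/2}} (\<lambda>y. level (ann0 y))"
    by (rule continuous_on_eq[OF continuous_on_snd[OF continuous_on_id]]) (simp add: coord_ann0)
qed

lemma norm_dir0: "cmod (dir0 b) = 1"
  by (cases b rule: B_cases) (auto simp: coord_ann0 coord_ann1 norm_power)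

lemma norm_scaled_dir1: "norm (scaled_dir1 b) = depth b"
  by (cases b rule: B_cases) (auto simp: coord_ann0 coord_ann1)

lemma ann1_coords:
  assumes "0 < depth b"
  shows "ann1 (sgn (scaled_dir1 b), height b) = b" "cmod (sgn (scaled_dir1 b)) = 1" "1 < height b" "height b < 2"
    "dir0 b = (if height b \<le> 3/2 then sgn (scaled_dir1 b) ^ 3 else sgn (scaled_dir1 b) ^ 2)"
proof -
  obtain z x where y: "(z, x) \<in> cyl1" "b = ann1 (z, x)"
    using assms by (cases b rule: B_cases) (auto simp: coord_ann0)
  then have x: "0 < min (x - 1) (2 - x)"
    using assms by (simp add: coord_ann1)
  have r: "sgn (scaled_dir1 b) = z"
    using y x by (simp only: y(2) coord_ann1 fst_conv snd_conv sgn_scaleR sgn_pos) (simp add: sgn_eq)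
  show "ann1 (sgn (scaled_dir1 b), height b) = b" "cmod (sgn (scaled_dir1 b)) = 1" "1 < height b" "height b < 2"
    "dir0 b = (if height b \<le> 3/2 then sgn (scaled_dir1 b) ^ 3 else sgn (scaled_dir1 b) ^ 2)"
    unfolding r using y x by (auto simp: coord_ann1)
qed

lemma continuous_sgn_dir1: "continuous_on {b. 0 < depth b} (\<lambda>b. sgn (scaled_dir1 b))"
proof -
  have "scaled_dir1 b \<noteq> 0" if "0 < depth b" for b
    using that norm_scaled_dir1[of b] by auto
  then show ?thesis
    by (intro continuous_on_sgn continuous_on_subset[OF continuous_scaled_dir1]) auto
qed



section \<open>The piecewise defined map\<close>

lemma phi_tilde_ann:
  "y \<in> cyl0 \<Longrightarrow> phi_tilde (ann0 y) = ann1 (fst y, 2 - snd y)"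
  "y \<in> cyl1 \<Longrightarrow> phi_tilde (ann1 y) = ann0 (fst y ^ 6, 2 - snd y)"
proof -
  let ?f = "\<lambda>(z, x). ann1 (z, 2 - x)" and ?g = "\<lambda>(z, x). ann0 (z ^ 6, 2 - x)"
  have "phi_tilde b = glue ?f ?g b" for b
    using rep_B_in_pieces[of b] unfolding phi_tilde_def glue_def
    by (auto simp: pieces_def ann1_top ann1_bottom abs_S0 abs_S1 norm_power simp flip: ann0_def ann1_def)
  moreover have "?f (z ^ 3, 0) = ?g (z, 1)" "?f (z ^ 2, 1) = ?g (z, 2)" if "z \<in> circle" for z
    using that by (simp_all add: ann1_top ann1_bottom norm_power flip: power_mult)
  ultimately show "y \<in> cyl0 \<Longrightarrow> phi_tilde (ann0 y) = ann1 (fst y, 2 - snd y)"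
    "y \<in> cyl1 \<Longrightarrow> phi_tilde (ann1 y) = ann0 (fst y ^ 6, 2 - snd y)"
    using glue_ann[of ?f ?g y] by (simp_all add: case_prod_beta)
qed

lemma phi_tilde_abs:
  assumes "x \<in> pieces"
  shows "pre_phi x \<in> pieces" "phi_tilde (abs_B x) = abs_B (pre_phi x)"
proof -
  show "pre_phi x \<in> pieces"
    using assms by (auto simp: pieces_def norm_power)
  consider z where "x = S0 z" "z \<in> circle" | z where "x = S1 z" "z \<in> circle"
    | y where "x = A0 y" "y \<in> cyl0" | y where "x = A1 y" "y \<in> cyl1"
    using assms unfolding pieces_def by blast
  then show "phi_tilde (abs_B x) = abs_B (pre_phi x)"
    by cases (auto simp: abs_S0 abs_S1 phi_tilde_ann ann1_top ann1_bottom norm_power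
        simp flip: ann0_def ann1_def)
qed

lemma continuous_phi_tilde: "continuous_on UNIV phi_tilde"
proof (rule continuous_on_B_UNIV)
  have "continuous_on cyl0 (\<lambda>y. ann1 (fst y, 2 - snd y))"
    by (rule continuous_on_compose2[OF continuous_on_ann(2)]) (auto intro!: continuous_intros)
  then show "continuous_on cyl0 (\<lambda>y. phi_tilde (ann0 y))"
    by (rule continuous_on_eq) (simp add: phi_tilde_ann)
  have "continuous_on cyl1 (\<lambda>y. ann0 (fst y ^ 6, 2 - snd y))"
    by (rule continuous_on_compose2[OF continuous_on_ann(1)]) (auto intro!: continuous_intros simp: norm_power)
  then show "continuous_on cyl1 (\<lambda>y. phi_tilde (ann1 y))"
    by (rule continuous_on_eq) (simp add: phi_tilde_ann)
qed

section \<open>Composition of homotopy classes of paths\<close>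

abbreviation pcl :: "(real \<Rightarrow> 'a::topological_space) \<Rightarrow> (real \<Rightarrow> 'a) set" where
  "pcl \<equiv> homotopy_class UNIV"

text \<open>
  The composition of the fundamental groupoid. It extends the multiplication of every fundamental
  group (\<open>mult_fundamental_group\<close>). Requiring the ends to match makes the product of two classes that
  cannot be composed empty, so that associativity holds without any hypothesis on end points.
\<close>

definition class_join :: "(real \<Rightarrow> 'a::topological_space) set \<Rightarrow> (real \<Rightarrow> 'a) set \<Rightarrow> (real \<Rightarrow> 'a) set"
    (infixr "\<star>" 70) where
  "c \<star> d = {r. \<exists>p\<in>c. \<exists>q\<in>d. pathfinish p = pathstart q \<and> homotopic_paths UNIV (p +++ q) r}"

definition paths_only :: "(real \<Rightarrow> 'a::topological_space) set \<Rightarrow> bool" where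
  "paths_only c \<longleftrightarrow> (\<forall>p\<in>c. path p)"

lemma paths_only_pcl [simp]: "paths_only (pcl p)"
  by (auto simp: paths_only_def homotopy_class_def dest: homotopic_paths_imp_path)

lemma paths_only_join [simp]: "paths_only (c \<star> d)"
  by (auto simp: paths_only_def class_join_def dest: homotopic_paths_imp_path)

lemma pcl_eqI: "homotopic_paths UNIV p q \<Longrightarrow> pcl p = pcl q"
  using homotopic_paths_imp_path[of UNIV p q] by (subst homotopy_class_eq_iff) auto

lemma pcl_join:
  assumes "path p" "path q" "pathfinish p = pathstart q"
  shows "pcl p \<star> pcl q = pcl (p +++ q)"
proof -
  have "p \<in> pcl p" "q \<in> pcl q"
    using assms by (simp_all add: homotopy_class_def)
  moreover have "homotopic_paths UNIV (p +++ q) r"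
    if "p' \<in> pcl p" "q' \<in> pcl q" "homotopic_paths UNIV (p' +++ q') r" for p' q' r
    using that homotopic_paths_join[of UNIV p p' q q'] assms homotopic_paths_trans
    unfolding homotopy_class_def by blast
  ultimately show ?thesis
    using assms(3) unfolding class_join_def homotopy_class_def[of _ "p +++ q"] by blast
qed

lemma class_join_assoc:
  assumes "paths_only c" "paths_only d" "paths_only e"
  shows "(c \<star> d) \<star> e = c \<star> d \<star> e"
proof -
  have L: "r \<in> (c \<star> d) \<star> e \<longleftrightarrow> (\<exists>p\<in>c. \<exists>q\<in>d. \<exists>s\<in>e. pathfinish p = pathstart q \<and>
      pathfinish q = pathstart s \<and> homotopic_paths UNIV (p +++ q +++ s) r)" for r
  proof
    assume "r \<in> (c \<star> d) \<star> e"
    then obtain p q x s where x: "p \<in> c" "q \<in> d" "s \<in> e" "pathfinish p = pathstart q"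
      "homotopic_paths UNIV (p +++ q) x" "pathfinish x = pathstart s" "homotopic_paths UNIV (x +++ s) r"
      by (auto simp: class_join_def)
    moreover have "pathfinish q = pathstart s"
      using homotopic_paths_imp_pathfinish[OF x(5)] x(6) by simp
    moreover from this have "homotopic_paths UNIV ((p +++ q) +++ s) (x +++ s)"
      using x assms by (intro homotopic_paths_join) (auto simp: paths_only_def)
    moreover have "homotopic_paths UNIV (p +++ q +++ s) ((p +++ q) +++ s)"
      using x assms \<open>pathfinish q = pathstart s\<close>
      by (intro homotopic_paths_assoc) (auto simp: paths_only_def)
    ultimately show "\<exists>p\<in>c. \<exists>q\<in>d. \<exists>s\<in>e. pathfinish p = pathstart q \<and>
      pathfinish q = pathstart s \<and> homotopic_paths UNIV (p +++ q +++ s) r"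
      by (meson homotopic_paths_trans)
  next
    assume "\<exists>p\<in>c. \<exists>q\<in>d. \<exists>s\<in>e. pathfinish p = pathstart q \<and>
      pathfinish q = pathstart s \<and> homotopic_paths UNIV (p +++ q +++ s) r"
    then obtain p q s where x: "p \<in> c" "q \<in> d" "s \<in> e" "pathfinish p = pathstart q"
      "pathfinish q = pathstart s" "homotopic_paths UNIV (p +++ q +++ s) r"
      by blast
    then have p: "path p" "path q" "path s"
      using assms by (auto simp: paths_only_def)
    then have "homotopic_paths UNIV (p +++ q +++ s) ((p +++ q) +++ s)"
      using x by (intro homotopic_paths_assoc) auto
    with x(6) have 1: "homotopic_paths UNIV ((p +++ q) +++ s) r"
      by (meson homotopic_paths_sym homotopic_paths_trans)
    have 2: "p +++ q \<in> c \<star> d"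
      unfolding class_join_def mem_Collect_eq
      by (rule bexI[of _ p], rule bexI[of _ q]) (use x p in auto)
    show "r \<in> (c \<star> d) \<star> e"
      unfolding class_join_def[of "c \<star> d"] mem_Collect_eq
      by (rule bexI[of _ "p +++ q"], rule bexI[of _ s]) (use x 1 2 in auto)
  qed
  have R: "r \<in> c \<star> d \<star> e \<longleftrightarrow> (\<exists>p\<in>c. \<exists>q\<in>d. \<exists>s\<in>e. pathfinish p = pathstart q \<and>
      pathfinish q = pathstart s \<and> homotopic_paths UNIV (p +++ q +++ s) r)" for r
  proof
    assume "r \<in> c \<star> d \<star> e"
    then obtain p q x s where x: "p \<in> c" "q \<in> d" "s \<in> e" "pathfinish q = pathstart s"
      "homotopic_paths UNIV (q +++ s) x" "pathfinish p = pathstart x" "homotopic_paths UNIV (p +++ x) r"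
      by (auto simp: class_join_def)
    moreover have "pathfinish p = pathstart q"
      using homotopic_paths_imp_pathstart[OF x(5)] x(6) by simp
    moreover from this have "homotopic_paths UNIV (p +++ q +++ s) (p +++ x)"
      using x assms by (intro homotopic_paths_join) (auto simp: paths_only_def)
    ultimately show "\<exists>p\<in>c. \<exists>q\<in>d. \<exists>s\<in>e. pathfinish p = pathstart q \<and>
      pathfinish q = pathstart s \<and> homotopic_paths UNIV (p +++ q +++ s) r"
      by (meson homotopic_paths_trans)
  next
    assume "\<exists>p\<in>c. \<exists>q\<in>d. \<exists>s\<in>e. pathfinish p = pathstart q \<and>
      pathfinish q = pathstart s \<and> homotopic_paths UNIV (p +++ q +++ s) r"
    then obtain p q s where x: "p \<in> c" "q \<in> d" "s \<in> e" "pathfinish p = pathstart q"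
      "pathfinish q = pathstart s" "homotopic_paths UNIV (p +++ q +++ s) r"
      by blast
    have 1: "q +++ s \<in> d \<star> e"
      unfolding class_join_def mem_Collect_eq
      by (rule bexI[of _ q], rule bexI[of _ s]) (use assms x in \<open>auto simp: paths_only_def\<close>)
    show "r \<in> c \<star> d \<star> e"
      unfolding class_join_def[of c] mem_Collect_eq
      by (rule bexI[of _ p], rule bexI[of _ "q +++ s"]) (use x 1 in auto)
  qed
  show ?thesis
    using L R by blast
qed

lemma mult_fundamental_group:
  assumes "c \<in> carrier (fundamental_group UNIV x)" "d \<in> carrier (fundamental_group UNIV x)"
  shows "c \<otimes>\<^bsub>fundamental_group UNIV x\<^esub> d = c \<star> d"
proof -
  obtain p q where "c = pcl p" "d = pcl q" "p \<in> loops_at UNIV x" "q \<in> loops_at UNIV x"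
    using assms by (auto simp: fundamental_group_def)
  then show ?thesis
    by (simp add: mult_homotopy_class) (simp add: loops_at_def pcl_join)
qed

lemma carrier_paths_only:
  "c \<in> carrier (fundamental_group UNIV x) \<Longrightarrow> paths_only c"
  by (auto simp: fundamental_group_def)

lemma pcl_carrier:
  "path p \<Longrightarrow> pathstart p = x \<Longrightarrow> pathfinish p = x \<Longrightarrow> pcl p \<in> carrier (fundamental_group UNIV x)"
  by (auto simp: fundamental_group_def loops_at_def)

section \<open>Segments in the universal covers of the two annuli\<close>

definition par0 :: "real \<times> real \<Rightarrow> B" where "par0 u = ann0 (cis (2 * pi * fst u), snd u)"
definition par1 :: "real \<times> real \<Rightarrow> B" where "par1 u = ann1 (cis (2 * pi * fst u), snd u)"

abbreviation strip0 :: "(real \<times> real) set" where "strip0 \<equiv> UNIV \<times> {0..1}"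
abbreviation strip1 :: "(real \<times> real) set" where "strip1 \<equiv> UNIV \<times> {1..2}"

lemma continuous_par: "continuous_on strip0 par0" "continuous_on strip1 par1"
  unfolding par0_def par1_def
  by (rule continuous_on_compose2[OF continuous_on_ann(1)] continuous_on_compose2[OF continuous_on_ann(2)];
      auto intro!: continuous_intros)+

lemma convex_strip: "convex strip0" "convex strip1"
  by (auto intro: convex_Times)

text \<open>
  Every path class below is a product of images of straight segments in the strips \<open>\<real> \<times> [0,1]\<close>
  and \<open>\<real> \<times> [1,2]\<close>, the universal covers of the annuli. Segments compose inside a strip
  (\<open>seg_join\<close>), are invariant under integer translations (\<open>seg_shift0\<close>, \<open>seg_shift1\<close>), and a
  boundary segment of the strip over \<open>A\<^sub>1\<close> equals a three or two times longer segment of the strip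
  over \<open>A\<^sub>0\<close> (\<open>seg_bottom\<close>, \<open>seg_top\<close>). All relations in \<open>\<pi>\<^sub>1(B)\<close> come from these rules.
\<close>

definition seg :: "('a::real_normed_vector \<Rightarrow> 'b::topological_space) \<Rightarrow> 'a \<Rightarrow> 'a \<Rightarrow> (real \<Rightarrow> 'b) set" where
  "seg f u v = pcl (f \<circ> linepath u v)"

lemma pcl_convex:
  fixes g h :: "real \<Rightarrow> 'a::real_normed_vector"
  assumes "convex C" "continuous_on C f" "path g" "path h" "path_image g \<subseteq> C" "path_image h \<subseteq> C"
    "pathstart g = pathstart h" "pathfinish g = pathfinish h"
  shows "pcl (f \<circ> g) = pcl (f \<circ> h)"
proof -
  have "homotopic_paths C g h"
    using assms
    by (intro homotopic_paths_linear closed_segment_subset) (auto simp: path_image_def image_subset_iff)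
  then show ?thesis
    using assms(2) by (intro pcl_eqI homotopic_paths_continuous_image[of C]) auto
qed

lemma path_convex_linepath:
  fixes u v :: "'a::real_normed_vector"
  assumes "convex C" "continuous_on C f" "u \<in> C" "v \<in> C"
  shows "path (f \<circ> linepath u v)"
  using continuous_on_subset[OF assms(2), of "closed_segment u v"] assms
  by (intro path_continuous_image) (simp_all add: closed_segment_subset)

lemma seg_join:
  assumes "convex C" "continuous_on C f" "u \<in> C" "v \<in> C" "w \<in> C"
  shows "seg f u v \<star> seg f v w = seg f u w"
proof -
  have "seg f u v \<star> seg f v w = pcl (f \<circ> (linepath u v +++ linepath v w))"
    using path_convex_linepath[OF assms(1,2)] assms
    by (simp add: seg_def pcl_join path_compose_join pathstart_compose pathfinish_compose)
  also have "\<dots> = seg f u w"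
    unfolding seg_def using assms
    by (intro pcl_convex[of C]) (auto simp: closed_segment_subset path_image_join)
  finally show ?thesis .
qed

lemma paths_only_seg [simp]: "paths_only (seg f u v)"
  by (simp add: seg_def)

lemma seg_join0:
  assumes "x \<in> {0..1}" "y \<in> {0..1}" "z \<in> {0..1}"
  shows "seg par0 (a, x) (b, y) \<star> seg par0 (b, y) (c, z) = seg par0 (a, x) (c, z)"
    "paths_only e \<Longrightarrow> seg par0 (a, x) (b, y) \<star> seg par0 (b, y) (c, z) \<star> e = seg par0 (a, x) (c, z) \<star> e"
proof -
  show *: "seg par0 (a, x) (b, y) \<star> seg par0 (b, y) (c, z) = seg par0 (a, x) (c, z)"
    by (rule seg_join[OF convex_strip(1) continuous_par(1)]) (use assms in auto)
  show "seg par0 (a, x) (b, y) \<star> seg par0 (b, y) (c, z) \<star> e = seg par0 (a, x) (c, z) \<star> e" if "paths_only e"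
    using that by (simp add: * flip: class_join_assoc)
qed

lemma seg_join1:
  assumes "x \<in> {1..2}" "y \<in> {1..2}" "z \<in> {1..2}"
  shows "seg par1 (a, x) (b, y) \<star> seg par1 (b, y) (c, z) = seg par1 (a, x) (c, z)"
    "paths_only e \<Longrightarrow> seg par1 (a, x) (b, y) \<star> seg par1 (b, y) (c, z) \<star> e = seg par1 (a, x) (c, z) \<star> e"
proof -
  show *: "seg par1 (a, x) (b, y) \<star> seg par1 (b, y) (c, z) = seg par1 (a, x) (c, z)"
    by (rule seg_join[OF convex_strip(2) continuous_par(2)]) (use assms in auto)
  show "seg par1 (a, x) (b, y) \<star> seg par1 (b, y) (c, z) \<star> e = seg par1 (a, x) (c, z) \<star> e" if "paths_only e"
    using that by (simp add: * flip: class_join_assoc)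
qed

lemma cis_eq_iff: "cis (2 * pi * s) = cis (2 * pi * t) \<longleftrightarrow> (\<exists>n::int. t = s + n)"
proof -
  have "cis (2 * pi * s) = cis (2 * pi * t) \<longleftrightarrow> (\<exists>n::int. 2 * pi * t = 2 * pi * s + 2 * pi * n)"
    using sin_cos_eq_iff[of "2 * pi * t" "2 * pi * s"] by (auto simp: complex_eq_iff)
  also have "\<dots> \<longleftrightarrow> (\<exists>n::int. t = s + n)"
  proof -
    have "2 * pi * t = 2 * pi * s + 2 * pi * n \<longleftrightarrow> t = s + n" for n :: int
      unfolding distrib_left[symmetric] by simp
    then show ?thesis by simp
  qed
  finally show ?thesis .
qed

lemma cis_shift: "cis (2 * pi * (s + of_int n)) = cis (2 * pi * s)"
  using cis_eq_iff[of s "s + of_int n"] by auto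

lemma seg_shift0: "seg par0 (a + of_int n, x) (b + of_int n, y) = seg par0 (a, x) (b, y)"
proof -
  have "par0 \<circ> linepath (a + of_int n, x) (b + of_int n, y) = par0 \<circ> linepath (a, x) (b, y)"
  proof
    fix t
    have "(1 - t) * (a + n) + t * (b + n) = ((1 - t) * a + t * b) + n"
      by (simp add: algebra_simps)
    then show "(par0 \<circ> linepath (a + of_int n, x) (b + of_int n, y)) t = (par0 \<circ> linepath (a, x) (b, y)) t"
      by (simp add: linepath_def par0_def cis_shift)
  qed
  then show ?thesis by (simp add: seg_def)
qed

lemma seg_shift1: "seg par1 (a + of_int n, x) (b + of_int n, y) = seg par1 (a, x) (b, y)"
proof -
  have "par1 \<circ> linepath (a + of_int n, x) (b + of_int n, y) = par1 \<circ> linepath (a, x) (b, y)"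
  proof
    fix t
    have "(1 - t) * (a + n) + t * (b + n) = ((1 - t) * a + t * b) + n"
      by (simp add: algebra_simps)
    then show "(par1 \<circ> linepath (a + of_int n, x) (b + of_int n, y)) t = (par1 \<circ> linepath (a, x) (b, y)) t"
      by (simp add: linepath_def par1_def cis_shift)
  qed
  then show ?thesis by (simp add: seg_def)
qed

lemma cis_power: "cis (2 * pi * s) ^ k = cis (2 * pi * (real k * s))"
  unfolding Complex.DeMoivre by (simp only: mult_ac)

lemma par1_bottom: "par1 (s, 1) = par0 (3 * s, 0)"
  using cis_power[of s 3] by (simp add: par0_def par1_def ann1_bottom)

lemma par1_top: "par1 (s, 2) = par0 (2 * s, 1)"
  using cis_power[of s 2] by (simp add: par0_def par1_def ann1_top)

lemma seg_bottom: "seg par1 (a, 1) (b, 1) = seg par0 (3 * a, 0) (3 * b, 0)"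
proof -
  have "par1 \<circ> linepath (a, 1) (b, 1) = par0 \<circ> linepath (3 * a, 0) (3 * b, 0)"
    by (simp add: fun_eq_iff linepath_def par1_bottom algebra_simps)
  then show ?thesis by (simp add: seg_def)
qed

lemma seg_top: "seg par1 (a, 2) (b, 2) = seg par0 (2 * a, 1) (2 * b, 1)"
proof -
  have "par1 \<circ> linepath (a, 2) (b, 2) = par0 \<circ> linepath (2 * a, 1) (2 * b, 1)"
    by (simp add: fun_eq_iff linepath_def par1_top algebra_simps)
  then show ?thesis by (simp add: seg_def)
qed

lemma path_par0: "u \<in> strip0 \<Longrightarrow> v \<in> strip0 \<Longrightarrow> path (par0 \<circ> linepath u v)"
  by (rule path_convex_linepath[OF convex_strip(1) continuous_par(1)])

lemma path_par1: "u \<in> strip1 \<Longrightarrow> v \<in> strip1 \<Longrightarrow> path (par1 \<circ> linepath u v)"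
  by (rule path_convex_linepath[OF convex_strip(2) continuous_par(2)])

lemma par0_cong:
  assumes "u \<in> strip0" "v \<in> strip0" "par0 u = par0 v"
  obtains n :: int where "v = (fst u + n, snd u)"
proof -
  have c: "(cis (2 * pi * fst u), snd u) \<in> cyl0" "(cis (2 * pi * fst v), snd v) \<in> cyl0"
    using assms by auto
  have "cis (2 * pi * fst u) = cis (2 * pi * fst v)" "snd u = snd v"
    using coord_ann0(3,4)[OF c(1)] coord_ann0(3,4)[OF c(2)] assms(3) by (simp_all add: par0_def)
  then obtain n :: int where "fst v = fst u + n"
    by (auto simp only: cis_eq_iff)
  with \<open>snd u = snd v\<close> show ?thesis
    using that[of n] by (simp add: prod_eq_iff)
qed

lemma par1_par0:
  assumes "u \<in> strip1" "v \<in> strip0" "par1 u = par0 v"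
  shows "snd u = 1 \<or> snd u = 2"
proof -
  have c: "(cis (2 * pi * fst u), snd u) \<in> cyl1" "(cis (2 * pi * fst v), snd v) \<in> cyl0"
    using assms by auto
  then show ?thesis
    using coord_ann1(1)[OF c(1)] coord_ann0(1)[OF c(2)] assms(3) by (simp add: par0_def par1_def min_def split: if_splits)
qed

lemma par1_cong:
  assumes "u \<in> strip1" "v \<in> strip1" "par1 u = par1 v" "snd u \<noteq> 1" "snd u \<noteq> 2"
  obtains n :: int where "v = (fst u + n, snd u)"
proof -
  have c: "(cis (2 * pi * fst u), snd u) \<in> cyl1" "(cis (2 * pi * fst v), snd v) \<in> cyl1"
    using assms by auto
  have s: "snd u = snd v"
    using coord_ann1(2)[OF c(1)] coord_ann1(2)[OF c(2)] assms(3) by (simp add: par1_def)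
  have "min (snd u - 1) (2 - snd u) \<noteq> 0"
    using assms(4,5) by (simp add: min_def)
  then have "cis (2 * pi * fst u) = cis (2 * pi * fst v)"
    using coord_ann1(5)[OF c(1)] coord_ann1(5)[OF c(2)] assms(3) s
    unfolding par1_def fst_conv snd_conv by (metis scaleR_left_imp_eq)
  then obtain n :: int where "fst v = fst u + n"
    by (auto simp only: cis_eq_iff)
  with s show ?thesis
    using that[of n] by (simp add: prod_eq_iff)
qed

abbreviation line0 :: "real \<times> real \<Rightarrow> real \<times> real \<Rightarrow> real \<Rightarrow> B" where "line0 u v \<equiv> par0 \<circ> linepath u v"
abbreviation line1 :: "real \<times> real \<Rightarrow> real \<times> real \<Rightarrow> real \<Rightarrow> B" where "line1 u v \<equiv> par1 \<circ> linepath u v"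

lemma line0_vertical: "line0 (0, x) (0, y) t = abs_B (A0 (1, x + t * (y - x)))"
proof -
  have "(1 - t) * x + t * y = x + t * (y - x)" by (simp add: algebra_simps)
  then show ?thesis by (simp add: linepath_def par0_def ann0_def)
qed

lemma line1_vertical: "line1 (0, x) (0, y) t = abs_B (A1 (1, x + t * (y - x)))"
proof -
  have "(1 - t) * x + t * y = x + t * (y - x)" by (simp add: algebra_simps)
  then show ?thesis by (simp add: linepath_def par1_def ann1_def)
qed

lemma line_horizontal:
  "line0 (0, x) (1, x) t = abs_B (A0 (cis (2 * pi * t), x))"
  "line1 (0, x) (1, x) t = abs_B (A1 (cis (2 * pi * t), x))"
proof -
  have "(1 - t) * x + t * x = x" by (simp add: algebra_simps)
  then show "line0 (0, x) (1, x) t = abs_B (A0 (cis (2 * pi * t), x))"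
    "line1 (0, x) (1, x) t = abs_B (A1 (cis (2 * pi * t), x))"
    by (simp_all add: linepath_def par0_def par1_def ann0_def ann1_def)
qed

lemma abs_cong: "x = y \<Longrightarrow> abs_B (A0 (z, x)) = abs_B (A0 (z, y))" "x = y \<Longrightarrow> abs_B (A1 (z, x)) = abs_B (A1 (z, y))"
  by simp_all

lemma gamma1_eq: "gamma1 = line0 (0, 1/2) (1, 1/2)"
  by (simp only: fun_eq_iff gamma1_def line_horizontal) simp

lemma gamma2_eq:
  "gamma2 = (line0 (0, 1/2) (0, 0) +++ line1 (0, 1) (0, 3/2)) +++
    (line1 (0, 3/2) (0, 2) +++ line0 (0, 1) (0, 1/2))"
  unfolding fun_eq_iff gamma2_def joinpaths_def line0_vertical line1_vertical
  by (auto intro!: abs_cong simp: field_simps)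

lemma path1_eq: "path1 = line0 (0, 1/2) (0, 1) +++ line1 (0, 2) (0, 3/2)"
  unfolding fun_eq_iff path1_def joinpaths_def line0_vertical line1_vertical
  by (auto intro!: abs_cong simp: field_simps)

lemma path2_eq: "path2 = line0 (0, 1/2) (0, 0) +++ line1 (0, 1) (0, 3/2)"
  unfolding fun_eq_iff path2_def joinpaths_def line0_vertical line1_vertical
  by (auto intro!: abs_cong simp: field_simps)

lemma par_ends: "par0 (0, 1/2) = base0" "par1 (0, 3/2) = base1" "par0 (of_int n, 1/2) = base0"
  "par1 (0, 1) = par0 (0, 0)" "par1 (0, 2) = par0 (0, 1)"
proof -
  show "par0 (0, 1/2) = base0" "par1 (0, 3/2) = base1" "par0 (of_int n, 1/2) = base0"
    using cis_shift[of 0 n] by (simp_all add: par0_def par1_def base0_def base1_def ann0_def ann1_def)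
  show "par1 (0, 1) = par0 (0, 0)" "par1 (0, 2) = par0 (0, 1)"
    by (simp_all add: par1_bottom par1_top)
qed

lemma pcl_gamma1: "pcl gamma1 = seg par0 (0, 1/2) (1, 1/2)"
  by (simp add: gamma1_eq seg_def)

lemma path_gamma1: "path gamma1" "pathstart gamma1 = base0" "pathfinish gamma1 = base0"
  using par_ends(3)[of 1] by (simp_all add: gamma1_eq path_par0 par_ends pathstart_compose pathfinish_compose)

lemma path_gamma2: "path gamma2" "pathstart gamma2 = base0" "pathfinish gamma2 = base0"
  by (simp_all add: gamma2_eq path_par0 path_par1 par_ends pathstart_compose pathfinish_compose)

lemma pcl_gamma2: "pcl gamma2 = seg par0 (0, 1/2) (0, 0) \<star> seg par1 (0, 1) (0, 2) \<star> seg par0 (0, 1) (0, 1/2)"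
proof -
  have "pcl gamma2 = (seg par0 (0, 1/2) (0, 0) \<star> seg par1 (0, 1) (0, 3/2)) \<star>
      (seg par1 (0, 3/2) (0, 2) \<star> seg par0 (0, 1) (0, 1/2))"
    by (simp add: gamma2_eq seg_def pcl_join path_par0 path_par1 par_ends pathstart_compose pathfinish_compose)
  then show ?thesis
    by (simp add: class_join_assoc seg_join1)
qed

lemma group_pi1: "group (pi1_B x)"
  by (simp add: group_fundamental_group)

lemma one_pi1: "\<one>\<^bsub>pi1_B base0\<^esub> = seg par0 (0, 1/2) (0, 1/2)"
  by (simp add: fundamental_group_def seg_def par_ends linepath_refl comp_def)

lemma gamma_carrier: "pcl gamma1 \<in> carrier (pi1_B base0)" "pcl gamma2 \<in> carrier (pi1_B base0)"
  by (simp_all add: pcl_carrier path_gamma1 path_gamma2)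

lemma seg_loop_carrier: "seg par0 (0, 1/2) (of_int n, 1/2) \<in> carrier (pi1_B base0)"
  unfolding seg_def by (rule pcl_carrier) (simp_all add: path_par0 par_ends pathstart_compose pathfinish_compose)

section \<open>Standard paths modulo the two loops\<close>

abbreviation gens :: "(real \<Rightarrow> B) set set" where
  "gens \<equiv> generate (pi1_B base0) {pcl gamma1, pcl gamma2}"

lemma gens_carrier: "h \<in> gens \<Longrightarrow> h \<in> carrier (pi1_B base0)"
  using group.generate_in_carrier[OF group_pi1, of "{pcl gamma1, pcl gamma2}" base0 h] gamma_carrier by simp

lemma gens_paths_only: "h \<in> gens \<Longrightarrow> paths_only h"
  using gens_carrier carrier_paths_only by blast

lemma gens_join: "h \<in> gens \<Longrightarrow> k \<in> gens \<Longrightarrow> h \<star> k \<in> gens"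
  by (metis gens_carrier generate.eng mult_fundamental_group)

lemma gens_one: "seg par0 (0, 1/2) (0, 1/2) \<in> gens"
  using generate.one[of "pi1_B base0"] by (simp add: one_pi1)

lemma gens_inverse:
  assumes "h \<in> gens"
  obtains k where "k \<in> gens" "k \<star> h = seg par0 (0, 1/2) (0, 1/2)"
proof -
  interpret group "pi1_B base0" by (rule group_pi1)
  have "inv\<^bsub>pi1_B base0\<^esub> h \<in> gens"
    using assms gamma_carrier by (intro generate_m_inv_closed) auto
  moreover have "inv\<^bsub>pi1_B base0\<^esub> h \<star> h = seg par0 (0, 1/2) (0, 1/2)"
    using assms gens_carrier by (simp flip: mult_fundamental_group[where x = base0] one_pi1)
  ultimately show ?thesis using that by blast
qed

text \<open>
  The straight loop winding \<open>n\<close> times around \<open>A\<^sub>0\<close> splits into \<open>n\<close> translates of \<open>\<gamma>\<^sub>1\<close>.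
\<close>

lemma seg_loop_nat:
  "seg par0 (0, 1/2) (real n, 1/2) = pcl gamma1 [^]\<^bsub>pi1_B base0\<^esub> n"
proof (induction n)
  case 0
  show ?case by (simp add: fundamental_group_def seg_def par_ends linepath_refl comp_def)
next
  case (Suc n)
  interpret group "pi1_B base0" by (rule group_pi1)
  have "seg par0 (0, 1/2) (real (Suc n), 1/2) = seg par0 (0, 1/2) (real n, 1/2) \<star> seg par0 (real n, 1/2) (real (Suc n), 1/2)"
    by (simp add: seg_join0)
  also have "seg par0 (real n, 1/2) (real (Suc n), 1/2) = pcl gamma1"
    using seg_shift0[of 0 "int n" "1/2" 1 "1/2"] by (simp add: pcl_gamma1 add.commute)
  finally show ?case
    using gamma_carrier by (simp add: Suc mult_fundamental_group)
qed

lemma gens_seg_loop: "seg par0 (0, 1/2) (of_int n, 1/2) \<in> gens"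
proof -
  interpret group "pi1_B base0" by (rule group_pi1)
  have pos: "seg par0 (0, 1/2) (real m, 1/2) \<in> gens" for m
  proof (induction m)
    case 0
    show ?case using gens_one by simp
  next
    case (Suc m)
    then show ?case
      unfolding seg_loop_nat nat_pow_Suc by (simp add: generate.eng generate.incl)
  qed
  show ?thesis
  proof (cases "n \<ge> 0")
    case True
    then show ?thesis using pos[of "nat n"] by simp
  next
    case False
    define m where "m = nat (- n)"
    have n: "of_int n = - real m" using False by (simp add: m_def)
    have "seg par0 (0, 1/2) (- real m, 1/2) \<otimes>\<^bsub>pi1_B base0\<^esub> seg par0 (0, 1/2) (real m, 1/2)
        = seg par0 (0, 1/2) (- real m, 1/2) \<star> seg par0 (- real m, 1/2) (0, 1/2)"
      using seg_shift0[of "- real m" "int m" "1/2" 0 "1/2"] seg_loop_carrier[of "- int m"] seg_loop_carrier[of "int m"]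
      by (simp add: mult_fundamental_group)
    also have "\<dots> = \<one>\<^bsub>pi1_B base0\<^esub>"
      by (simp add: seg_join0 one_pi1)
    finally have "seg par0 (0, 1/2) (- real m, 1/2) = inv\<^bsub>pi1_B base0\<^esub> (seg par0 (0, 1/2) (real m, 1/2))"
      using seg_loop_carrier[of "- int m"] seg_loop_carrier[of "int m"]
      by (intro inv_equality[symmetric]) auto
    then show ?thesis
      using pos[of m] gamma_carrier unfolding n by (auto intro: generate_m_inv_closed)
  qed
qed

text \<open>
  For each point of a strip, a chosen path from the base point to its image: straight in the
  strip over \<open>A\<^sub>0\<close>, respectively down to the circle \<open>S\<^sub>0\<close> and then straight in the strip over \<open>A\<^sub>1\<close>.
  A point of \<open>B\<close> has many preimages in the strips; the
  chosen paths to all of them differ only by elements of the subgroup generated by the two loops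
  (\<open>std0_std0\<close>, \<open>std1_std0\<close>, \<open>std1_std1\<close>).
\<close>

definition std0 :: "real \<times> real \<Rightarrow> (real \<Rightarrow> B) set" where
  "std0 u = seg par0 (0, 1/2) u"

definition std1 :: "real \<times> real \<Rightarrow> (real \<Rightarrow> B) set" where
  "std1 u = seg par0 (0, 1/2) (0, 0) \<star> seg par1 (0, 1) u"

definition same_coset :: "(real \<Rightarrow> B) set \<Rightarrow> (real \<Rightarrow> B) set \<Rightarrow> bool" where
  "same_coset c d \<longleftrightarrow> (\<exists>h\<in>gens. c = h \<star> d)"

lemma std_paths_only [simp]: "paths_only (std0 u)" "paths_only (std1 u)"
  by (simp_all add: std0_def std1_def)

lemma std_one:
  "u \<in> strip0 \<Longrightarrow> seg par0 (0, 1/2) (0, 1/2) \<star> std0 u = std0 u"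
  "seg par0 (0, 1/2) (0, 1/2) \<star> std1 u = std1 u"
  by (cases u; auto simp: std0_def std1_def seg_join0)+

lemma same_coset_refl: "u \<in> strip0 \<Longrightarrow> same_coset (std0 u) (std0 u)"
  unfolding same_coset_def using std_one(1) gens_one by metis

lemma same_coset_trans:
  assumes "same_coset c d" "same_coset d e" "paths_only e"
  shows "same_coset c e"
proof -
  obtain h k where "h \<in> gens" "k \<in> gens" "c = h \<star> d" "d = k \<star> e"
    using assms by (auto simp: same_coset_def)
  then show ?thesis
    unfolding same_coset_def using assms(3)
    by (intro bexI[of _ "h \<star> k"]) (auto simp: class_join_assoc gens_paths_only gens_join)
qed

lemma same_coset_sym:
  assumes "same_coset c d" "paths_only d" "seg par0 (0, 1/2) (0, 1/2) \<star> d = d"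
  shows "same_coset d c"
proof -
  obtain h where h: "h \<in> gens" "c = h \<star> d"
    using assms by (auto simp: same_coset_def)
  obtain k where k: "k \<in> gens" "k \<star> h = seg par0 (0, 1/2) (0, 1/2)"
    using gens_inverse[OF h(1)] by blast
  have "d = k \<star> c"
    using k h assms by (simp add: gens_paths_only flip: class_join_assoc)
  with k show ?thesis by (auto simp: same_coset_def)
qed

text \<open>
  Translating the end point by \<open>n\<close> amounts to running \<open>n\<close> times around \<open>\<gamma>\<^sub>1\<close> first.
\<close>

lemma std0_shift:
  assumes "x \<in> {0..1}"
  shows "same_coset (std0 (s + of_int n, x)) (std0 (s, x))"
proof -
  have "std0 (s + of_int n, x) = seg par0 (0, 1/2) (of_int n, 1/2) \<star> seg par0 (of_int n, 1/2) (s + of_int n, x)"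
    using assms by (simp add: std0_def seg_join0)
  also have "seg par0 (of_int n, 1/2) (s + of_int n, x) = std0 (s, x)"
    using seg_shift0[of 0 n "1/2" s x] by (simp add: std0_def)
  finally show ?thesis
    unfolding same_coset_def using gens_seg_loop by blast
qed

lemma std0_std0:
  assumes "u \<in> strip0" "v \<in> strip0" "par0 u = par0 v"
  shows "same_coset (std0 u) (std0 v)"
proof -
  obtain n :: int where "u = (fst v + n, snd v)"
    using par0_cong[OF assms(2,1)] assms(3) by metis
  then show ?thesis
    using std0_shift[of "snd v" "fst v" n] assms by (auto simp: mem_Times_iff)
qed

lemma std1_bottom: "std1 (s, 1) = std0 (3 * s, 0)"
  using seg_bottom[of 0 s] by (simp add: std1_def std0_def seg_join0)

text \<open>
  The factor is \<open>[\<gamma>\<^sub>2]\<close>: the standard path crosses \<open>A\<^sub>1\<close> upwards, and returning through \<open>A\<^sub>0\<close> to the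
  base point closes it up to \<open>\<gamma>\<^sub>2\<close>.
\<close>

lemma std1_top: "same_coset (std1 (s, 2)) (std0 (2 * s, 1))"
proof -
  have "std1 (s, 2) = seg par0 (0, 1/2) (0, 0) \<star> seg par1 (0, 1) (0, 2) \<star> seg par1 (0, 2) (s, 2)"
    by (simp add: std1_def seg_join1)
  also have "seg par1 (0, 2) (s, 2) = seg par0 (0, 1) (0, 1/2) \<star> std0 (2 * s, 1)"
    using seg_top[of 0 s] by (simp add: std0_def seg_join0)
  finally have "std1 (s, 2) = pcl gamma2 \<star> std0 (2 * s, 1)"
    by (simp add: pcl_gamma2 class_join_assoc)
  then show ?thesis
    unfolding same_coset_def by (auto intro: generate.incl)
qed

lemma std1_ends:
  assumes "u \<in> strip1" "snd u = 1 \<or> snd u = 2"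
  obtains v where "v \<in> strip0" "par1 u = par0 v" "same_coset (std1 u) (std0 v)"
proof (cases "snd u = 1")
  case True
  then have "u = (fst u, 1)" by (simp add: prod_eq_iff)
  then show ?thesis
    using that[of "(3 * fst u, 0)"] std1_bottom[of "fst u"] par1_bottom[of "fst u"]
      same_coset_refl[of "(3 * fst u, 0)"] by simp
next
  case False
  then have "u = (fst u, 2)" using assms by (simp add: prod_eq_iff)
  then show ?thesis
    using that[of "(2 * fst u, 1)"] std1_top[of "fst u"] par1_top[of "fst u"] by simp
qed

lemma std1_std0:
  assumes "u \<in> strip1" "v \<in> strip0" "par1 u = par0 v"
  shows "same_coset (std1 u) (std0 v)" "same_coset (std0 v) (std1 u)"
proof -
  obtain w where w: "w \<in> strip0" "par1 u = par0 w" "same_coset (std1 u) (std0 w)"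
    using std1_ends[OF assms(1) par1_par0[OF assms]] by blast
  then show *: "same_coset (std1 u) (std0 v)"
    using std0_std0[OF w(1) assms(2)] assms(3) same_coset_trans[OF w(3)] by simp
  show "same_coset (std0 v) (std1 u)"
    using same_coset_sym[OF *] std_one assms(2) by simp
qed

text \<open>
  A loop around the bottom of \<open>A\<^sub>1\<close> is three times the loop of \<open>A\<^sub>0\<close>, so the factor is the
  \<open>3n\<close>-th power of \<open>[\<gamma>\<^sub>1]\<close>.
\<close>

lemma std1_shift:
  assumes "x \<in> {1..2}"
  shows "same_coset (std1 (s + of_int n, x)) (std1 (s, x))"
proof -
  have "std1 (s + of_int n, x) = seg par0 (0, 1/2) (0, 0) \<star> seg par1 (0, 1) (of_int n, 1) \<star> seg par1 (of_int n, 1) (s + of_int n, x)"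
    using assms by (simp add: std1_def seg_join1)
  also have "seg par1 (of_int n, 1) (s + of_int n, x) = seg par1 (0, 1) (s, x)"
    using seg_shift1[of 0 n 1 s x] by simp
  also have "seg par0 (0, 1/2) (0, 0) \<star> seg par1 (0, 1) (of_int n, 1) \<star> seg par1 (0, 1) (s, x) =
      seg par0 (0, 1/2) (3 * of_int n, 1/2) \<star> seg par0 (3 * of_int n, 1/2) (3 * of_int n, 0) \<star> seg par1 (0, 1) (s, x)"
    using seg_bottom[of 0 "of_int n"] by (simp add: seg_join0)
  also have "seg par0 (3 * of_int n, 1/2) (3 * of_int n, 0) = seg par0 (0, 1/2) (0, 0)"
    using seg_shift0[of 0 "3 * n" "1/2" 0 0] by simp
  also have "seg par0 (0, 1/2) (0, 0) \<star> seg par1 (0, 1) (s, x) = std1 (s, x)"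
    by (simp add: std1_def)
  finally show ?thesis
    unfolding same_coset_def using gens_seg_loop[of "3 * n"] by auto
qed

lemma std1_std1:
  assumes "u \<in> strip1" "v \<in> strip1" "par1 u = par1 v"
  shows "same_coset (std1 u) (std1 v)"
proof (cases "snd v = 1 \<or> snd v = 2")
  case True
  obtain w where w: "w \<in> strip0" "par1 v = par0 w"
    using std1_ends[OF assms(2) True] by blast
  then show ?thesis
    using std1_std0(1)[of u w] std1_std0(2)[of v w] assms same_coset_trans[of "std1 u" "std0 w" "std1 v"]
    by simp
next
  case False
  then obtain n :: int where "u = (fst v + n, snd v)"
    using par1_cong[OF assms(2,1)] assms(3) by metis
  then show ?thesis
    using std1_shift[of "snd v" "fst v" n] assms by (auto simp: mem_Times_iff)
qed

definition standard :: "(real \<Rightarrow> B) set \<Rightarrow> B \<Rightarrow> bool" where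
  "standard c b \<longleftrightarrow> (\<exists>u\<in>strip0. b = par0 u \<and> same_coset c (std0 u)) \<or>
    (\<exists>u\<in>strip1. b = par1 u \<and> same_coset c (std1 u))"

text \<open>
  Being standard does not depend on the chosen preimage, nor on the strip it is taken from; this
  is what allows a path to be followed from one annulus into the other.
\<close>

lemma standard_par0:
  assumes "standard c (par0 u)" "u \<in> strip0"
  shows "same_coset c (std0 u)"
proof -
  consider v where "v \<in> strip0" "par0 u = par0 v" "same_coset c (std0 v)"
    | v where "v \<in> strip1" "par0 u = par1 v" "same_coset c (std1 v)"
    using assms(1) unfolding standard_def by blast
  then show ?thesis
  proof cases
    case (1 v)
    then show ?thesis
      using same_coset_trans[OF 1(3) std0_std0[OF 1(1) assms(2)]] by simp
  next
    case (2 v)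
    then show ?thesis
      using same_coset_trans[OF 2(3) std1_std0(1)[OF 2(1) assms(2)]] by simp
  qed
qed

lemma standard_par1:
  assumes "standard c (par1 u)" "u \<in> strip1"
  shows "same_coset c (std1 u)"
proof -
  consider v where "v \<in> strip0" "par1 u = par0 v" "same_coset c (std0 v)"
    | v where "v \<in> strip1" "par1 u = par1 v" "same_coset c (std1 v)"
    using assms(1) unfolding standard_def by blast
  then show ?thesis
  proof cases
    case (1 v)
    then show ?thesis
      using same_coset_trans[OF 1(3) std1_std0(2)[OF assms(2) 1(1)]] by simp
  next
    case (2 v)
    then show ?thesis
      using same_coset_trans[OF 2(3) std1_std1[OF 2(1) assms(2)]] by simp
  qed
qed

lemma standard_seg0:
  assumes "standard c (par0 u)" "u \<in> strip0" "v \<in> strip0"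
  shows "standard (c \<star> seg par0 u v) (par0 v)"
proof -
  obtain h where h: "h \<in> gens" "c = h \<star> std0 u"
    using standard_par0[OF assms(1,2)] by (auto simp: same_coset_def)
  obtain a x b y where "u = (a, x)" "v = (b, y)" by (cases u; cases v)
  then have "std0 u \<star> seg par0 u v = std0 v"
    using assms by (simp add: std0_def seg_join0)
  then have "same_coset (c \<star> seg par0 u v) (std0 v)"
    using h by (auto simp: same_coset_def class_join_assoc gens_paths_only)
  then show ?thesis
    using assms(3) unfolding standard_def by blast
qed

lemma standard_seg1:
  assumes "standard c (par1 u)" "u \<in> strip1" "v \<in> strip1"
  shows "standard (c \<star> seg par1 u v) (par1 v)"
proof -
  obtain h where h: "h \<in> gens" "c = h \<star> std1 u"
    using standard_par1[OF assms(1,2)] by (auto simp: same_coset_def)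
  obtain a x b y where "u = (a, x)" "v = (b, y)" by (cases u; cases v)
  then have "std1 u \<star> seg par1 u v = std1 v"
    using assms by (simp add: std1_def class_join_assoc seg_join1)
  then have "same_coset (c \<star> seg par1 u v) (std1 v)"
    using h by (auto simp: same_coset_def class_join_assoc gens_paths_only)
  then show ?thesis
    using assms(3) unfolding standard_def by blast
qed

section \<open>The two loops generate\<close>

text \<open>
  Stretching the middle third of \<open>[1,2]\<close> over the whole interval collapses the two outer thirds
  to the end points.
\<close>

definition stretch :: "real \<Rightarrow> real" where "stretch x = max 1 (min 2 (3 * x - 3))"

definition push :: "B \<times> real \<Rightarrow> B" where
  "push = (\<lambda>(b, s). glue ann0 (\<lambda>(z, x). ann1 (z, (1 - s) * x + s * stretch x)) b)"

lemma push_ann: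
  "y \<in> cyl0 \<Longrightarrow> push (ann0 y, s) = ann0 y"
  "y \<in> cyl1 \<Longrightarrow> push (ann1 y, s) = ann1 (fst y, (1 - s) * snd y + s * stretch (snd y))"
proof -
  let ?g = "\<lambda>(z, x). ann1 (z, (1 - s) * x + s * stretch x)"
  have "ann0 (z ^ 3, 0) = ?g (z, 1)" "ann0 (z ^ 2, 1) = ?g (z, 2)" if "z \<in> circle" for z
  proof -
    have "(1 - s) * 1 + s * stretch 1 = 1" "(1 - s) * 2 + s * stretch 2 = 2"
      by (simp_all add: stretch_def)
    then show "ann0 (z ^ 3, 0) = ?g (z, 1)" "ann0 (z ^ 2, 1) = ?g (z, 2)"
      using that by (simp_all only: prod.case ann1_top ann1_bottom)
  qed
  from glue_ann[of ann0 ?g, OF this]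
  show "y \<in> cyl0 \<Longrightarrow> push (ann0 y, s) = ann0 y"
    "y \<in> cyl1 \<Longrightarrow> push (ann1 y, s) = ann1 (fst y, (1 - s) * snd y + s * stretch (snd y))"
    by (simp_all add: push_def case_prod_beta)
qed

lemma continuous_push: "continuous_on (UNIV \<times> {0..1}) push"
proof (rule continuous_on_B_Times)
  have "continuous_on (cyl0 \<times> {0..1}) (\<lambda>w. ann0 (fst w))"
    by (rule continuous_on_compose2[OF continuous_on_ann(1)]) (auto intro!: continuous_intros)
  then show "continuous_on (cyl0 \<times> {0..1}) (\<lambda>(y, s). push (ann0 y, s))"
    by (rule continuous_on_eq) (auto simp: push_ann)
  have "(\<lambda>w. (fst (fst w), (1 - snd w) * snd (fst w) + snd w * stretch (snd (fst w)))) \<in> cyl1 \<times> {0..1} \<rightarrow> cyl1"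
  proof
    fix w :: "(complex \<times> real) \<times> real"
    assume w: "w \<in> cyl1 \<times> {0..1}"
    have "(1 - snd w) *\<^sub>R snd (fst w) + snd w *\<^sub>R stretch (snd (fst w)) \<in> {1..2}"
      by (rule convexD_alt) (use w in \<open>auto simp: stretch_def\<close>)
    then show "(fst (fst w), (1 - snd w) * snd (fst w) + snd w * stretch (snd (fst w))) \<in> cyl1"
      using w by auto
  qed
  then have "continuous_on (cyl1 \<times> {0..1}) (\<lambda>w. ann1 (fst (fst w), (1 - snd w) * snd (fst w) + snd w * stretch (snd (fst w))))"
    by (intro continuous_on_compose2[OF continuous_on_ann(2)])
      (auto intro!: continuous_intros simp: stretch_def)
  then show "continuous_on (cyl1 \<times> {0..1}) (\<lambda>(y, s). push (ann1 y, s))"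
    by (rule continuous_on_eq) (auto simp: push_ann)
qed simp

lemma push_0: "push (b, 0) = b"
  by (cases b rule: B_cases) (simp_all add: push_ann)

lemma push_base0: "push (base0, s) = base0"
  using push_ann(1)[of "(1, 1/2)"] by (simp add: base0_def ann0_def)

text \<open>
  The bound \<open>1/3\<close> is the width of the two collars that \<open>stretch\<close> collapses. There the pushed point
  depends continuously on \<open>b\<close> through the retraction onto \<open>A\<^sub>0\<close>.
\<close>

lemma push_near_ends:
  assumes "depth b < 1/3"
  shows "push (b, 1) = ann0 (dir0 b, level b)" "(dir0 b, level b) \<in> cyl0"
proof -
  show "(dir0 b, level b) \<in> cyl0"
    by (cases b rule: B_cases) (auto simp: norm_dir0 coord_ann0 coord_ann1 norm_power)
  show "push (b, 1) = ann0 (dir0 b, level b)"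
  proof (cases b rule: B_cases)
    case (1 y)
    then show ?thesis by (simp add: push_ann coord_ann0)
  next
    case (2 y)
    have c: "min (snd y - 1) (2 - snd y) < 1/3"
      using assms 2 by (simp add: coord_ann1)
    show ?thesis
    proof (cases "snd y \<le> 3/2")
      case True
      then have "stretch (snd y) = 1"
        using c by (auto simp: stretch_def min_def split: if_splits)
      then show ?thesis
        using 2 True by (auto simp: push_ann coord_ann1 ann1_bottom)
    next
      case False
      then have "stretch (snd y) = 2"
        using c by (auto simp: stretch_def min_def split: if_splits)
      then show ?thesis
        using 2 False by (auto simp: push_ann coord_ann1 ann1_top)
    qed
  qed
qed

lemma push_interior:
  assumes "0 < depth b"
  shows "push (b, 1) = ann1 (sgn (scaled_dir1 b), stretch (height b))"
proof -
  have "(sgn (scaled_dir1 b), height b) \<in> cyl1"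
    using ann1_coords[OF assms] by auto
  from push_ann(2)[OF this, of 1] show ?thesis
    by (simp add: ann1_coords(1)[OF assms])
qed

lemma homotopic_push:
  assumes "path p" "pathstart p = base0" "pathfinish p = base0"
  shows "homotopic_paths UNIV p (\<lambda>t. push (p t, 1))"
  unfolding homotopic_paths
proof (intro exI[of _ "\<lambda>(s, t). push (p t, s)"] conjI)
  have "continuous_on ({0..1} \<times> {0..1}) (\<lambda>w. push (p (snd w), fst w))"
    by (rule continuous_on_compose2[OF continuous_push])
      (use assms(1) in \<open>auto intro!: continuous_intros continuous_on_compose2[of "{0..1}" p] simp: path_def\<close>)
  then show "continuous_on ({0..1} \<times> {0..1}) (\<lambda>(s, t). push (p t, s))"
    by (simp add: case_prod_beta)
qed (use assms push_0 push_base0 in \<open>auto simp: pathstart_def pathfinish_def\<close>)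

lemma circle_lift:
  fixes f :: "'a::real_normed_vector \<Rightarrow> complex"
  assumes "continuous_on S f" "convex S" "\<And>x. x \<in> S \<Longrightarrow> cmod (f x) = 1"
  obtains \<theta> :: "'a \<Rightarrow> real" where "continuous_on S \<theta>" "\<And>x. x \<in> S \<Longrightarrow> f x = cis (2 * pi * \<theta> x)"
proof -
  have "f x \<noteq> 0" if "x \<in> S" for x
    using assms(3)[OF that] by auto
  from continuous_logarithm_on_contractible[OF assms(1) convex_imp_contractible[OF assms(2)] this]
  obtain g where g: "continuous_on S g" "\<And>x. x \<in> S \<Longrightarrow> f x = exp (g x)"
    by metis
  have "f x = cis (2 * pi * (Im (g x) / (2 * pi)))" if "x \<in> S" for x
    using exp_eq_polar[of "g x"] g(2)[OF that] assms(3)[OF that] by (simp add: norm_mult)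
  moreover have "continuous_on S (\<lambda>x. Im (g x) / (2 * pi))"
    using g(1) by (intro continuous_intros) auto
  ultimately show ?thesis
    using that by blast
qed

text \<open>
  A path with a lift to a convex set is homotopic to the image of the straight segment between
  the ends of the lift.
\<close>

lemma seg_lift:
  fixes l :: "real \<Rightarrow> 'a::real_normed_vector"
  assumes "convex C" "continuous_on C f" "a \<le> b" "continuous_on {a..b} l" "l ` {a..b} \<subseteq> C"
    "\<And>t. t \<in> {a..b} \<Longrightarrow> q t = f (l t)"
  shows "seg q a b = seg f (l a) (l b)"
proof -
  have t: "linepath a b x \<in> {a..b}" if "x \<in> {0..1}" for x
    using that assms(3) linepath_in_path[of x a b] by (simp add: closed_segment_eq_real_ivl)
  have l: "path (l \<circ> linepath a b)"
    using assms(3,4) by (intro path_continuous_image) (simp_all add: closed_segment_eq_real_ivl)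
  have i: "path_image (l \<circ> linepath a b) \<subseteq> C"
    using t assms(5) by (auto simp: path_image_def)
  have "path (f \<circ> (l \<circ> linepath a b))"
    by (rule path_continuous_image[OF l continuous_on_subset[OF assms(2) i]])
  then have "homotopic_paths UNIV (f \<circ> (l \<circ> linepath a b)) (q \<circ> linepath a b)"
    by (rule homotopic_paths_eq) (use t assms(6) in auto)
  from pcl_eqI[OF this] have "seg q a b = pcl (f \<circ> (l \<circ> linepath a b))" by (simp add: seg_def)
  also have "\<dots> = seg f (l a) (l b)"
    unfolding seg_def using assms l i
    by (intro pcl_convex[of C]) (auto simp: closed_segment_subset image_subset_iff pathstart_compose pathfinish_compose)
  finally show ?thesis .
qed

text \<open>
  A single step along the loop: in either case the pushed piece lies in one annulus, its angular
  coordinate lifts to the reals, and the piece is a segment of the corresponding strip.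
\<close>

lemma push_standard_local:
  assumes p: "path p" and ab: "0 \<le> a" "a \<le> b" "b \<le> 1"
    and near: "(\<forall>t\<in>{a..b}. depth (p t) < 1/3) \<or> (\<forall>t\<in>{a..b}. 0 < depth (p t))"
    and c: "standard c (push (p a, 1))"
  shows "standard (c \<star> seg (\<lambda>t. push (p t, 1)) a b) (push (p b, 1))"
  using near
proof
  have cp: "continuous_on {a..b} p"
    using p ab unfolding path_def by (auto intro: continuous_on_subset)
  {
    assume n: "\<forall>t\<in>{a..b}. depth (p t) < 1/3"
    have sub: "p ` {a..b} \<subseteq> {b. depth b < 1/2}"
      using n by fastforce
    have "continuous_on {a..b} (\<lambda>t. dir0 (p t))"
      by (rule continuous_on_compose2[OF continuous_dir0 cp sub])
    then obtain \<theta> where \<theta>: "continuous_on {a..b} \<theta>" "\<And>t. t \<in> {a..b} \<Longrightarrow> dir0 (p t) = cis (2 * pi * \<theta> t)"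
      using circle_lift[of "{a..b}" "\<lambda>t. dir0 (p t)"] by (auto simp: norm_dir0)
    define l where "l t = (\<theta> t, level (p t))" for t
    have l: "continuous_on {a..b} l"
      unfolding l_def using \<theta>(1) continuous_on_compose2[OF continuous_level cp sub]
      by (intro continuous_on_Pair)
    have e: "push (p t, 1) = par0 (l t)" "l t \<in> strip0" if "t \<in> {a..b}" for t
      using push_near_ends[of "p t"] n \<theta>(2)[OF that] that by (auto simp: par0_def l_def)
    have "seg (\<lambda>t. push (p t, 1)) a b = seg par0 (l a) (l b)"
      by (rule seg_lift[OF convex_strip(1) continuous_par(1) ab(2) l]) (use e in blast)+
    then show ?thesis
      using standard_seg0[of c "l a" "l b"] c e ab(2) by simp
  next
    assume n: "\<forall>t\<in>{a..b}. 0 < depth (p t)"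
    then have sub: "p ` {a..b} \<subseteq> {b. 0 < depth b}"
      by auto
    have "continuous_on {a..b} (\<lambda>t. sgn (scaled_dir1 (p t)))"
      by (rule continuous_on_compose2[OF continuous_sgn_dir1 cp sub])
    then obtain \<theta> where \<theta>: "continuous_on {a..b} \<theta>" "\<And>t. t \<in> {a..b} \<Longrightarrow> sgn (scaled_dir1 (p t)) = cis (2 * pi * \<theta> t)"
      using circle_lift[of "{a..b}" "\<lambda>t. sgn (scaled_dir1 (p t))"] ann1_coords(2) n by auto
    define l where "l t = (\<theta> t, stretch (height (p t)))" for t
    have l: "continuous_on {a..b} l"
      unfolding l_def stretch_def using \<theta>(1) continuous_on_compose2[OF continuous_height cp]
      by (intro continuous_intros) auto
    have e: "push (p t, 1) = par1 (l t)" "l t \<in> strip1" if "t \<in> {a..b}" for t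
      using push_interior[of "p t"] n \<theta>(2)[OF that] that by (auto simp: par1_def l_def stretch_def)
    have "seg (\<lambda>t. push (p t, 1)) a b = seg par1 (l a) (l b)"
      by (rule seg_lift[OF convex_strip(2) continuous_par(2) ab(2) l]) (use e in blast)+
    then show ?thesis
      using standard_seg1[of c "l a" "l b"] c e ab(2) by simp
  }
qed

lemma path_near_cases:
  assumes "path p" "t \<in> {0..1}"
  obtains d where "d > 0"
    "(\<forall>s\<in>{0..1}. \<bar>s - t\<bar> < d \<longrightarrow> depth (p s) < 1/3) \<or> (\<forall>s\<in>{0..1}. \<bar>s - t\<bar> < d \<longrightarrow> 0 < depth (p s))"
proof -
  have c: "continuous_on {0..1} (\<lambda>s. depth (p s))"
    using assms(1) continuous_on_compose2[OF continuous_depth] by (auto simp: path_def)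
  then obtain d where d: "d > 0" "\<And>s. s \<in> {0..1} \<Longrightarrow> dist s t < d \<Longrightarrow> dist (depth (p s)) (depth (p t)) < 1/6"
    using assms(2) unfolding continuous_on_iff by (meson zero_less_divide_1_iff zero_less_numeral)
  have near: "\<bar>depth (p s) - depth (p t)\<bar> < 1/6" if "s \<in> {0..1}" "\<bar>s - t\<bar> < d" for s
    using d(2)[of s] that by (simp add: dist_real_def)
  show ?thesis
  proof (cases "depth (p t) \<le> 1/6")
    case True
    have "depth (p s) < 1/3" if "s \<in> {0..1}" "\<bar>s - t\<bar> < d" for s
      using near[OF that] True by linarith
    then show ?thesis using that[OF d(1)] by blast
  next
    case False
    have "0 < depth (p s)" if "s \<in> {0..1}" "\<bar>s - t\<bar> < d" for s
      using near[OF that] False by linarith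
    then show ?thesis using that[OF d(1)] by blast
  qed
qed

text \<open>
  The pushed loop is cut into short pieces by bisection, and the standard form is carried from the
  constant path through all of them. At the end of the loop, back at the base point, a standard path
  may be taken constant, so that only an element of the subgroup remains.
\<close>

lemma loop_in_gens:
  assumes p: "path p" "pathstart p = base0" "pathfinish p = base0"
  shows "pcl p \<in> gens"
proof -
  define q where "q t = push (p t, 1)" for t
  have hp: "homotopic_paths UNIV p q"
    unfolding q_def using p by (rule homotopic_push)
  then have q: "path q" "q 0 = base0" "q 1 = base0"
    using p homotopic_paths_imp_path[OF hp] homotopic_paths_imp_pathstart[OF hp] homotopic_paths_imp_pathfinish[OF hp]
    by (auto simp: pathstart_def pathfinish_def)
  define P where "P a b \<longleftrightarrow> (0 \<le> a \<longrightarrow> b \<le> 1 \<longrightarrow> (\<forall>c. standard c (q a) \<longrightarrow> paths_only c \<longrightarrow> standard (c \<star> seg q a b) (q b)))"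
    for a b
  have "P 0 1"
  proof (rule Bolzano)
    fix a b d assume "P a b" "P b d" and le: "a \<le> b" "b \<le> d"
    show "P a d"
      unfolding P_def
    proof (intro impI allI)
      fix c assume H: "0 \<le> a" "d \<le> 1" and c: "standard c (q a)" "paths_only c"
      have "standard (c \<star> seg q a b) (q b)"
        using \<open>P a b\<close> H le c unfolding P_def by simp
      then have "standard ((c \<star> seg q a b) \<star> seg q b d) (q d)"
        using \<open>P b d\<close> H le unfolding P_def by simp
      moreover have "(c \<star> seg q a b) \<star> seg q b d = c \<star> seg q a d"
        using c H le seg_join[of "{0..1}" q a b d] q(1) by (simp add: class_join_assoc path_def)
      ultimately show "standard (c \<star> seg q a d) (q d)" by simp
    qed
  next
    fix t :: real assume t: "0 \<le> t" "t \<le> 1"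
    then obtain d where d: "d > 0"
      "(\<forall>s\<in>{0..1}. \<bar>s - t\<bar> < d \<longrightarrow> depth (p s) < 1/3) \<or> (\<forall>s\<in>{0..1}. \<bar>s - t\<bar> < d \<longrightarrow> 0 < depth (p s))"
      using path_near_cases[OF p(1), of t] by auto
    have "P a b" if ab: "a \<le> t" "t \<le> b" "b - a < d" for a b
      unfolding P_def q_def
    proof (intro impI allI)
      fix c assume H: "0 \<le> a" "b \<le> 1" "standard c (push (p a, 1))"
      have "s \<in> {0..1}" "\<bar>s - t\<bar> < d" if "s \<in> {a..b}" for s
        using that H ab by (auto simp: abs_less_iff)
      then have "(\<forall>t\<in>{a..b}. depth (p t) < 1/3) \<or> (\<forall>t\<in>{a..b}. 0 < depth (p t))"
        using d(2) by blast
      then show "standard (c \<star> seg (\<lambda>t. push (p t, 1)) a b) (push (p b, 1))"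
        using H ab by (intro push_standard_local[OF p(1)]) auto
    qed
    then show "\<exists>d>0. \<forall>a b. a \<le> t \<and> t \<le> b \<and> b - a < d \<longrightarrow> P a b"
      using d(1) by blast
  qed simp
  moreover have seg01: "seg q 0 1 = pcl q"
    by (simp add: seg_def linepath_def comp_def)
  moreover have "standard (seg par0 (0, 1/2) (0, 1/2)) (q 0)"
    unfolding standard_def q(2) using same_coset_refl[of "(0, 1/2)"]
    by (intro disjI1 bexI[of _ "(0, 1/2)"]) (auto simp: par_ends std0_def)
  ultimately have "standard (seg par0 (0, 1/2) (0, 1/2) \<star> pcl q) base0"
    using q by (simp add: seg01 P_def)
  then have "same_coset (seg par0 (0, 1/2) (0, 1/2) \<star> pcl q) (std0 (0, 1/2))"
    using standard_par0[of _ "(0, 1/2)"] by (simp add: par_ends)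
  then obtain h where h: "h \<in> gens" "seg par0 (0, 1/2) (0, 1/2) \<star> pcl q = h \<star> seg par0 (0, 1/2) (0, 1/2)"
    by (auto simp: same_coset_def std0_def)
  interpret group "pi1_B base0" by (rule group_pi1)
  have "pcl q \<in> carrier (pi1_B base0)"
    using q by (intro pcl_carrier) (auto simp: pathstart_def pathfinish_def)
  with h gens_carrier[OF h(1)] have "pcl q = h"
    by (simp flip: one_pi1 mult_fundamental_group[where x = base0])
  with h(1) pcl_eqI[OF hp] show ?thesis by simp
qed

lemma gens_eq: "gens = carrier (pi1_B base0)"
proof
  show "carrier (pi1_B base0) \<subseteq> gens"
  proof
    fix c assume "c \<in> carrier (pi1_B base0)"
    then obtain p where "c = pcl p" "p \<in> loops_at UNIV base0"
      by (auto simp: fundamental_group_def)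
    then show "c \<in> gens"
      using loop_in_gens[of p] by (simp add: loops_at_def)
  qed
qed (use gens_carrier in blast)

section \<open>Flat sections and holonomy\<close>

locale BS_relation = group G for G (structure) +
  fixes \<alpha> \<beta>
  assumes \<alpha> [simp]: "\<alpha> \<in> carrier G" and \<beta> [simp]: "\<beta> \<in> carrier G"
    and relation: "\<beta> \<otimes> \<alpha> [^] (2::int) = \<alpha> [^] (3::int) \<otimes> \<beta>"
begin

lemma cancel_inv:
  assumes "c \<in> carrier G" "x \<in> carrier G"
  shows "inv c \<otimes> (c \<otimes> x) = x" "c \<otimes> (inv c \<otimes> x) = x"
  using assms by (simp_all flip: m_assoc)

text \<open>
  Over the open annulus \<open>A\<^sub>1\<close>, the value of a flat section at lifted angle \<open>\<theta>\<close>. In the lower half it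
  is the value that \<open>A\<^sub>0\<close> prescribes, where the angle is multiplied by \<open>3\<close>; in the upper half the
  angle is multiplied by \<open>2\<close> and the factor \<open>\<beta>\<close> records the crossing. The jump at the middle
  circle is a choice of trivialization. By the relation between \<open>\<alpha>\<close> and \<open>\<beta>\<close>,
  replacing \<open>\<theta>\<close> by \<open>\<theta> + 1\<close> multiplies both halves by the same factor \<open>\<alpha>\<^sup>3\<close> on the left
  (\<open>weight_shift\<close>), so that the choice of the lifted angle does not matter.
\<close>

definition weight :: "B \<Rightarrow> real \<Rightarrow> 'a" where
  "weight b \<theta> = (if height b \<le> 3/2 then \<alpha> [^] \<lfloor>3 * \<theta>\<rfloor> else \<beta> \<otimes> \<alpha> [^] \<lfloor>2 * \<theta>\<rfloor>)"

lemma weight_closed [simp]: "weight b \<theta> \<in> carrier G"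
  by (simp add: weight_def)

lemma relation_pow: "\<beta> \<otimes> \<alpha> [^] (2 * n :: int) = \<alpha> [^] (3 * n) \<otimes> \<beta>"
proof -
  have nat: "\<beta> \<otimes> \<alpha> [^] (2 * int k) = \<alpha> [^] (3 * int k) \<otimes> \<beta>" for k
  proof (induction k)
    case 0
    show ?case by simp
  next
    case (Suc k)
    have "\<beta> \<otimes> \<alpha> [^] (2 * int (Suc k)) = \<beta> \<otimes> (\<alpha> [^] (2 * int k) \<otimes> \<alpha> [^] (2::int))"
      by (simp add: int_pow_mult[symmetric] algebra_simps)
    also have "\<dots> = \<alpha> [^] (3 * int k) \<otimes> (\<beta> \<otimes> \<alpha> [^] (2::int))"
      using Suc by (simp flip: m_assoc)
    also have "\<dots> = \<alpha> [^] (3 * int (Suc k)) \<otimes> \<beta>"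
      by (simp add: relation flip: m_assoc) (simp add: int_pow_mult[symmetric] algebra_simps)
    finally show ?case .
  qed
  show ?thesis
  proof (cases "n \<ge> 0")
    case True
    then show ?thesis using nat[of "nat n"] by simp
  next
    case False
    define k where "k = nat (- n)"
    have n: "n = - int k" using False by (simp add: k_def)
    have "\<alpha> [^] (3 * int k) \<otimes> (\<beta> \<otimes> \<alpha> [^] (2 * n)) = \<beta> \<otimes> (\<alpha> [^] (2 * int k) \<otimes> \<alpha> [^] (2 * n))"
      using nat[of k] by (simp flip: m_assoc)
    also have "\<dots> = \<beta>" by (simp add: n flip: int_pow_mult)
    also have "\<dots> = \<alpha> [^] (3 * int k) \<otimes> (\<alpha> [^] (3 * n) \<otimes> \<beta>)"
      by (simp add: n flip: m_assoc int_pow_mult)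
    finally show ?thesis
      using Units_l_cancel[of "\<alpha> [^] (3 * int k)" "\<beta> \<otimes> \<alpha> [^] (2 * n)" "\<alpha> [^] (3 * n) \<otimes> \<beta>"]
      by simp
  qed
qed

lemma weight_shift: "weight b (\<theta> + of_int n) = \<alpha> [^] (3 * n) \<otimes> weight b \<theta>"
proof -
  have f: "\<lfloor>3 * (\<theta> + of_int n)\<rfloor> = 3 * n + \<lfloor>3 * \<theta>\<rfloor>" "\<lfloor>2 * (\<theta> + of_int n)\<rfloor> = 2 * n + \<lfloor>2 * \<theta>\<rfloor>"
    by (simp_all add: distrib_left floor_eq_iff)
  show ?thesis
    unfolding weight_def f using relation_pow[of n]
    by (auto simp: int_pow_mult m_assoc[symmetric])
qed

text \<open>
  The local form of a lift of \<open>h\<close> to the covering with fibre \<open>G\<close>, over the two open sets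
  \<open>depth < 1/2\<close> and \<open>depth > 0\<close>. The fibre is identified with \<open>G\<close> by cutting the annuli at angle
  zero, which is why floors occur: a lift passing the cut changes its \<open>G\<close>-coordinate by a
  power of \<open>\<alpha>\<close>.
\<close>

definition chart0 :: "('d::euclidean_space \<Rightarrow> B) \<Rightarrow> 'd set \<Rightarrow> ('d \<Rightarrow> 'a) \<Rightarrow> bool" where
  "chart0 h E u \<longleftrightarrow> (\<exists>c\<in>carrier G. \<exists>\<theta>. continuous_on E \<theta> \<and> (\<forall>x\<in>E. depth (h x) < 1/2 \<and>
     dir0 (h x) = cis (2 * pi * \<theta> x) \<and> u x = c \<otimes> \<alpha> [^] \<lfloor>\<theta> x\<rfloor>))"

definition chart1 :: "('d::euclidean_space \<Rightarrow> B) \<Rightarrow> 'd set \<Rightarrow> ('d \<Rightarrow> 'a) \<Rightarrow> bool" where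
  "chart1 h E u \<longleftrightarrow> (\<exists>c\<in>carrier G. \<exists>\<theta>. continuous_on E \<theta> \<and> (\<forall>x\<in>E. 0 < depth (h x) \<and>
     sgn (scaled_dir1 (h x)) = cis (2 * pi * \<theta> x) \<and> u x = c \<otimes> weight (h x) (\<theta> x)))"

definition chart :: "('d::euclidean_space \<Rightarrow> B) \<Rightarrow> 'd set \<Rightarrow> ('d \<Rightarrow> 'a) \<Rightarrow> bool" where
  "chart h E u \<longleftrightarrow> chart0 h E u \<or> chart1 h E u"

definition flat :: "('d::euclidean_space \<Rightarrow> B) \<Rightarrow> 'd set \<Rightarrow> ('d \<Rightarrow> 'a) \<Rightarrow> bool" where
  "flat h D u \<longleftrightarrow> (\<forall>x\<in>D. \<exists>e>0. chart h (D \<inter> ball x e) u)"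

lemma chart_closed: "chart h E u \<Longrightarrow> x \<in> E \<Longrightarrow> u x \<in> carrier G"
  by (auto simp: chart_def chart0_def chart1_def)

lemma chart_subset:
  assumes "chart h E u" "E' \<subseteq> E"
  shows "chart h E' u"
proof -
  have "chart0 h E' u" if "chart0 h E u"
    using that assms(2) continuous_on_subset[OF _ assms(2)] unfolding chart0_def by blast
  moreover have "chart1 h E' u" if "chart1 h E u"
    using that assms(2) continuous_on_subset[OF _ assms(2)] unfolding chart1_def by blast
  ultimately show ?thesis
    using assms(1) unfolding chart_def by blast
qed

lemma chart_cong:
  assumes "chart h E u" "\<And>x. x \<in> E \<Longrightarrow> h x = h' x" "\<And>x. x \<in> E \<Longrightarrow> u x = u' x"
  shows "chart h' E u'"
  using assms unfolding chart_def chart0_def chart1_def by (auto cong: ball_cong)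

lemma chart_mult:
  assumes "chart h E u" "g \<in> carrier G"
  shows "chart h E (\<lambda>x. g \<otimes> u x)"
  using assms(1) unfolding chart_def
proof
  assume "chart0 h E u"
  then obtain c \<theta> where "c \<in> carrier G" "continuous_on E \<theta>" "\<And>x. x \<in> E \<Longrightarrow> depth (h x) < 1/2 \<and>
     dir0 (h x) = cis (2 * pi * \<theta> x) \<and> u x = c \<otimes> \<alpha> [^] \<lfloor>\<theta> x\<rfloor>"
    unfolding chart0_def by blast
  then have "chart0 h E (\<lambda>x. g \<otimes> u x)"
    unfolding chart0_def using assms(2) by (intro bexI[of _ "g \<otimes> c"] exI[of _ \<theta>]) (auto simp: m_assoc)
  then show "chart0 h E (\<lambda>x. g \<otimes> u x) \<or> chart1 h E (\<lambda>x. g \<otimes> u x)" ..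
next
  assume "chart1 h E u"
  then obtain c \<theta> where "c \<in> carrier G" "continuous_on E \<theta>" "\<And>x. x \<in> E \<Longrightarrow> 0 < depth (h x) \<and>
     sgn (scaled_dir1 (h x)) = cis (2 * pi * \<theta> x) \<and> u x = c \<otimes> weight (h x) (\<theta> x)"
    unfolding chart1_def by blast
  then have "chart1 h E (\<lambda>x. g \<otimes> u x)"
    unfolding chart1_def using assms(2) by (intro bexI[of _ "g \<otimes> c"] exI[of _ \<theta>]) (auto simp: m_assoc)
  then show "chart0 h E (\<lambda>x. g \<otimes> u x) \<or> chart1 h E (\<lambda>x. g \<otimes> u x)" ..
qed

text \<open>
  Two lifts of the same angle differ by a continuous integer-valued function.
\<close>

lemma angle_difference:
  fixes E :: "'d::euclidean_space set"
  assumes "connected E" "continuous_on E \<theta>" "continuous_on E \<theta>'"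
    "\<And>x. x \<in> E \<Longrightarrow> cis (2 * pi * \<theta> x) = cis (2 * pi * \<theta>' x)"
  obtains n :: int where "\<And>x. x \<in> E \<Longrightarrow> \<theta>' x = \<theta> x + of_int n"
proof (cases "E = {}")
  case False
  then obtain a where a: "a \<in> E" by blast
  have int: "\<exists>n::int. \<theta>' x - \<theta> x = of_int n" if "x \<in> E" for x
    using assms(4)[OF that] unfolding cis_eq_iff by (auto simp: algebra_simps)
  have "(\<lambda>x. \<theta>' x - \<theta> x) constant_on E"
  proof (rule continuous_discrete_range_constant[OF assms(1)])
    show "continuous_on E (\<lambda>x. \<theta>' x - \<theta> x)"
      using assms(2,3) by (intro continuous_intros)
    fix x assume x: "x \<in> E"
    show "\<exists>e>0. \<forall>y. y \<in> E \<and> \<theta>' y - \<theta> y \<noteq> \<theta>' x - \<theta> x \<longrightarrow> e \<le> norm (\<theta>' y - \<theta> y - (\<theta>' x - \<theta> x))"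
    proof (intro exI[of _ 1] conjI allI impI)
      fix y assume y: "y \<in> E \<and> \<theta>' y - \<theta> y \<noteq> \<theta>' x - \<theta> x"
      obtain m n :: int where "\<theta>' x - \<theta> x = m" "\<theta>' y - \<theta> y = n"
        using int x y by metis
      then show "1 \<le> norm (\<theta>' y - \<theta> y - (\<theta>' x - \<theta> x))"
        using y of_int_1_le_iff[of "\<bar>n - m\<bar>", where 'a = real] by (cases "n \<le> m") auto
    qed simp
  qed
  then obtain c where "\<And>x. x \<in> E \<Longrightarrow> \<theta>' x - \<theta> x = c"
    unfolding constant_on_def by blast
  moreover obtain n :: int where "\<theta>' a - \<theta> a = n"
    using int[OF a] by blast
  ultimately have "\<theta>' x = \<theta> x + of_int n" if "x \<in> E" for x
    using a that by force
  then show ?thesis by (rule that)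
qed (use that in auto)

lemma chart0_unique:
  assumes "connected E" "chart0 h E u" "chart0 h E v"
  shows "\<exists>g\<in>carrier G. \<forall>x\<in>E. v x = g \<otimes> u x"
proof -
  obtain c \<theta> where u: "c \<in> carrier G" "continuous_on E \<theta>" "\<And>x. x \<in> E \<Longrightarrow> depth (h x) < 1/2 \<and>
     dir0 (h x) = cis (2 * pi * \<theta> x) \<and> u x = c \<otimes> \<alpha> [^] \<lfloor>\<theta> x\<rfloor>"
    using assms(2) unfolding chart0_def by blast
  obtain d \<theta>' where v: "d \<in> carrier G" "continuous_on E \<theta>'" "\<And>x. x \<in> E \<Longrightarrow> depth (h x) < 1/2 \<and>
     dir0 (h x) = cis (2 * pi * \<theta>' x) \<and> v x = d \<otimes> \<alpha> [^] \<lfloor>\<theta>' x\<rfloor>"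
    using assms(3) unfolding chart0_def by blast
  obtain n :: int where n: "\<And>x. x \<in> E \<Longrightarrow> \<theta>' x = \<theta> x + of_int n"
    using angle_difference[OF assms(1) u(2) v(2)] u(3) v(3) by metis
  have "v x = (d \<otimes> \<alpha> [^] n \<otimes> inv c) \<otimes> u x" if "x \<in> E" for x
    using u(1) u(3)[OF that] v(1) v(3)[OF that] n[OF that]
    by (simp add: m_assoc cancel_inv int_pow_mult[symmetric] add.commute)
  then show ?thesis
    using u(1) v(1) by (intro bexI[of _ "d \<otimes> \<alpha> [^] n \<otimes> inv c"]) auto
qed

lemma chart1_unique:
  assumes "connected E" "chart1 h E u" "chart1 h E v"
  shows "\<exists>g\<in>carrier G. \<forall>x\<in>E. v x = g \<otimes> u x"
proof -
  obtain c \<theta> where u: "c \<in> carrier G" "continuous_on E \<theta>" "\<And>x. x \<in> E \<Longrightarrow> 0 < depth (h x) \<and>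
     sgn (scaled_dir1 (h x)) = cis (2 * pi * \<theta> x) \<and> u x = c \<otimes> weight (h x) (\<theta> x)"
    using assms(2) unfolding chart1_def by blast
  obtain d \<theta>' where v: "d \<in> carrier G" "continuous_on E \<theta>'" "\<And>x. x \<in> E \<Longrightarrow> 0 < depth (h x) \<and>
     sgn (scaled_dir1 (h x)) = cis (2 * pi * \<theta>' x) \<and> v x = d \<otimes> weight (h x) (\<theta>' x)"
    using assms(3) unfolding chart1_def by blast
  obtain n :: int where n: "\<And>x. x \<in> E \<Longrightarrow> \<theta>' x = \<theta> x + of_int n"
    using angle_difference[OF assms(1) u(2) v(2)] u(3) v(3) by metis
  have "v x = (d \<otimes> \<alpha> [^] (3 * n) \<otimes> inv c) \<otimes> u x" if "x \<in> E" for x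
    using u(1) u(3)[OF that] v(1) v(3)[OF that] n[OF that]
    by (simp add: weight_shift m_assoc cancel_inv)
  then show ?thesis
    using u(1) v(1) by (intro bexI[of _ "d \<otimes> \<alpha> [^] (3 * n) \<otimes> inv c"]) auto
qed

text \<open>
  On the overlap the middle circle is avoided, so a connected set lies entirely in the lower or
  entirely in the upper half of \<open>A\<^sub>1\<close>. There the angle on \<open>A\<^sub>0\<close> is three or two times the angle on
  \<open>A\<^sub>1\<close>, and \<open>weight\<close> is by design the corresponding power of \<open>\<alpha>\<close>, up to the constant \<open>\<beta>\<close>.
\<close>

lemma chart1_imp_chart0:
  assumes E: "connected E" "continuous_on E h" and h: "\<And>x. x \<in> E \<Longrightarrow> depth (h x) < 1/2" and "chart1 h E u"
  shows "chart0 h E u"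
proof -
  obtain c \<theta> where u: "c \<in> carrier G" "continuous_on E \<theta>" "\<And>x. x \<in> E \<Longrightarrow> 0 < depth (h x) \<and>
     sgn (scaled_dir1 (h x)) = cis (2 * pi * \<theta> x) \<and> u x = c \<otimes> weight (h x) (\<theta> x)"
    using assms(4) unfolding chart1_def by blast
  have "height (h x) \<noteq> 3/2" if "x \<in> E" for x
  proof
    assume "height (h x) = 3/2"
    then have "h x = ann1 (sgn (scaled_dir1 (h x)), 3/2)"
      using ann1_coords(1)[of "h x"] u(3)[OF that] by metis
    moreover have "(sgn (scaled_dir1 (h x)), 3/2) \<in> cyl1"
      using ann1_coords(2)[of "h x"] u(3)[OF that] by auto
    ultimately have "depth (h x) = 1/2"
      using coord_ann1(1)[of "(sgn (scaled_dir1 (h x)), 3/2)"] by simp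
    with h[OF that] show False by simp
  qed
  moreover have "connected ((\<lambda>x. height (h x)) ` E)"
    using E continuous_on_compose2[OF continuous_height] by (intro connected_continuous_image) auto
  ultimately have "(\<forall>x\<in>E. height (h x) \<le> 3/2) \<or> (\<forall>x\<in>E. \<not> height (h x) \<le> 3/2)"
    using connected_contains_Icc[of "(\<lambda>x. height (h x)) ` E"]
    by (smt (verit) atLeastAtMost_iff image_iff subset_iff)
  then show ?thesis
  proof
    assume low: "\<forall>x\<in>E. height (h x) \<le> 3/2"
    then have "depth (h x) < 1/2 \<and> dir0 (h x) = cis (2 * pi * (3 * \<theta> x)) \<and> u x = c \<otimes> \<alpha> [^] \<lfloor>3 * \<theta> x\<rfloor>"
      if "x \<in> E" for x
      using that h u(3)[OF that] ann1_coords(5)[of "h x"] cis_power[of "\<theta> x" 3] by (simp add: weight_def)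
    moreover have "continuous_on E (\<lambda>x. 3 * \<theta> x)"
      using u(2) by (intro continuous_intros)
    ultimately show ?thesis
      unfolding chart0_def using u(1) by blast
  next
    assume high: "\<forall>x\<in>E. \<not> height (h x) \<le> 3/2"
    then have "depth (h x) < 1/2 \<and> dir0 (h x) = cis (2 * pi * (2 * \<theta> x)) \<and> u x = (c \<otimes> \<beta>) \<otimes> \<alpha> [^] \<lfloor>2 * \<theta> x\<rfloor>"
      if "x \<in> E" for x
      using that h u(1) u(3)[OF that] ann1_coords(5)[of "h x"] cis_power[of "\<theta> x" 2] by (simp add: weight_def m_assoc)
    moreover have "continuous_on E (\<lambda>x. 2 * \<theta> x)"
      using u(2) by (intro continuous_intros)
    moreover have "c \<otimes> \<beta> \<in> carrier G" using u(1) by simp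
    ultimately show ?thesis
      unfolding chart0_def by blast
  qed
qed

lemma chart_unique:
  assumes "connected E" "continuous_on E h" "chart h E u" "chart h E v"
  shows "\<exists>g\<in>carrier G. \<forall>x\<in>E. v x = g \<otimes> u x"
proof (cases "chart1 h E u \<and> chart1 h E v")
  case True
  then show ?thesis using chart1_unique assms(1) by blast
next
  case False
  then have "\<And>x. x \<in> E \<Longrightarrow> depth (h x) < 1/2"
    using assms(3,4) unfolding chart_def chart0_def by blast
  then have "chart0 h E u" "chart0 h E v"
    using assms chart1_imp_chart0 unfolding chart_def by blast+
  then show ?thesis using chart0_unique assms(1) by blast
qed

lemma flat_closed: "flat h D u \<Longrightarrow> x \<in> D \<Longrightarrow> u x \<in> carrier G"
  unfolding flat_def using chart_closed by (metis Int_iff centre_in_ball)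

lemma flat_mult: "flat h D u \<Longrightarrow> g \<in> carrier G \<Longrightarrow> flat h D (\<lambda>x. g \<otimes> u x)"
  unfolding flat_def using chart_mult by blast

lemma chart_imp_flat: "chart h D u \<Longrightarrow> flat h D u"
  unfolding flat_def using chart_subset[of h D u] by (meson inf_le1 zero_less_one)

lemma flat_cong:
  assumes "flat h D u" "\<And>x. x \<in> D \<Longrightarrow> h x = h' x"
  shows "flat h' D u"
  unfolding flat_def
proof
  fix x assume "x \<in> D"
  then obtain e where "e > 0" "chart h (D \<inter> ball x e) u"
    using assms(1) unfolding flat_def by blast
  then show "\<exists>e>0. chart h' (D \<inter> ball x e) u"
    using chart_cong[of h "D \<inter> ball x e" u h' u] assms(2) by blast
qed

lemma flat_subset:
  assumes "flat h D u" "D' \<subseteq> D"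
  shows "flat h D' u"
  unfolding flat_def
proof
  fix x assume "x \<in> D'"
  then obtain e where "e > 0" "chart h (D \<inter> ball x e) u"
    using assms unfolding flat_def by blast
  then show "\<exists>e>0. chart h (D' \<inter> ball x e) u"
    using chart_subset[of h "D \<inter> ball x e" u "D' \<inter> ball x e"] assms(2) by blast
qed

text \<open>
  The quotient of two flat sections is locally constant by \<open>chart_unique\<close>, hence constant.
\<close>

lemma flat_ratio:
  assumes "convex D" "continuous_on D h" "flat h D u" "flat h D v"
  shows "\<exists>g\<in>carrier G. \<forall>x\<in>D. v x = g \<otimes> u x"
proof (cases "D = {}")
  case False
  then obtain a where a: "a \<in> D" by blast
  have "(\<lambda>x. v x \<otimes> inv (u x)) constant_on D"
  proof (rule locally_constant_imp_constant)
    show "connected D" using assms(1) by (rule convex_connected)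
    fix x assume x: "x \<in> D"
    obtain e where e: "e > 0" "chart h (D \<inter> ball x e) u"
      using assms(3) x unfolding flat_def by blast
    obtain e' where e': "e' > 0" "chart h (D \<inter> ball x e') v"
      using assms(4) x unfolding flat_def by blast
    define T where "T = D \<inter> ball x (min e e')"
    have "connected T"
      unfolding T_def using assms(1) by (intro convex_connected convex_Int convex_ball)
    moreover have "continuous_on T h"
      using assms(2) by (rule continuous_on_subset) (simp add: T_def)
    moreover have "chart h T u" "chart h T v"
      by (rule chart_subset[OF e(2)] chart_subset[OF e'(2)]; auto simp: T_def)+
    ultimately obtain g where g: "g \<in> carrier G" "\<And>y. y \<in> T \<Longrightarrow> v y = g \<otimes> u y"
      using chart_unique[of T h u v] by blast
    have "v y \<otimes> inv (u y) = g" if "y \<in> T" for y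
      using g that flat_closed[OF assms(3), of y] by (simp add: T_def m_assoc)
    moreover have "x \<in> T" using x e e' by (simp add: T_def)
    ultimately show "\<exists>T. openin (top_of_set D) T \<and> x \<in> T \<and> (\<forall>y\<in>T. v y \<otimes> inv (u y) = v x \<otimes> inv (u x))"
      by (intro exI[of _ T]) (auto simp: T_def openin_open_Int)
  qed
  then obtain g where g: "\<And>x. x \<in> D \<Longrightarrow> v x \<otimes> inv (u x) = g"
    unfolding constant_on_def by blast
  have cl: "u x \<in> carrier G" "v x \<in> carrier G" if "x \<in> D" for x
    using flat_closed[OF assms(3) that] flat_closed[OF assms(4) that] .
  have "g \<in> carrier G" using g[OF a] cl[OF a] by auto
  moreover have "v x = g \<otimes> u x" if "x \<in> D" for x
    using g[OF that] cl[OF that] by (auto simp: m_assoc)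
  ultimately show ?thesis by blast
qed auto

lemma flat_unique:
  assumes "convex D" "continuous_on D h" "flat h D u" "flat h D v" "a \<in> D" "u a = v a" "x \<in> D"
  shows "u x = v x"
proof -
  obtain g where g: "g \<in> carrier G" "\<forall>x\<in>D. v x = g \<otimes> u x"
    using flat_ratio[OF assms(1-4)] by blast
  then have "u a = g \<otimes> u a" using assms(5,6) by metis
  then have "g = \<one>"
    using g(1) flat_closed[OF assms(3,5)] by (simp only: r_cancel_one')
  then show ?thesis
    using g assms(7) flat_closed[OF assms(3,7)] by simp
qed

lemma chart_exists:
  fixes E :: "'d::euclidean_space set"
  assumes "convex E" "continuous_on E h" "(\<forall>x\<in>E. depth (h x) < 1/2) \<or> (\<forall>x\<in>E. 0 < depth (h x))"
  shows "\<exists>u. chart h E u"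
  using assms(3)
proof
  assume n: "\<forall>x\<in>E. depth (h x) < 1/2"
  have "continuous_on E (\<lambda>x. dir0 (h x))"
    by (rule continuous_on_compose2[OF continuous_dir0 assms(2)]) (use n in auto)
  then obtain \<theta> where "continuous_on E \<theta>" "\<And>x. x \<in> E \<Longrightarrow> dir0 (h x) = cis (2 * pi * \<theta> x)"
    using circle_lift[of E "\<lambda>x. dir0 (h x)"] assms(1) norm_dir0 by blast
  then have "chart0 h E (\<lambda>x. \<one> \<otimes> \<alpha> [^] \<lfloor>\<theta> x\<rfloor>)"
    unfolding chart0_def using n by blast
  then show ?thesis
    unfolding chart_def by blast
next
  assume n: "\<forall>x\<in>E. 0 < depth (h x)"
  have "continuous_on E (\<lambda>x. sgn (scaled_dir1 (h x)))"
    by (rule continuous_on_compose2[OF continuous_sgn_dir1 assms(2)]) (use n in auto)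
  then obtain \<theta> where "continuous_on E \<theta>" "\<And>x. x \<in> E \<Longrightarrow> sgn (scaled_dir1 (h x)) = cis (2 * pi * \<theta> x)"
    using circle_lift[of E "\<lambda>x. sgn (scaled_dir1 (h x))"] assms(1) ann1_coords(2) n by blast
  then have "chart1 h E (\<lambda>x. \<one> \<otimes> weight (h x) (\<theta> x))"
    unfolding chart1_def using n by blast
  then show ?thesis
    unfolding chart_def by blast
qed

lemma depth_dichotomy:
  assumes "continuous_on D h" "x \<in> D"
  obtains e where "e > 0"
    "(\<forall>y\<in>D \<inter> ball x e. depth (h y) < 1/2) \<or> (\<forall>y\<in>D \<inter> ball x e. 0 < depth (h y))"
proof -
  have c: "continuous_on D (\<lambda>x. depth (h x))"
    using continuous_on_compose2[OF continuous_depth assms(1)] by auto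
  have "(1/6::real) > 0" by simp
  with c assms(2) obtain e where e: "e > 0"
    "\<And>y. y \<in> D \<Longrightarrow> dist y x < e \<Longrightarrow> dist (depth (h y)) (depth (h x)) < 1/6"
    unfolding continuous_on_iff by meson
  have near: "\<bar>depth (h y) - depth (h x)\<bar> < 1/6" if "y \<in> D \<inter> ball x e" for y
    using e(2)[of y] that by (auto simp: dist_commute[of x y] dist_real_def)
  show ?thesis
  proof (cases "depth (h x) \<le> 1/6")
    case True
    have "depth (h y) < 1/2" if "y \<in> D \<inter> ball x e" for y
      using near[OF that] True by linarith
    then show ?thesis using that[OF e(1)] by blast
  next
    case False
    have "0 < depth (h y)" if "y \<in> D \<inter> ball x e" for y
      using near[OF that] False by linarith
    then show ?thesis using that[OF e(1)] by blast
  qed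
qed

text \<open>
  After a left multiplication the two sections agree on \<open>D1 \<inter> D2\<close>. At a point of the
  intersection, a local section on the union with the same value agrees with both by uniqueness, and so shows
  that the combined function is flat there.
\<close>

lemma flat_union:
  fixes D1 D2 :: "'d::euclidean_space set"
  assumes D: "closed D1" "closed D2" "convex D1" "convex D2" "convex (D1 \<union> D2)" "D1 \<inter> D2 \<noteq> {}"
    and h: "continuous_on (D1 \<union> D2) h" and u: "flat h D1 u1" "flat h D2 u2"
  shows "\<exists>u. flat h (D1 \<union> D2) u"
proof -
  have ch: "continuous_on S h" if "S \<subseteq> D1 \<union> D2" for S
    using h that by (rule continuous_on_subset)
  have "flat h (D1 \<inter> D2) u1" "flat h (D1 \<inter> D2) u2"
    using u flat_subset by blast+
  moreover have "convex (D1 \<inter> D2)" using D by (intro convex_Int)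
  moreover have "continuous_on (D1 \<inter> D2) h" by (rule ch) auto
  ultimately obtain g where g: "g \<in> carrier G" "\<forall>x\<in>D1 \<inter> D2. u1 x = g \<otimes> u2 x"
    using flat_ratio[of "D1 \<inter> D2" h u2 u1] by blast
  define v2 where "v2 x = g \<otimes> u2 x" for x
  have v2: "flat h D2 v2"
    unfolding v2_def using u(2) g(1) by (rule flat_mult)
  define u where "u x = (if x \<in> D1 then u1 x else v2 x)" for x
  have u1: "u x = u1 x" if "x \<in> D1" for x using that by (simp add: u_def)
  have u2: "u x = v2 x" if "x \<in> D2" for x using that g(2) by (simp add: u_def v2_def)
  have "\<exists>e>0. chart h ((D1 \<union> D2) \<inter> ball x e) u" if x: "x \<in> D1 \<union> D2" for x
  proof -
    consider "x \<in> D1" "x \<notin> D2" | "x \<notin> D1" "x \<in> D2" | "x \<in> D1" "x \<in> D2"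
      using x by blast
    then show ?thesis
    proof cases
      case 1
      obtain e where e: "e > 0" "chart h (D1 \<inter> ball x e) u1"
        using u(1) 1 unfolding flat_def by blast
      obtain d where d: "d > 0" "ball x d \<subseteq> - D2"
        using D(2) 1 open_contains_ball[of "- D2"] by (auto simp: open_closed)
      have "chart h ((D1 \<union> D2) \<inter> ball x (min d e)) u"
      proof (rule chart_cong[OF chart_subset[OF e(2), of "(D1 \<union> D2) \<inter> ball x (min d e)"]])
        show *: "(D1 \<union> D2) \<inter> ball x (min d e) \<subseteq> D1 \<inter> ball x e"
          using d(2) by (auto simp: subset_iff)
        show "u1 y = u y" if "y \<in> (D1 \<union> D2) \<inter> ball x (min d e)" for y
          using that * u1 by auto
      qed simp
      then show ?thesis
        using e(1) d(1) by (intro exI[of _ "min d e"]) simp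
    next
      case 2
      obtain e where e: "e > 0" "chart h (D2 \<inter> ball x e) v2"
        using v2 2 unfolding flat_def by blast
      obtain d where d: "d > 0" "ball x d \<subseteq> - D1"
        using D(1) 2 open_contains_ball[of "- D1"] by (auto simp: open_closed)
      have "chart h ((D1 \<union> D2) \<inter> ball x (min d e)) u"
      proof (rule chart_cong[OF chart_subset[OF e(2), of "(D1 \<union> D2) \<inter> ball x (min d e)"]])
        show *: "(D1 \<union> D2) \<inter> ball x (min d e) \<subseteq> D2 \<inter> ball x e"
          using d(2) by (auto simp: subset_iff)
        show "v2 y = u y" if "y \<in> (D1 \<union> D2) \<inter> ball x (min d e)" for y
          using that * u2 by auto
      qed simp
      then show ?thesis
        using e(1) d(1) by (intro exI[of _ "min d e"]) simp
    next
      case 3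
      obtain e where e: "e > 0" "(\<forall>y\<in>(D1 \<union> D2) \<inter> ball x e. depth (h y) < 1/2) \<or> (\<forall>y\<in>(D1 \<union> D2) \<inter> ball x e. 0 < depth (h y))"
        using depth_dichotomy[OF h x] by blast
      define E where "E = (D1 \<union> D2) \<inter> ball x e"
      have "convex E" unfolding E_def using D(5) by (intro convex_Int convex_ball)
      moreover have "continuous_on E h" by (rule ch) (auto simp: E_def)
      ultimately obtain w where w: "chart h E w"
        using chart_exists e(2) unfolding E_def by blast
      have xE: "x \<in> E" using 3 e(1) by (simp add: E_def)
      \<comment> \<open>a local section through the value of \<open>u\<close> at \<open>x\<close>\<close>
      define w' where "w' y = (u x \<otimes> inv (w x)) \<otimes> w y" for y
      have cl: "u x \<in> carrier G" "w x \<in> carrier G"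
        using u1[of x] 3 flat_closed[OF u(1)] chart_closed[OF w xE] by auto
      then have w': "chart h E w'" "w' x = u x"
        unfolding w'_def using w by (auto intro: chart_mult simp: m_assoc)
      have "w' y = u1 y" if "y \<in> D1 \<inter> ball x e" for y
      proof (rule flat_unique[of "D1 \<inter> ball x e" h _ _ x])
        show "flat h (D1 \<inter> ball x e) w'"
          by (rule flat_subset[OF chart_imp_flat[OF w'(1)]]) (auto simp: E_def)
        show "flat h (D1 \<inter> ball x e) u1"
          by (rule flat_subset[OF u(1)]) auto
        show "continuous_on (D1 \<inter> ball x e) h" by (rule ch) auto
      qed (use 3 e(1) D(3) that w'(2) u1 in \<open>auto intro: convex_Int\<close>)
      moreover have "w' y = v2 y" if "y \<in> D2 \<inter> ball x e" for y
      proof (rule flat_unique[of "D2 \<inter> ball x e" h _ _ x])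
        show "flat h (D2 \<inter> ball x e) w'"
          by (rule flat_subset[OF chart_imp_flat[OF w'(1)]]) (auto simp: E_def)
        show "flat h (D2 \<inter> ball x e) v2"
          by (rule flat_subset[OF v2]) auto
        show "continuous_on (D2 \<inter> ball x e) h" by (rule ch) auto
      qed (use 3 e(1) D(4) that w'(2) u2 in \<open>auto intro: convex_Int\<close>)
      ultimately have "w' y = u y" if "y \<in> E" for y
        using that u1 u2 unfolding E_def by auto
      then have "chart h E u"
        using chart_cong[OF w'(1)] by blast
      then show ?thesis
        using e(1) unfolding E_def by blast
    qed
  qed
  then have "flat h (D1 \<union> D2) u"
    unfolding flat_def by blast
  then show ?thesis by blast
qed

text \<open>
  Two nested bisections: for a fixed first coordinate, small rectangles are stacked to thin strips
  of full height, and these are then joined along the first coordinate.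
\<close>

lemma flat_exists_square:
  fixes h :: "real \<times> real \<Rightarrow> B"
  assumes h: "continuous_on ({0..1} \<times> {0..1}) h"
  shows "\<exists>u. flat h ({0..1} \<times> {0..1}) u"
proof -
  define F where "F a b c d \<longleftrightarrow> (0 \<le> a \<longrightarrow> b \<le> 1 \<longrightarrow> 0 \<le> c \<longrightarrow> d \<le> 1 \<longrightarrow> (\<exists>u. flat h ({a..b} \<times> {c..d}) u))"
    for a b c d :: real
  have ch: "continuous_on ({a..b} \<times> {c..d}) h" if "0 \<le> a" "b \<le> 1" "0 \<le> c" "d \<le> 1" for a b c d
    by (rule continuous_on_subset[OF h]) (use that in auto)
  have cv: "convex ({a..b} \<times> {c..d})" "closed ({a..b} \<times> {c..d})" for a b c d :: real
    by (auto intro: convex_Times closed_Times)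
  have strip: "\<exists>\<delta>>0. \<forall>a b. a \<le> s \<and> s \<le> b \<and> b - a < \<delta> \<longrightarrow> F a b 0 1" if s: "0 \<le> s" "s \<le> 1" for s
  proof -
    define Q where "Q c d \<longleftrightarrow> (\<exists>\<delta>>0. \<forall>a b. a \<le> s \<and> s \<le> b \<and> b - a < \<delta> \<longrightarrow> F a b c d)" for c d
    have "Q 0 1"
    proof (rule Bolzano)
      fix c d e assume "Q c d" "Q d e" and le: "c \<le> d" "d \<le> e"
      then obtain \<delta> \<delta>' where \<delta>: "\<delta> > 0" "\<And>a b. a \<le> s \<and> s \<le> b \<and> b - a < \<delta> \<Longrightarrow> F a b c d"
        "\<delta>' > 0" "\<And>a b. a \<le> s \<and> s \<le> b \<and> b - a < \<delta>' \<Longrightarrow> F a b d e"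
        unfolding Q_def by blast
      have "F a b c e" if ab: "a \<le> s \<and> s \<le> b \<and> b - a < min \<delta> \<delta>'" for a b
        unfolding F_def
      proof (intro impI)
        assume H: "0 \<le> a" "b \<le> 1" "0 \<le> c" "e \<le> 1"
        have un: "{a..b} \<times> {c..d} \<union> {a..b} \<times> {d..e} = {a..b} \<times> {c..e}"
          using le by auto
        have "(a, d) \<in> {a..b} \<times> {c..d} \<inter> {a..b} \<times> {d..e}"
          using le ab by auto
        then have ne: "{a..b} \<times> {c..d} \<inter> {a..b} \<times> {d..e} \<noteq> {}"
          by blast
        obtain u1 u2 where "flat h ({a..b} \<times> {c..d}) u1" "flat h ({a..b} \<times> {d..e}) u2"
          using \<delta>(2)[of a b] \<delta>(4)[of a b] ab H le unfolding F_def by auto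
        then have "\<exists>u. flat h ({a..b} \<times> {c..d} \<union> {a..b} \<times> {d..e}) u"
          by (intro flat_union cv) (use un cv ch[of a b c e] H le ab ne in auto)
        then show "\<exists>u. flat h ({a..b} \<times> {c..e}) u" unfolding un .
      qed
      then show "Q c e"
        unfolding Q_def using \<delta>(1,3) by (intro exI[of _ "min \<delta> \<delta>'"]) auto
    next
      fix t :: real assume t: "0 \<le> t" "t \<le> 1"
      have st: "(s, t) \<in> {0..1} \<times> {0..1}" using s t by simp
      obtain r where r: "r > 0" "(\<forall>y\<in>({0..1} \<times> {0..1}) \<inter> ball (s, t) r. depth (h y) < 1/2) \<or>
          (\<forall>y\<in>({0..1} \<times> {0..1}) \<inter> ball (s, t) r. 0 < depth (h y))"
        using depth_dichotomy[OF h st] by blast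
      have "F a b c d" if ab: "a \<le> s \<and> s \<le> b \<and> b - a < r / 2" and cd: "c \<le> t \<and> t \<le> d \<and> d - c < r / 2" for a b c d
        unfolding F_def
      proof (intro impI)
        assume H: "0 \<le> a" "b \<le> 1" "0 \<le> c" "d \<le> 1"
        have "y \<in> ball (s, t) r" if y: "y \<in> {a..b} \<times> {c..d}" for y
        proof -
          have "dist (s, t) y \<le> dist s (fst y) + dist t (snd y)"
            unfolding dist_prod_def fst_conv snd_conv by (rule sqrt_sum_squares_le_sum) auto
          also have "\<dots> < r / 2 + r / 2"
            using y ab cd by (intro add_strict_mono) (auto simp: dist_real_def abs_if)
          finally show ?thesis by simp
        qed
        then have "{a..b} \<times> {c..d} \<subseteq> ({0..1} \<times> {0..1}) \<inter> ball (s, t) r"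
          using H by auto
        with r(2) have "(\<forall>y\<in>{a..b} \<times> {c..d}. depth (h y) < 1/2) \<or> (\<forall>y\<in>{a..b} \<times> {c..d}. 0 < depth (h y))"
          by blast
        then have "\<exists>u. chart h ({a..b} \<times> {c..d}) u"
          by (intro chart_exists cv ch H)
        then show "\<exists>u. flat h ({a..b} \<times> {c..d}) u"
          using chart_imp_flat by blast
      qed
      then have "\<forall>c d. c \<le> t \<and> t \<le> d \<and> d - c < r / 2 \<longrightarrow> Q c d"
        unfolding Q_def using r(1) half_gt_zero by blast
      then show "\<exists>\<delta>>0. \<forall>c d. c \<le> t \<and> t \<le> d \<and> d - c < \<delta> \<longrightarrow> Q c d"
        using r(1) half_gt_zero by blast
    qed simp
    then show ?thesis unfolding Q_def .
  qed
  have "F 0 1 0 1"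
  proof (rule Bolzano[where P = "\<lambda>a b. F a b 0 1"])
    fix a b c assume F: "F a b 0 1" "F b c 0 1" and le: "a \<le> b" "b \<le> c"
    show "F a c 0 1"
      unfolding F_def
    proof (intro impI)
      assume H: "0 \<le> a" "c \<le> 1"
      have un: "{a..b} \<times> {0..1} \<union> {b..c} \<times> {0..1} = {a..c} \<times> {0..1::real}"
        using le by auto
      have "(b, 0) \<in> {a..b} \<times> {0..1} \<inter> {b..c} \<times> {0..1::real}"
        using le by auto
      then have ne: "{a..b} \<times> {0..1} \<inter> {b..c} \<times> {0..1::real} \<noteq> {}"
        by blast
      obtain u1 u2 where "flat h ({a..b} \<times> {0..1}) u1" "flat h ({b..c} \<times> {0..1}) u2"
        using F H le unfolding F_def by auto
      then have "\<exists>u. flat h ({a..b} \<times> {0..1} \<union> {b..c} \<times> {0..1}) u"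
        by (intro flat_union cv) (use un cv ch[of a c 0 1] H le ne in auto)
      then show "\<exists>u. flat h ({a..c} \<times> {0..1}) u" unfolding un .
    qed
  qed (use strip in auto)
  then show ?thesis by (simp add: F_def)
qed

lemma flat_pullback:
  assumes u: "flat h D u" and g: "continuous_on E g" "g ` E \<subseteq> D"
  shows "flat (\<lambda>x. h (g x)) E (\<lambda>x. u (g x))"
  unfolding flat_def
proof
  fix x assume x: "x \<in> E"
  then obtain e where e: "e > 0" "chart h (D \<inter> ball (g x) e) u"
    using u g(2) unfolding flat_def by blast
  obtain d where d: "d > 0" "\<And>y. y \<in> E \<Longrightarrow> dist y x < d \<Longrightarrow> dist (g y) (g x) < e"
    using g(1) x e(1) unfolding continuous_on_iff by meson
  define S where "S = E \<inter> ball x d"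
  have S: "g ` S \<subseteq> D \<inter> ball (g x) e" "continuous_on S g"
    using d g by (auto simp: S_def dist_commute intro: continuous_on_subset)
  have "chart (\<lambda>x. h (g x)) S (\<lambda>x. u (g x))"
    using e(2) unfolding chart_def
  proof
    assume "chart0 h (D \<inter> ball (g x) e) u"
    then obtain c \<theta> where c: "c \<in> carrier G" "continuous_on (D \<inter> ball (g x) e) \<theta>"
      "\<And>y. y \<in> D \<inter> ball (g x) e \<Longrightarrow> depth (h y) < 1/2 \<and> dir0 (h y) = cis (2 * pi * \<theta> y) \<and> u y = c \<otimes> \<alpha> [^] \<lfloor>\<theta> y\<rfloor>"
      unfolding chart0_def by blast
    have "continuous_on S (\<lambda>y. \<theta> (g y))"
      by (rule continuous_on_compose2[OF c(2) S(2,1)])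
    then have "chart0 (\<lambda>x. h (g x)) S (\<lambda>x. u (g x))"
      unfolding chart0_def using c(1,3) S(1) by (intro bexI[of _ c] exI[of _ "\<lambda>y. \<theta> (g y)"]) blast+
    then show "chart0 (\<lambda>x. h (g x)) S (\<lambda>x. u (g x)) \<or> chart1 (\<lambda>x. h (g x)) S (\<lambda>x. u (g x))" ..
  next
    assume "chart1 h (D \<inter> ball (g x) e) u"
    then obtain c \<theta> where c: "c \<in> carrier G" "continuous_on (D \<inter> ball (g x) e) \<theta>"
      "\<And>y. y \<in> D \<inter> ball (g x) e \<Longrightarrow> 0 < depth (h y) \<and> sgn (scaled_dir1 (h y)) = cis (2 * pi * \<theta> y) \<and> u y = c \<otimes> weight (h y) (\<theta> y)"
      unfolding chart1_def by blast
    have "continuous_on S (\<lambda>y. \<theta> (g y))"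
      by (rule continuous_on_compose2[OF c(2) S(2,1)])
    then have "chart1 (\<lambda>x. h (g x)) S (\<lambda>x. u (g x))"
      unfolding chart1_def using c(1,3) S(1) by (intro bexI[of _ c] exI[of _ "\<lambda>y. \<theta> (g y)"]) blast+
    then show "chart0 (\<lambda>x. h (g x)) S (\<lambda>x. u (g x)) \<or> chart1 (\<lambda>x. h (g x)) S (\<lambda>x. u (g x))" ..
  qed
  then show "\<exists>e>0. chart (\<lambda>x. h (g x)) (E \<inter> ball x e) (\<lambda>x. u (g x))"
    using d(1) unfolding S_def by blast
qed

text \<open>
  Some constant function is flat along a constant map, and uniqueness does the rest.
\<close>

lemma flat_const:
  fixes D :: "'d::euclidean_space set"
  assumes "convex D" "flat (\<lambda>_. b) D u" "x \<in> D" "y \<in> D"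
  shows "u x = u y"
proof -
  have "depth b < 1/2 \<or> 0 < depth b" by linarith
  then have "\<exists>w. chart (\<lambda>_. b) {x} w"
    by (intro chart_exists) auto
  then obtain w where w: "chart (\<lambda>_. b) {x} w" by blast
  have "flat (\<lambda>_. b) {x} w" using w by (rule chart_imp_flat)
  then have c: "flat (\<lambda>_. b) D (\<lambda>_. w x)"
    using flat_pullback[of "\<lambda>_. b" "{x}" w D "\<lambda>_. x"] by (simp add: image_subset_iff)
  have "w x \<in> carrier G" using chart_closed[OF w] by simp
  then have "flat (\<lambda>_. b) D (\<lambda>_. u x \<otimes> inv (w x) \<otimes> w x)"
    using flat_mult[OF c, of "u x \<otimes> inv (w x)"] flat_closed[OF assms(2,3)] by simp
  from flat_unique[OF assms(1) _ assms(2) this assms(3) _ assms(4)]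
  show ?thesis
    using \<open>w x \<in> carrier G\<close> flat_closed[OF assms(2,3)] by (simp add: m_assoc)
qed

text \<open>
  The holonomy: how the lift of \<open>p\<close> to the covering moves in the fibre.
\<close>

definition hol :: "(real \<Rightarrow> B) \<Rightarrow> 'a" where
  "hol p = (SOME g. \<exists>u. flat p {0..1} u \<and> g = inv (u 0) \<otimes> u 1)"

lemma hol_eq:
  assumes "path p" "flat p {0..1} u"
  shows "hol p = inv (u 0) \<otimes> u 1"
proof -
  have "inv (v 0) \<otimes> v 1 = inv (u 0) \<otimes> u 1" if v: "flat p {0..1} v" for v
  proof -
    obtain g where "g \<in> carrier G" "\<forall>x\<in>{0..1}. v x = g \<otimes> u x"
      using flat_ratio[OF _ _ assms(2) v] assms(1) unfolding path_def by auto
    then show ?thesis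
      using flat_closed[OF assms(2), of 0] flat_closed[OF assms(2), of 1]
      by (simp add: inv_mult_group m_assoc cancel_inv)
  qed
  then show ?thesis
    unfolding hol_def using assms(2) by (intro some_equality) blast+
qed

text \<open>
  A flat section over the homotopy restricts to flat sections over both paths, and it is constant
  along the two sides on which the homotopy is constant.
\<close>

lemma hol_homotopic:
  assumes "homotopic_paths UNIV p q"
  shows "hol p = hol q" "\<exists>u. flat p {0..1} u"
proof -
  obtain h :: "real \<times> real \<Rightarrow> B" where h: "continuous_on ({0..1} \<times> {0..1}) h" "\<forall>x\<in>{0..1}. h (0, x) = p x"
    "\<forall>x\<in>{0..1}. h (1, x) = q x" and e: "\<forall>t\<in>{0..1}. h (t, 0) = p 0 \<and> h (t, 1) = p 1"
    using assms unfolding homotopic_paths pathstart_def pathfinish_def comp_def by blast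
  obtain u where u: "flat h ({0..1} \<times> {0..1}) u"
    using flat_exists_square[OF h(1)] by blast
  have row: "flat (\<lambda>t. h (s, t)) {0..1} (\<lambda>t. u (s, t))" if "s \<in> {0..1}" for s
    by (rule flat_pullback[OF u]) (use that in \<open>auto intro!: continuous_intros\<close>)
  have col: "flat (\<lambda>s. h (s, t)) {0..1} (\<lambda>s. u (s, t))" if "t \<in> {0..1}" for t
    by (rule flat_pullback[OF u]) (use that in \<open>auto intro!: continuous_intros\<close>)
  have p: "flat p {0..1} (\<lambda>t. u (0, t))"
    by (rule flat_cong[OF row]) (use h in auto)
  have q: "flat q {0..1} (\<lambda>t. u (1, t))"
    by (rule flat_cong[OF row]) (use h in auto)
  have "flat (\<lambda>_. p 0) {0..1} (\<lambda>s. u (s, 0))" "flat (\<lambda>_. p 1) {0..1} (\<lambda>s. u (s, 1))"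
    by (rule flat_cong[OF col]; use e in auto)+
  from flat_const[OF _ this(1), of 0 1] flat_const[OF _ this(2), of 0 1]
  have "u (0, 0) = u (1, 0)" "u (0, 1) = u (1, 1)" by auto
  then show "hol p = hol q"
    using hol_eq[OF _ p] hol_eq[OF _ q] homotopic_paths_imp_path[OF assms] by simp
  show "\<exists>u. flat p {0..1} u" using p by blast
qed

lemma flat_path: "path p \<Longrightarrow> \<exists>u. flat p {0..1} u"
  by (rule hol_homotopic(2)[of p p]) simp

lemma hol_closed: "path p \<Longrightarrow> hol p \<in> carrier G"
  using flat_path hol_eq flat_closed by fastforce

lemma hol_join:
  assumes "path p" "path q" "pathfinish p = pathstart q"
  shows "hol (p +++ q) = hol p \<otimes> hol q"
proof -
  have pq: "path (p +++ q)" using assms by simp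
  then obtain u where u: "flat (p +++ q) {0..1} u"
    using flat_path by blast
  have "flat (\<lambda>t. (p +++ q) (t / 2)) {0..1} (\<lambda>t. u (t / 2))"
    by (rule flat_pullback[OF u]) (auto intro!: continuous_intros)
  then have 1: "flat p {0..1} (\<lambda>t. u (t / 2))"
    by (rule flat_cong) (simp add: joinpaths_def)
  have "flat (\<lambda>t. (p +++ q) ((t + 1) / 2)) {0..1} (\<lambda>t. u ((t + 1) / 2))"
    by (rule flat_pullback[OF u]) (auto intro!: continuous_intros)
  then have 2: "flat q {0..1} (\<lambda>t. u ((t + 1) / 2))"
  proof (rule flat_cong)
    fix t :: real assume "t \<in> {0..1}"
    moreover have "(2 * t + 2) / 2 - 1 = t" by (simp add: field_simps)
    ultimately show "(p +++ q) ((t + 1) / 2) = q t"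
      using assms(3) by (cases "t = 0") (auto simp: joinpaths_def pathstart_def pathfinish_def)
  qed
  show ?thesis
    using hol_eq[OF pq u] hol_eq[OF assms(1) 1] hol_eq[OF assms(2) 2]
      flat_closed[OF u, of 0] flat_closed[OF u, of "1/2"] flat_closed[OF u, of 1]
    by (simp add: m_assoc cancel_inv)
qed

lemma hol_gamma1: "hol gamma1 = \<alpha>"
proof -
  have g: "(cis (2 * pi * t), 1/2) \<in> cyl0" "gamma1 t = ann0 (cis (2 * pi * t), 1/2)" for t
    by (simp_all add: gamma1_def ann0_def)
  have "chart0 gamma1 {0..1} (\<lambda>t. \<one> \<otimes> \<alpha> [^] \<lfloor>t\<rfloor>)"
    unfolding chart0_def
    by (intro bexI[of _ \<one>] exI[of _ "\<lambda>t. t"]) (auto simp: g(2) coord_ann0[OF g(1)])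
  then have "flat gamma1 {0..1} (\<lambda>t. \<one> \<otimes> \<alpha> [^] \<lfloor>t\<rfloor>)"
    unfolding chart_def[symmetric] using chart_imp_flat chart_def by blast
  from hol_eq[OF path_gamma1(1) this] show ?thesis by simp
qed

lemma gamma2_coords:
  assumes "t \<in> {0..1}"
  shows "dir0 (gamma2 t) = 1" "t \<noteq> 1/2 \<Longrightarrow> depth (gamma2 t) < 1/2"
    "\<bar>t - 1/2\<bar> < 1/4 \<Longrightarrow> 0 < depth (gamma2 t) \<and> sgn (scaled_dir1 (gamma2 t)) = 1 \<and> height (gamma2 t) = 1/2 + 2 * t"
proof -
  consider "t \<le> 1/4" | "1/4 < t" "t \<le> 3/4" | "3/4 < t" by linarith
  then have "dir0 (gamma2 t) = 1 \<and> (t \<noteq> 1/2 \<longrightarrow> depth (gamma2 t) < 1/2) \<and> (\<bar>t - 1/2\<bar> < 1/4 \<longrightarrow>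
    0 < depth (gamma2 t) \<and> sgn (scaled_dir1 (gamma2 t)) = 1 \<and> height (gamma2 t) = 1/2 + 2 * t)"
  proof cases
    case 1
    then have "gamma2 t = ann0 (1, 1/2 - 2 * t)" "(1, 1/2 - 2 * t) \<in> cyl0"
      using assms by (auto simp: gamma2_def ann0_def)
    then show ?thesis using 1 by (simp add: coord_ann0)
  next
    case 2
    have g: "gamma2 t = ann1 (1, 1/2 + 2 * t)" "(1, 1/2 + 2 * t) \<in> cyl1"
      using 2 by (auto simp: gamma2_def ann1_def)
    have m: "0 < min (2 * t - 1/2) (3/2 - 2 * t)" if "\<bar>t - 1/2\<bar> < 1/4"
      using that by (simp add: abs_if split: if_splits)
    have "depth (gamma2 t) = min (2 * t - 1/2) (3/2 - 2 * t)" "height (gamma2 t) = 1/2 + 2 * t"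
      "scaled_dir1 (gamma2 t) = of_real (min (2 * t - 1/2) (3/2 - 2 * t))" "dir0 (gamma2 t) = 1"
      unfolding g(1) coord_ann1[OF g(2)] by (simp_all add: scaleR_conv_of_real)
    moreover have "min (2 * t - 1/2) (3/2 - 2 * t) < 1/2" if "t \<noteq> 1/2"
      using that by (simp add: min_def)
    moreover have "sgn (of_real r :: complex) = 1" if "0 < r" for r
      using that by (simp add: sgn_of_real)
    ultimately show ?thesis
      using m by simp
  next
    case 3
    then have "gamma2 t = ann0 (1, 5/2 - 2 * t)" "(1, 5/2 - 2 * t) \<in> cyl0"
      using assms by (auto simp: gamma2_def ann0_def)
    then show ?thesis using 3 by (simp add: coord_ann0 abs_if)
  qed
  then show "dir0 (gamma2 t) = 1" "t \<noteq> 1/2 \<Longrightarrow> depth (gamma2 t) < 1/2"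
    "\<bar>t - 1/2\<bar> < 1/4 \<Longrightarrow> 0 < depth (gamma2 t) \<and> sgn (scaled_dir1 (gamma2 t)) = 1 \<and> height (gamma2 t) = 1/2 + 2 * t"
    by blast+
qed

text \<open>
  Cutting at angle zero leaves \<open>\<gamma>\<^sub>2\<close> in one sheet except at time \<open>1/2\<close>, when it crosses the
  middle circle of \<open>A\<^sub>1\<close> and picks up the factor \<open>\<beta>\<close>.
\<close>

lemma hol_gamma2: "hol gamma2 = \<beta>"
proof -
  define u where "u t = (if t \<le> 1/2 then \<one> else \<beta>)" for t :: real
  have "flat gamma2 {0..1} u"
    unfolding flat_def
  proof
    fix x :: real assume x: "x \<in> {0..1}"
    show "\<exists>e>0. chart gamma2 ({0..1} \<inter> ball x e) u"
    proof (cases "x = 1/2")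
      case True
      have "chart1 gamma2 ({0..1} \<inter> ball x (1/4)) u"
        unfolding chart1_def
      proof (intro bexI[of _ \<one>] exI[of _ "\<lambda>_. 0"] conjI ballI)
        fix t assume t: "t \<in> {0..1} \<inter> ball x (1/4)"
        then have d: "\<bar>t - 1/2\<bar> < 1/4"
          using True by (simp add: dist_real_def abs_minus_commute)
        note c = gamma2_coords(3)[OF _ d]
        show "0 < depth (gamma2 t)" "sgn (scaled_dir1 (gamma2 t)) = cis (2 * pi * 0)"
          "u t = \<one> \<otimes> weight (gamma2 t) 0"
          using t c by (auto simp: u_def weight_def)
      qed simp_all
      then show ?thesis
        unfolding chart_def by (intro exI[of _ "1/4"]) simp
    next
      case False
      define e where "e = \<bar>x - 1/2\<bar>"
      have e: "t \<noteq> 1/2 \<and> (t \<le> 1/2 \<longleftrightarrow> x \<le> 1/2)" if "t \<in> ball x e" for t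
        using that by (auto simp: e_def dist_real_def abs_if split: if_splits)
      have "chart0 gamma2 ({0..1} \<inter> ball x e) u"
        unfolding chart0_def
      proof (intro bexI[of _ "u x"] exI[of _ "\<lambda>_. 0"] conjI ballI)
        fix t assume t: "t \<in> {0..1} \<inter> ball x e"
        show "depth (gamma2 t) < 1/2" "dir0 (gamma2 t) = cis (2 * pi * 0)"
          "u t = u x \<otimes> \<alpha> [^] \<lfloor>0::real\<rfloor>"
          using t gamma2_coords(1,2)[of t] e[of t] by (auto simp: u_def)
      qed (simp_all add: u_def)
      then show ?thesis
        unfolding chart_def using False by (intro exI[of _ e]) (simp add: e_def)
    qed
  qed
  from hol_eq[OF path_gamma2(1) this] show ?thesis by (simp add: u_def)
qed

definition hol_class :: "(real \<Rightarrow> B) set \<Rightarrow> 'a" where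
  "hol_class c = hol (SOME p. p \<in> c)"

lemma hol_class_pcl:
  assumes "path p"
  shows "hol_class (pcl p) = hol p"
proof -
  have "p \<in> pcl p" using assms by (simp add: homotopy_class_def)
  then have "(SOME p'. p' \<in> pcl p) \<in> pcl p" by (rule someI[of "\<lambda>p'. p' \<in> pcl p"])
  then have "homotopic_paths UNIV p (SOME p'. p' \<in> pcl p)"
    by (simp add: homotopy_class_def)
  from hol_homotopic(1)[OF this] show ?thesis
    by (simp add: hol_class_def)
qed

lemma hol_class_hom: "hol_class \<in> hom (pi1_B x) G"
proof (rule homI)
  fix c assume "c \<in> carrier (pi1_B x)"
  then show "hol_class c \<in> carrier G"
    by (auto simp: fundamental_group_def loops_at_def hol_class_pcl hol_closed)
next
  fix c d assume "c \<in> carrier (pi1_B x)" "d \<in> carrier (pi1_B x)"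
  then obtain p q where "c = pcl p" "d = pcl q" "p \<in> loops_at UNIV x" "q \<in> loops_at UNIV x"
    by (auto simp: fundamental_group_def)
  then show "hol_class (c \<otimes>\<^bsub>pi1_B x\<^esub> d) = hol_class c \<otimes> hol_class d"
    by (simp add: mult_homotopy_class) (simp add: loops_at_def hol_class_pcl hol_join)
qed

end

section \<open>Homomorphisms out of a presented group\<close>

definition word_value :: "('b, 'c) monoid_scheme \<Rightarrow> ('g \<Rightarrow> 'b) \<Rightarrow> 'g word \<Rightarrow> 'b" where
  "word_value G f w = foldr (\<lambda>(g, e) y. (if e then f g else inv\<^bsub>G\<^esub> f g) \<otimes>\<^bsub>G\<^esub> y) w \<one>\<^bsub>G\<^esub>"

context group
begin

lemma word_value_Nil [simp]: "word_value G f [] = \<one>"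
  by (simp add: word_value_def)

lemma word_value_Cons [simp]:
  "word_value G f ((g, e) # w) = (if e then f g else inv f g) \<otimes> word_value G f w"
  by (simp add: word_value_def)

lemma word_value_closed [simp]: "(\<And>g. f g \<in> carrier G) \<Longrightarrow> word_value G f w \<in> carrier G"
  by (induction w) (auto simp: word_value_def)

lemma word_value_append:
  assumes "\<And>g. f g \<in> carrier G"
  shows "word_value G f (u @ v) = word_value G f u \<otimes> word_value G f v"
proof (induction u)
  case Nil
  show ?case using assms by simp
next
  case (Cons l u)
  obtain g e where "l = (g, e)" by (cases l)
  then show ?case using Cons assms by (simp add: m_assoc)
qed

lemma word_value_pres_eq:
  assumes "pres_eq R u v" and f: "\<And>g. f g \<in> carrier G"
    and R: "\<And>u v. (u, v) \<in> R \<Longrightarrow> word_value G f u = word_value G f v"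
  shows "word_value G f u = word_value G f v"
  using assms(1) by induction (use f in \<open>simp_all add: R word_value_append\<close>)

lemma presented_group_hom:
  assumes f: "\<And>g. f g \<in> carrier G"
    and R: "\<And>u v. (u, v) \<in> R \<Longrightarrow> word_value G f u = word_value G f v"
  obtains \<psi> where "\<psi> \<in> hom (presented_group R) G" "\<And>w. \<psi> (pres_class R w) = word_value G f w"
proof -
  \<comment> \<open>any representative of the class gives the same value\<close>
  define \<psi> where "\<psi> c = word_value G f (SOME w. w \<in> c)" for c
  have \<psi>: "\<psi> (pres_class R w) = word_value G f w" for w
  proof -
    have "w \<in> pres_class R w" by (simp add: pres_class_def pres_eq.refl)
    then have "(SOME w'. w' \<in> pres_class R w) \<in> pres_class R w"
      by (rule someI[of "\<lambda>w'. w' \<in> pres_class R w"])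
    then have "pres_eq R w (SOME w'. w' \<in> pres_class R w)" by (simp add: pres_class_def)
    from word_value_pres_eq[OF this f R] show ?thesis by (simp add: \<psi>_def)
  qed
  have "\<psi> \<in> hom (presented_group R) G"
    using f by (intro homI) (auto simp: carrier_presented_group mult_pres_class \<psi> word_value_append)
  then show ?thesis using \<psi> by (rule that)
qed

end

context BS_relation
begin

lemma BS23_hom:
  obtains \<psi> where "\<psi> \<in> hom BS23 G" "\<psi> bs_a = \<alpha>" "\<psi> bs_b = \<beta>"
proof -
  define f where "f g = (case g of Gen_a \<Rightarrow> \<alpha> | Gen_b \<Rightarrow> \<beta>)" for g
  have f: "f g \<in> carrier G" for g by (cases g) (simp_all add: f_def)
  have "\<alpha> [^] (2::int) = \<alpha> \<otimes> \<alpha>" "\<alpha> [^] (3::int) = \<alpha> \<otimes> (\<alpha> \<otimes> \<alpha>)"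
    using int_pow_int[of G \<alpha> 2] int_pow_int[of G \<alpha> 3]
    by (simp_all add: numeral_2_eq_2 numeral_3_eq_3 m_assoc)
  then have "word_value G f u = word_value G f v" if "(u, v) \<in> BS23_rel" for u v
    using that relation by (auto simp: BS23_rel_def f_def m_assoc)
  then obtain \<psi> where "\<psi> \<in> hom BS23 G" "\<And>w. \<psi> (pres_class BS23_rel w) = word_value G f w"
    using presented_group_hom[of f BS23_rel] f unfolding BS23_def by blast
  then show ?thesis
    by (intro that[of \<psi>]) (simp_all add: bs_a_def bs_b_def f_def)
qed

end

section \<open>Change of base point and induced maps\<close>

lemma reversepath_line: "reversepath (f \<circ> linepath u v) = f \<circ> linepath v u"
  by (simp add: reversepath_def linepath_def comp_def fun_eq_iff add.commute)

lemma carrierE: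
  assumes "c \<in> carrier (fundamental_group UNIV x)"
  obtains p where "c = pcl p" "path p" "pathstart p = x" "pathfinish p = x"
  using assms by (auto simp: fundamental_group_def loops_at_def)

text \<open>
  A path is itself a segment for the parameter interval, so reversal and cancellation are instances
  of \<open>seg_join\<close>.
\<close>

lemma pcl_seg: "pcl p = seg p 0 1" "pcl (reversepath p) = seg p 1 0" "pcl (\<lambda>_. p t) = seg p t t"
  by (simp_all add: seg_def comp_def linepath_def reversepath_def algebra_simps)

lemma seg_join_path:
  assumes "path p" "r \<in> {0..1}" "s \<in> {0..1}" "t \<in> {0..1}"
  shows "seg p r s \<star> seg p s t = seg p r t"
  using assms by (intro seg_join[of "{0..1}"]) (auto simp: path_def)

lemma one_fundamental_group: "\<one>\<^bsub>fundamental_group UNIV x\<^esub> = pcl (\<lambda>_. x)"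
  by (simp add: fundamental_group_def)

lemma change_base_eq:
  assumes p: "path p" and c: "c \<in> carrier (fundamental_group UNIV (p 1))"
  shows "change_base UNIV p c = seg p 0 1 \<star> c \<star> seg p 1 0"
    "change_base UNIV p c \<in> carrier (fundamental_group UNIV (p 0))"
proof -
  obtain d where d: "c = pcl d" "path d" "pathstart d = p 1" "pathfinish d = p 1"
    using c by (rule carrierE)
  have "change_base UNIV p c = pcl (p +++ d +++ reversepath p)"
    unfolding d(1) using d p by (intro change_base_homotopy_class) (auto simp: loops_at_def pathfinish_def)
  moreover have ends: "pathstart p = p 0" "pathfinish p = p 1"
    by (simp_all add: pathstart_def pathfinish_def)
  moreover have "pcl (p +++ d +++ reversepath p) \<in> carrier (fundamental_group UNIV (p 0))"
    by (rule pcl_carrier) (simp_all add: d p ends)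
  moreover have "pcl p \<star> pcl d \<star> pcl (reversepath p) = pcl (p +++ d +++ reversepath p)"
    by (simp add: pcl_join d p ends)
  ultimately show "change_base UNIV p c = seg p 0 1 \<star> c \<star> seg p 1 0"
    "change_base UNIV p c \<in> carrier (fundamental_group UNIV (p 0))"
    unfolding d(1) pcl_seg(1)[of p, symmetric] pcl_seg(2)[of p, symmetric] by simp_all
qed

lemma carrier_unit:
  assumes "path p" "c \<in> carrier (fundamental_group UNIV (p t))"
  shows "seg p t t \<star> c = c" "c \<star> seg p t t = c"
proof -
  interpret group "fundamental_group UNIV (p t)" by (simp add: group_fundamental_group)
  have "seg p t t = \<one>\<^bsub>fundamental_group UNIV (p t)\<^esub>"
    by (simp only: one_fundamental_group pcl_seg(3))
  then show "seg p t t \<star> c = c" "c \<star> seg p t t = c"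
    using mult_fundamental_group[OF one_closed assms(2)] mult_fundamental_group[OF assms(2) one_closed] assms(2)
    by simp_all
qed

lemma change_base_hom:
  assumes p: "path p"
  shows "change_base UNIV p \<in> hom (fundamental_group UNIV (p 1)) (fundamental_group UNIV (p 0))"
proof (rule homI)
  fix c d assume c: "c \<in> carrier (fundamental_group UNIV (p 1))" "d \<in> carrier (fundamental_group UNIV (p 1))"
  interpret group "fundamental_group UNIV (p 1)" by (simp add: group_fundamental_group)
  note P = carrier_paths_only[OF c(1)] carrier_paths_only[OF c(2)]
  have "change_base UNIV p c \<otimes>\<^bsub>fundamental_group UNIV (p 0)\<^esub> change_base UNIV p d =
      seg p 0 1 \<star> c \<star> (seg p 1 0 \<star> seg p 0 1) \<star> d \<star> seg p 1 0"
    unfolding mult_fundamental_group[OF change_base_eq(2)[OF p c(1)] change_base_eq(2)[OF p c(2)]]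
    using P by (simp add: change_base_eq(1)[OF p] c class_join_assoc)
  also have "\<dots> = seg p 0 1 \<star> (c \<star> seg p 1 1) \<star> d \<star> seg p 1 0"
    using P by (simp add: seg_join_path p class_join_assoc)
  also have "\<dots> = seg p 0 1 \<star> (c \<star> d) \<star> seg p 1 0"
    using P carrier_unit(2)[OF p c(1)] by (simp add: class_join_assoc)
  also have "\<dots> = change_base UNIV p (c \<otimes>\<^bsub>fundamental_group UNIV (p 1)\<^esub> d)"
    using c m_closed[OF c] by (simp add: change_base_eq[OF p]) (simp add: mult_fundamental_group)
  finally show "change_base UNIV p (c \<otimes>\<^bsub>fundamental_group UNIV (p 1)\<^esub> d) =
    change_base UNIV p c \<otimes>\<^bsub>fundamental_group UNIV (p 0)\<^esub> change_base UNIV p d" by simp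
qed (rule change_base_eq(2)[OF p])

lemma change_base_inj:
  assumes p: "path p" and c: "c \<in> carrier (fundamental_group UNIV (p 1))"
    and one: "change_base UNIV p c = \<one>\<^bsub>fundamental_group UNIV (p 0)\<^esub>"
  shows "c = \<one>\<^bsub>fundamental_group UNIV (p 1)\<^esub>"
proof -
  note P = carrier_paths_only[OF c]
  have "seg p 1 0 \<star> (seg p 0 1 \<star> c \<star> seg p 1 0) \<star> seg p 0 1 = seg p 1 0 \<star> seg p 0 0 \<star> seg p 0 1"
    using one by (simp only: change_base_eq(1)[OF p c] one_fundamental_group pcl_seg(3)[of p])
  also have "\<dots> = \<one>\<^bsub>fundamental_group UNIV (p 1)\<^esub>"
    by (simp add: seg_join_path p one_fundamental_group pcl_seg(3)[of p])
  also have "seg p 1 0 \<star> (seg p 0 1 \<star> c \<star> seg p 1 0) \<star> seg p 0 1 =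
      (seg p 1 0 \<star> seg p 0 1) \<star> c \<star> (seg p 1 0 \<star> seg p 0 1)"
    using P by (simp add: class_join_assoc)
  also have "\<dots> = c"
    using carrier_unit[OF p c] by (simp add: seg_join_path p)
  finally show ?thesis .
qed

lemma induced_map_pcl:
  assumes "c \<in> carrier (fundamental_group UNIV x)" "continuous_on UNIV f"
  obtains p where "c = pcl p" "path p" "pathstart p = x" "pathfinish p = x" "induced_map UNIV f c = pcl (f \<circ> p)"
proof -
  obtain p where p: "c = pcl p" "path p" "pathstart p = x" "pathfinish p = x"
    using assms(1) by (rule carrierE)
  then have "induced_map UNIV f c = pcl (f \<circ> p)"
    using assms(2) induced_map_homotopy_class[of p UNIV x f UNIV] by (simp add: loops_at_def)
  with p show ?thesis by (rule that)
qed

lemma induced_map_hom: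
  assumes f: "continuous_on UNIV f"
  shows "induced_map UNIV f \<in> hom (fundamental_group UNIV x) (fundamental_group UNIV (f x))"
proof (rule homI)
  fix c assume "c \<in> carrier (fundamental_group UNIV x)"
  from induced_map_pcl[OF this f] obtain p where "path p" "pathstart p = x" "pathfinish p = x"
    "induced_map UNIV f c = pcl (f \<circ> p)" by metis
  then show "induced_map UNIV f c \<in> carrier (fundamental_group UNIV (f x))"
    using continuous_on_subset[OF f]
    by (auto intro!: pcl_carrier path_continuous_image simp: pathstart_compose pathfinish_compose)
next
  fix c d assume c: "c \<in> carrier (fundamental_group UNIV x)" and d: "d \<in> carrier (fundamental_group UNIV x)"
  from induced_map_pcl[OF c f] obtain p where p: "c = pcl p" "path p" "pathstart p = x" "pathfinish p = x"
    "induced_map UNIV f c = pcl (f \<circ> p)" by metis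
  from induced_map_pcl[OF d f] obtain q where q: "d = pcl q" "path q" "pathstart q = x" "pathfinish q = x"
    "induced_map UNIV f d = pcl (f \<circ> q)" by metis
  have l: "p \<in> loops_at UNIV x" "q \<in> loops_at UNIV x" "f \<circ> p \<in> loops_at UNIV (f x)" "f \<circ> q \<in> loops_at UNIV (f x)"
    using p q continuous_on_subset[OF f]
    by (auto simp: loops_at_def pathstart_compose pathfinish_compose intro!: path_continuous_image)
  have "induced_map UNIV f (c \<otimes>\<^bsub>fundamental_group UNIV x\<^esub> d) = pcl (f \<circ> (p +++ q))"
    using l p q f by (simp add: mult_homotopy_class induced_map_homotopy_class[OF join_loop[OF l(1,2)]])
  then show "induced_map UNIV f (c \<otimes>\<^bsub>fundamental_group UNIV x\<^esub> d) =
    induced_map UNIV f c \<otimes>\<^bsub>fundamental_group UNIV (f x)\<^esub> induced_map UNIV f d"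
    using l p(5) q(5) by (simp add: mult_homotopy_class path_compose_join)
qed

lemma seg_cong:
  assumes "convex C" "continuous_on C f" "u \<in> C" "v \<in> C" "\<And>w. w \<in> C \<Longrightarrow> f w = g w"
  shows "seg f u v = seg g u v"
  unfolding seg_def
proof (rule pcl_eqI, rule homotopic_paths_eq)
  show "path (f \<circ> linepath u v)"
    using assms(1-4) by (rule path_convex_linepath)
  fix t :: real assume "t \<in> {0..1}"
  then have "linepath u v t \<in> C"
    using closed_segment_subset[OF assms(3,4,1)] linepath_in_path by blast
  then show "(f \<circ> linepath u v) t = (g \<circ> linepath u v) t"
    using assms(5) by simp
qed simp

section \<open>The effect of the map on segments and loops\<close>

lemma phi_tilde_par:
  "u \<in> strip0 \<Longrightarrow> phi_tilde (par0 u) = par1 (fst u, 2 - snd u)"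
  "u \<in> strip1 \<Longrightarrow> phi_tilde (par1 u) = par0 (6 * fst u, 2 - snd u)"
  using cis_power[of "fst u" 6] by (auto simp: par0_def par1_def phi_tilde_ann)

lemma continuous_phi_par: "continuous_on strip0 (phi_tilde \<circ> par0)" "continuous_on strip1 (phi_tilde \<circ> par1)"
  by (intro continuous_on_compose continuous_par continuous_on_subset[OF continuous_phi_tilde]; simp)+

lemma path_phi_line:
  "u \<in> strip0 \<Longrightarrow> v \<in> strip0 \<Longrightarrow> path (phi_tilde \<circ> line0 u v)"
  "u \<in> strip1 \<Longrightarrow> v \<in> strip1 \<Longrightarrow> path (phi_tilde \<circ> line1 u v)"
  using path_convex_linepath[OF convex_strip(1) continuous_phi_par(1)]
    path_convex_linepath[OF convex_strip(2) continuous_phi_par(2)] by (simp_all add: comp_assoc)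

lemma phi_seg0:
  assumes "x \<in> {0..1}" "y \<in> {0..1}"
  shows "pcl (phi_tilde \<circ> line0 (a, x) (b, y)) = seg par1 (a, 2 - x) (b, 2 - y)"
proof -
  have "pcl (phi_tilde \<circ> line0 (a, x) (b, y)) = seg (phi_tilde \<circ> par0) (a, x) (b, y)"
    by (simp add: seg_def comp_assoc)
  also have "\<dots> = seg (\<lambda>u. par1 (fst u, 2 - snd u)) (a, x) (b, y)"
    by (rule seg_cong[OF convex_strip(1) continuous_phi_par(1)]) (use assms phi_tilde_par(1) in auto)
  also have "\<dots> = seg par1 (a, 2 - x) (b, 2 - y)"
    by (simp add: seg_def comp_def linepath_def algebra_simps)
  finally show ?thesis .
qed

lemma phi_seg1:
  assumes "x \<in> {1..2}" "y \<in> {1..2}"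
  shows "pcl (phi_tilde \<circ> line1 (a, x) (b, y)) = seg par0 (6 * a, 2 - x) (6 * b, 2 - y)"
proof -
  have "pcl (phi_tilde \<circ> line1 (a, x) (b, y)) = seg (phi_tilde \<circ> par1) (a, x) (b, y)"
    by (simp add: seg_def comp_assoc)
  also have "\<dots> = seg (\<lambda>u. par0 (6 * fst u, 2 - snd u)) (a, x) (b, y)"
    by (rule seg_cong[OF convex_strip(2) continuous_phi_par(2)]) (use assms phi_tilde_par(2) in auto)
  also have "\<dots> = seg par0 (6 * a, 2 - x) (6 * b, 2 - y)"
    by (simp add: seg_def comp_def linepath_def algebra_simps)
  finally show ?thesis .
qed

lemma phi_base0: "phi_tilde base0 = base1"
  using phi_tilde_par(1)[of "(0, 1/2)"] by (simp add: par_ends)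

lemma induced_gamma1: "induced_map UNIV phi_tilde (pcl gamma1) = seg par1 (0, 3/2) (1, 3/2)"
proof -
  have "induced_map UNIV phi_tilde (pcl gamma1) = pcl (phi_tilde \<circ> gamma1)"
    by (rule induced_map_homotopy_class[where x = base0])
      (simp_all add: loops_at_def path_gamma1 continuous_phi_tilde)
  then show ?thesis
    using phi_seg0[of "1/2" "1/2" 0 1] by (simp add: gamma1_eq)
qed

lemma induced_gamma2: "induced_map UNIV phi_tilde (pcl gamma2) =
  seg par1 (0, 3/2) (0, 2) \<star> seg par0 (0, 1) (0, 0) \<star> seg par1 (0, 1) (0, 3/2)"
proof -
  have e: "phi_tilde (par1 (0, 3/2)) = base0" "phi_tilde (par0 (0, 0)) = phi_tilde (par1 (0, 1))"
     "phi_tilde (par0 (0, 1)) = phi_tilde (par1 (0, 2))"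
    using phi_tilde_par(2)[of "(0, 3/2)"] by (simp_all add: par_ends)
  have "induced_map UNIV phi_tilde (pcl gamma2) = pcl (phi_tilde \<circ> gamma2)"
    by (rule induced_map_homotopy_class[where x = base0])
      (simp_all add: loops_at_def path_gamma2 continuous_phi_tilde)
  also have "\<dots> = (pcl (phi_tilde \<circ> line0 (0, 1/2) (0, 0)) \<star> pcl (phi_tilde \<circ> line1 (0, 1) (0, 3/2))) \<star>
    (pcl (phi_tilde \<circ> line1 (0, 3/2) (0, 2)) \<star> pcl (phi_tilde \<circ> line0 (0, 1) (0, 1/2)))"
    unfolding gamma2_eq path_compose_join
    by (simp add: pcl_join path_phi_line pathstart_compose pathfinish_compose e)
  also have "\<dots> = seg par1 (0, 3/2) (0, 2) \<star> seg par0 (0, 1) (0, 0) \<star> seg par1 (0, 1) (0, 3/2)"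
    by (simp add: phi_seg0 phi_seg1 class_join_assoc seg_join0)
  finally show ?thesis .
qed

lemma path_path12: "path path1" "path path2" "path1 0 = base0" "path2 0 = base0" "path1 1 = base1" "path2 1 = base1"
  using par_ends(1,2)
  by (simp_all add: path1_eq path2_eq path_par0 path_par1 par_ends pathstart_compose pathfinish_compose)
    (simp_all add: joinpaths_def linepath_def par_ends)

lemma seg_path1: "seg path1 0 1 = seg par0 (0, 1/2) (0, 1) \<star> seg par1 (0, 2) (0, 3/2)"
  "seg path1 1 0 = seg par1 (0, 3/2) (0, 2) \<star> seg par0 (0, 1) (0, 1/2)"
  unfolding pcl_seg[symmetric] unfolding path1_eq
  by (simp_all add: reversepath_joinpaths reversepath_line path_par0 path_par1 par_ends pathstart_compose pathfinish_compose
      seg_def pcl_join)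

lemma seg_path2: "seg path2 0 1 = seg par0 (0, 1/2) (0, 0) \<star> seg par1 (0, 1) (0, 3/2)"
  "seg path2 1 0 = seg par1 (0, 3/2) (0, 1) \<star> seg par0 (0, 0) (0, 1/2)"
  unfolding pcl_seg[symmetric] unfolding path2_eq
  by (simp_all add: reversepath_joinpaths reversepath_line path_par0 path_par1 par_ends pathstart_compose pathfinish_compose
      seg_def pcl_join)

lemma induced_carrier: "c \<in> carrier (pi1_B base0) \<Longrightarrow> induced_map UNIV phi_tilde c \<in> carrier (pi1_B base1)"
  using hom_in_carrier[OF induced_map_hom[OF continuous_phi_tilde, of base0]] by (simp add: phi_base0)

lemma change_base_path:
  assumes "c \<in> carrier (pi1_B base1)"
  shows "change_base UNIV path1 c = seg par0 (0, 1/2) (0, 1) \<star> seg par1 (0, 2) (0, 3/2) \<star> c \<star>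
      seg par1 (0, 3/2) (0, 2) \<star> seg par0 (0, 1) (0, 1/2)"
    "change_base UNIV path2 c = seg par0 (0, 1/2) (0, 0) \<star> seg par1 (0, 1) (0, 3/2) \<star> c \<star>
      seg par1 (0, 3/2) (0, 1) \<star> seg par0 (0, 0) (0, 1/2)"
  using change_base_eq(1)[of path1 c] change_base_eq(1)[of path2 c] assms carrier_paths_only[OF assms]
  by (simp_all add: path_path12 seg_path1 seg_path2 class_join_assoc)

text \<open>
  The induced map moves \<open>\<gamma>\<^sub>1\<close> to the middle circle of \<open>A\<^sub>1\<close>. Along \<open>path1\<close> it is slid to the top,
  where the attaching degree is \<open>2\<close>; along \<open>path2\<close>, in the next lemma, it is slid to the bottom, where the
  degree is \<open>3\<close>.
\<close>

lemma path1_gamma1: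
  "change_base UNIV path1 (induced_map UNIV phi_tilde (pcl gamma1)) = seg par0 (0, 1/2) (2, 1/2)"
proof -
  have "change_base UNIV path1 (induced_map UNIV phi_tilde (pcl gamma1)) =
     seg par0 (0, 1/2) (0, 1) \<star> seg par1 (0, 2) (1, 3/2) \<star> seg par1 (0, 3/2) (0, 2) \<star> seg par0 (0, 1) (0, 1/2)"
    unfolding change_base_path(1)[OF induced_carrier[OF gamma_carrier(1)]]
    by (simp add: induced_gamma1 seg_join1)
  also have "seg par1 (0, 3/2) (0, 2) = seg par1 (1, 3/2) (1, 2)"
    using seg_shift1[of 0 1 "3/2" 0 2] by simp
  also have "seg par0 (0, 1) (0, 1/2) = seg par0 (2, 1) (2, 1/2)"
    using seg_shift0[of 0 2 1 0 "1/2"] by simp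
  finally show ?thesis
    using seg_top[of 0 1] by (simp add: seg_join0 seg_join1)
qed

lemma path2_gamma1:
  "change_base UNIV path2 (induced_map UNIV phi_tilde (pcl gamma1)) = seg par0 (0, 1/2) (3, 1/2)"
proof -
  have "change_base UNIV path2 (induced_map UNIV phi_tilde (pcl gamma1)) =
     seg par0 (0, 1/2) (0, 0) \<star> seg par1 (0, 1) (1, 3/2) \<star> seg par1 (0, 3/2) (0, 1) \<star> seg par0 (0, 0) (0, 1/2)"
    unfolding change_base_path(2)[OF induced_carrier[OF gamma_carrier(1)]]
    by (simp add: induced_gamma1 seg_join1)
  also have "seg par1 (0, 3/2) (0, 1) = seg par1 (1, 3/2) (1, 1)"
    using seg_shift1[of 0 1 "3/2" 0 1] by simp
  also have "seg par0 (0, 0) (0, 1/2) = seg par0 (3, 0) (3, 1/2)"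
    using seg_shift0[of 0 3 0 0 "1/2"] by simp
  finally show ?thesis
    using seg_bottom[of 0 1] by (simp add: seg_join0 seg_join1)
qed

text \<open>
  The image of \<open>\<gamma>\<^sub>2\<close> starts and ends in the middle of \<open>A\<^sub>1\<close>. Conjugation by either path
  cancels its detours and leaves the crossing of \<open>A\<^sub>1\<close> and the return through \<open>A\<^sub>0\<close>.
\<close>

lemma path1_gamma2:
  "change_base UNIV path1 (induced_map UNIV phi_tilde (pcl gamma2)) = pcl gamma2"
  unfolding change_base_path(1)[OF induced_carrier[OF gamma_carrier(2)]]
  unfolding induced_gamma2
  using seg_top[of 0 0] by (simp add: pcl_gamma2 class_join_assoc seg_join0 seg_join1)

lemma path2_gamma2:
  "change_base UNIV path2 (induced_map UNIV phi_tilde (pcl gamma2)) = pcl gamma2"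
  unfolding change_base_path(2)[OF induced_carrier[OF gamma_carrier(2)]]
  unfolding induced_gamma2
  using seg_bottom[of 0 0] by (simp add: pcl_gamma2 class_join_assoc seg_join0 seg_join1)

section \<open>The presentation and the kernels\<close>

text \<open>
  The loop \<open>\<gamma>\<^sub>1\<close> taken twice at the top of \<open>A\<^sub>1\<close> is one turn of \<open>A\<^sub>1\<close>, which slides to the bottom
  and becomes three turns of \<open>A\<^sub>0\<close>.
\<close>

lemma pi1_relation:
  "pcl gamma2 \<otimes>\<^bsub>pi1_B base0\<^esub> pcl gamma1 [^]\<^bsub>pi1_B base0\<^esub> (2::nat) =
    pcl gamma1 [^]\<^bsub>pi1_B base0\<^esub> (3::nat) \<otimes>\<^bsub>pi1_B base0\<^esub> pcl gamma2"
proof -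
  interpret group "pi1_B base0" by (rule group_pi1)
  have "pcl gamma2 \<star> seg par0 (0, 1/2) (2, 1/2) =
      seg par0 (0, 1/2) (0, 0) \<star> seg par1 (0, 1) (0, 2) \<star> seg par1 (0, 2) (1, 2) \<star> seg par0 (2, 1) (2, 1/2)"
    using seg_top[of 0 1] by (simp add: pcl_gamma2 class_join_assoc seg_join0)
  also have "\<dots> = seg par0 (0, 1/2) (0, 0) \<star> seg par1 (0, 1) (1, 1) \<star> seg par1 (1, 1) (1, 2) \<star> seg par0 (2, 1) (2, 1/2)"
    by (simp add: seg_join1)
  also have "\<dots> = seg par0 (0, 1/2) (3, 1/2) \<star> seg par0 (3, 1/2) (3, 0) \<star> seg par1 (1, 1) (1, 2) \<star> seg par0 (2, 1) (2, 1/2)"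
    using seg_bottom[of 0 1] by (simp add: seg_join0)
  also have "seg par0 (3, 1/2) (3, 0) = seg par0 (0, 1/2) (0, 0)"
    using seg_shift0[of 0 3 "1/2" 0 0] by simp
  also have "seg par1 (1, 1) (1, 2) = seg par1 (0, 1) (0, 2)"
    using seg_shift1[of 0 1 1 0 2] by simp
  also have "seg par0 (2, 1) (2, 1/2) = seg par0 (0, 1) (0, 1/2)"
    using seg_shift0[of 0 2 1 0 "1/2"] by simp
  finally show ?thesis
    using gamma_carrier seg_loop_nat[of 2] seg_loop_nat[of 3]
    by (simp add: mult_fundamental_group pcl_gamma2)
qed

text \<open>
  Injectivity comes from the holonomy with values in \<open>BS(2,3)\<close> itself: composed with \<open>\<iota>\<close> it fixes
  both generators.
\<close>

lemma presentation_iso: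
  obtains \<iota> where "\<iota> \<in> iso BS23 (pi1_B base0)" "\<iota> bs_a = pcl gamma1" "\<iota> bs_b = pcl gamma2"
proof -
  interpret P: BS_relation "pi1_B base0" "pcl gamma1" "pcl gamma2"
    using group_pi1 gamma_carrier pi1_relation int_pow_int[of "pi1_B base0" _ 2] int_pow_int[of "pi1_B base0" _ 3]
    by (simp add: BS_relation_def BS_relation_axioms_def)
  obtain \<iota> where \<iota>: "\<iota> \<in> hom BS23 (pi1_B base0)" "\<iota> bs_a = pcl gamma1" "\<iota> bs_b = pcl gamma2"
    by (rule P.BS23_hom)
  have ab: "bs_a \<in> carrier BS23" "bs_b \<in> carrier BS23"
    by (simp_all add: BS23_def bs_a_def bs_b_def carrier_presented_group)
  interpret S: BS_relation BS23 bs_a bs_b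
    using group_BS23 ab BS23_relation int_pow_int[of BS23 _ 2] int_pow_int[of BS23 _ 3]
    by (simp add: BS_relation_def BS_relation_axioms_def)
  have left_inverse: "S.hol_class (\<iota> x) = x" if "x \<in> carrier BS23" for x
  proof -
    have f: "S.hol_class \<circ> \<iota> \<in> hom BS23 BS23"
      by (rule hom_compose[OF \<iota>(1) S.hol_class_hom])
    have i: "id \<in> hom BS23 BS23"
      by (simp add: hom_def)
    have "(S.hol_class \<circ> \<iota>) x = id x"
      by (rule hom_BS23_unique[OF group_BS23 f i _ _ that])
        (simp_all add: \<iota> S.hol_class_pcl path_gamma1 path_gamma2 S.hol_gamma1 S.hol_gamma2)
    then show ?thesis by simp
  qed
  then have "inj_on \<iota> (carrier BS23)"
    by (metis inj_onI)
  moreover have "\<iota> ` carrier BS23 = carrier (pi1_B base0)"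
  proof
    show "\<iota> ` carrier BS23 \<subseteq> carrier (pi1_B base0)"
      using \<iota>(1) by (auto simp: hom_def)
    interpret h: group_hom BS23 "pi1_B base0" \<iota>
      using \<iota>(1) group_BS23 group_pi1 by (simp add: group_hom_def group_hom_axioms_def)
    have "gens \<subseteq> \<iota> ` carrier BS23"
      using ab \<iota>(2,3) by (intro P.generate_subgroup_incl h.img_is_subgroup) (auto intro: rev_image_eqI)
    then show "carrier (pi1_B base0) \<subseteq> \<iota> ` carrier BS23"
      by (simp add: gens_eq)
  qed
  ultimately have "\<iota> \<in> iso BS23 (pi1_B base0)"
    using \<iota>(1) by (simp add: iso_def bij_betw_def)
  then show ?thesis
    using \<iota>(2,3) by (rule that)
qed

text \<open>
  Raising the relation to the power \<open>n\<close> shows that \<open>a\<^sup>n\<close> and \<open>b\<close> satisfy it again.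
\<close>

lemma BS23_power_hom:
  obtains \<phi> where "\<phi> \<in> hom BS23 BS23" "\<phi> bs_a = bs_a [^]\<^bsub>BS23\<^esub> (n::nat)" "\<phi> bs_b = bs_b"
proof -
  have ab: "bs_a \<in> carrier BS23" "bs_b \<in> carrier BS23"
    by (simp_all add: BS23_def bs_a_def bs_b_def carrier_presented_group)
  interpret S: BS_relation BS23 bs_a bs_b
    using group_BS23 ab BS23_relation int_pow_int[of BS23 _ 2] int_pow_int[of BS23 _ 3]
    by (simp add: BS_relation_def BS_relation_axioms_def)
  have p: "(bs_a [^]\<^bsub>BS23\<^esub> n) [^]\<^bsub>BS23\<^esub> (k::int) = bs_a [^]\<^bsub>BS23\<^esub> (k * int n)" for k
    by (simp add: S.int_pow_pow mult.commute flip: int_pow_int)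
  interpret T: BS_relation BS23 "bs_a [^]\<^bsub>BS23\<^esub> n" bs_b
  proof
    show "bs_b \<otimes>\<^bsub>BS23\<^esub> (bs_a [^]\<^bsub>BS23\<^esub> n) [^]\<^bsub>BS23\<^esub> (2::int) =
        (bs_a [^]\<^bsub>BS23\<^esub> n) [^]\<^bsub>BS23\<^esub> (3::int) \<otimes>\<^bsub>BS23\<^esub> bs_b"
      unfolding p by (rule S.relation_pow)
  qed simp_all
  show ?thesis
    by (rule T.BS23_hom) (rule that)
qed

text \<open>
  Both endomorphisms are treated at once. Only the winding number \<open>n\<close> of the transported \<open>\<gamma>\<^sub>1\<close>
  depends on the path; the statement on kernels holds because change of base point is injective.
\<close>

lemma change_base_induced:
  assumes \<iota>: "\<iota> \<in> hom BS23 (pi1_B base0)" "\<iota> bs_a = pcl gamma1" "\<iota> bs_b = pcl gamma2"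
    and \<phi>: "\<phi> \<in> hom BS23 BS23" "\<phi> bs_a = bs_a [^]\<^bsub>BS23\<^esub> n" "\<phi> bs_b = bs_b"
    and p: "path p" "p 0 = base0" "p 1 = base1"
    and 1: "change_base UNIV p (induced_map UNIV phi_tilde (pcl gamma1)) = seg par0 (0, 1/2) (real n, 1/2)"
    and 2: "change_base UNIV p (induced_map UNIV phi_tilde (pcl gamma2)) = pcl gamma2"
  shows "\<forall>g\<in>carrier BS23. change_base UNIV p (induced_map UNIV phi_tilde (\<iota> g)) = \<iota> (\<phi> g)"
    "kernel (pi1_B base0) (pi1_B base1) (induced_map UNIV phi_tilde) \<inter> \<iota> ` carrier BS23 =
      \<iota> ` {g \<in> carrier BS23. \<iota> (\<phi> g) = \<one>\<^bsub>pi1_B base0\<^esub>}"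
proof -
  have ab: "bs_a \<in> carrier BS23" "bs_b \<in> carrier BS23"
    by (simp_all add: BS23_def bs_a_def bs_b_def carrier_presented_group)
  interpret h: group_hom BS23 "pi1_B base0" \<iota>
    using \<iota>(1) group_BS23 group_pi1 by (simp add: group_hom_def group_hom_axioms_def)
  have ind: "induced_map UNIV phi_tilde \<in> hom (pi1_B base0) (pi1_B base1)"
    using induced_map_hom[OF continuous_phi_tilde, of base0] by (simp add: phi_base0)
  have cb: "change_base UNIV p \<in> hom (pi1_B base1) (pi1_B base0)"
    using change_base_hom[OF p(1)] p(2,3) by simp
  have f1: "change_base UNIV p \<circ> (induced_map UNIV phi_tilde \<circ> \<iota>) \<in> hom BS23 (pi1_B base0)"
    by (rule hom_compose[OF hom_compose[OF \<iota>(1) ind] cb])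
  have f2: "\<iota> \<circ> \<phi> \<in> hom BS23 (pi1_B base0)"
    by (rule hom_compose[OF \<phi>(1) \<iota>(1)])
  have "(change_base UNIV p \<circ> (induced_map UNIV phi_tilde \<circ> \<iota>)) g = (\<iota> \<circ> \<phi>) g"
    if "g \<in> carrier BS23" for g
    by (rule hom_BS23_unique[OF group_pi1 f1 f2 _ _ that])
      (simp_all add: \<iota> \<phi> ab 1 2 h.hom_nat_pow seg_loop_nat)
  then show *: "\<forall>g\<in>carrier BS23. change_base UNIV p (induced_map UNIV phi_tilde (\<iota> g)) = \<iota> (\<phi> g)"
    by simp
  have "induced_map UNIV phi_tilde (\<iota> g) = \<one>\<^bsub>pi1_B base1\<^esub> \<longleftrightarrow> \<iota> (\<phi> g) = \<one>\<^bsub>pi1_B base0\<^esub>"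
    if g: "g \<in> carrier BS23" for g
  proof
    assume "induced_map UNIV phi_tilde (\<iota> g) = \<one>\<^bsub>pi1_B base1\<^esub>"
    then show "\<iota> (\<phi> g) = \<one>\<^bsub>pi1_B base0\<^esub>"
      using * g hom_one[OF cb group_pi1 group_pi1] by metis
  next
    assume "\<iota> (\<phi> g) = \<one>\<^bsub>pi1_B base0\<^esub>"
    then show "induced_map UNIV phi_tilde (\<iota> g) = \<one>\<^bsub>pi1_B base1\<^esub>"
      using change_base_inj[OF p(1), of "induced_map UNIV phi_tilde (\<iota> g)"] p(2,3) * g
        induced_carrier[OF h.hom_closed[OF g]] by simp
  qed
  then show "kernel (pi1_B base0) (pi1_B base1) (induced_map UNIV phi_tilde) \<inter> \<iota> ` carrier BS23 =
      \<iota> ` {g \<in> carrier BS23. \<iota> (\<phi> g) = \<one>\<^bsub>pi1_B base0\<^esub>}"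
    by (auto simp: kernel_def)
qed

theorem mainTheorem2:
  shows
    "(\<forall>x\<in>pieces. pre_phi x \<in> pieces \<and> phi_tilde (abs_B x) = abs_B (pre_phi x))
     \<and> continuous_on UNIV phi_tilde
     \<and> induced_map UNIV phi_tilde \<in> hom (pi1_B base0) (pi1_B base1)
     \<and> generate (pi1_B base0) {homotopy_class UNIV gamma1, homotopy_class UNIV gamma2}
         = carrier (pi1_B base0)
     \<and> (\<exists>\<iota> \<phi> \<phi>'.
           \<iota> \<in> iso BS23 (pi1_B base0)
         \<and> \<iota> bs_a = homotopy_class UNIV gamma1
         \<and> \<iota> bs_b = homotopy_class UNIV gamma2
         \<and> \<phi> \<in> hom BS23 BS23
         \<and> \<phi> bs_a = bs_a [^]\<^bsub>BS23\<^esub> (2::nat) \<and> \<phi> bs_b = bs_b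
         \<and> \<phi>' \<in> hom BS23 BS23
         \<and> \<phi>' bs_a = bs_a [^]\<^bsub>BS23\<^esub> (3::nat) \<and> \<phi>' bs_b = bs_b
         \<and> kernel (pi1_B base0) (pi1_B base1) (induced_map UNIV phi_tilde) = \<iota> ` kernel BS23 BS23 \<phi>
         \<and> kernel BS23 BS23 \<phi> = kernel BS23 BS23 \<phi>'
         \<and> (\<forall>g\<in>carrier BS23.
              change_base UNIV path1 (induced_map UNIV phi_tilde (\<iota> g)) = \<iota> (\<phi> g))
         \<and> (\<forall>g\<in>carrier BS23.
              change_base UNIV path2 (induced_map UNIV phi_tilde (\<iota> g)) = \<iota> (\<phi>' g)))"
proof -
  obtain \<iota> where \<iota>: "\<iota> \<in> iso BS23 (pi1_B base0)" "\<iota> bs_a = pcl gamma1" "\<iota> bs_b = pcl gamma2"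
    by (rule presentation_iso)
  obtain \<phi> where \<phi>: "\<phi> \<in> hom BS23 BS23" "\<phi> bs_a = bs_a [^]\<^bsub>BS23\<^esub> (2::nat)" "\<phi> bs_b = bs_b"
    by (rule BS23_power_hom)
  obtain \<phi>' where \<phi>': "\<phi>' \<in> hom BS23 BS23" "\<phi>' bs_a = bs_a [^]\<^bsub>BS23\<^esub> (3::nat)" "\<phi>' bs_b = bs_b"
    by (rule BS23_power_hom)
  have \<iota>h: "\<iota> \<in> hom BS23 (pi1_B base0)" and inj: "inj_on \<iota> (carrier BS23)"
    and surj: "\<iota> ` carrier BS23 = carrier (pi1_B base0)"
    using \<iota>(1) by (auto simp: iso_def bij_betw_def)
  have K: "{g \<in> carrier BS23. \<iota> (\<psi> g) = \<one>\<^bsub>pi1_B base0\<^esub>} = kernel BS23 BS23 \<psi>"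
    if "\<psi> \<in> hom BS23 BS23" for \<psi>
  proof -
    have "\<iota> (\<psi> g) = \<one>\<^bsub>pi1_B base0\<^esub> \<longleftrightarrow> \<psi> g = \<one>\<^bsub>BS23\<^esub>" if "g \<in> carrier BS23" for g
      using inj_onD[OF inj, of "\<psi> g" "\<one>\<^bsub>BS23\<^esub>"] hom_one[OF \<iota>h group_BS23 group_pi1]
        hom_in_carrier[OF \<open>\<psi> \<in> hom BS23 BS23\<close> that] group.is_monoid[OF group_BS23] monoid.one_closed by metis
    then show ?thesis by (auto simp: kernel_def)
  qed
  have sub: "kernel (pi1_B base0) (pi1_B base1) (induced_map UNIV phi_tilde) \<inter> \<iota> ` carrier BS23 =
      kernel (pi1_B base0) (pi1_B base1) (induced_map UNIV phi_tilde)"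
    unfolding surj by (auto simp: kernel_def)
  note c1 = change_base_induced[OF \<iota>h \<iota>(2,3) \<phi> path_path12(1,3,5) _ path1_gamma2, unfolded sub K[OF \<phi>(1)]]
  note c2 = change_base_induced[OF \<iota>h \<iota>(2,3) \<phi>' path_path12(2,4,6) _ path2_gamma2, unfolded sub K[OF \<phi>'(1)]]
  have k: "kernel (pi1_B base0) (pi1_B base1) (induced_map UNIV phi_tilde) = \<iota> ` kernel BS23 BS23 \<phi>"
    "kernel (pi1_B base0) (pi1_B base1) (induced_map UNIV phi_tilde) = \<iota> ` kernel BS23 BS23 \<phi>'"
    using c1(2) c2(2) path1_gamma1 path2_gamma1 by simp_all
  have "\<iota> ` kernel BS23 BS23 \<phi> = \<iota> ` kernel BS23 BS23 \<phi>'"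
    using k by simp
  then have kk: "kernel BS23 BS23 \<phi> = kernel BS23 BS23 \<phi>'"
    using inj_on_image_eq_iff[OF inj, of "kernel BS23 BS23 \<phi>" "kernel BS23 BS23 \<phi>'"] by (auto simp: kernel_def)
  have ind: "induced_map UNIV phi_tilde \<in> hom (pi1_B base0) (pi1_B base1)"
    using induced_map_hom[OF continuous_phi_tilde, of base0] by (simp add: phi_base0)
  have wd: "\<forall>x\<in>pieces. pre_phi x \<in> pieces \<and> phi_tilde (abs_B x) = abs_B (pre_phi x)"
    using phi_tilde_abs by blast
  have cb: "\<forall>g\<in>carrier BS23. change_base UNIV path1 (induced_map UNIV phi_tilde (\<iota> g)) = \<iota> (\<phi> g)"
    "\<forall>g\<in>carrier BS23. change_base UNIV path2 (induced_map UNIV phi_tilde (\<iota> g)) = \<iota> (\<phi>' g)"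
    using c1(1) c2(1) path1_gamma1 path2_gamma1 by simp_all
  show ?thesis
    by (intro conjI wd continuous_phi_tilde ind gens_eq, rule exI[of _ \<iota>], rule exI[of _ \<phi>],
        rule exI[of _ \<phi>'], intro conjI \<iota> \<phi> \<phi>' k(1) kk cb)
qed

end
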